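(* Let $\alpha,\beta,\gamma\in\mathbb{R}$ satisfy $\alpha>-\frac12$, $\gamma\in(-1,-\frac12)$ and $H:=\alpha+\beta+\gamma+\frac32>0$, and let $X=\{X(t),t\ge 0\}$ be the Gaussian Volterra process $X(t)=\int_0^t r^\alpha\left(\int_r^t u^\beta(u-r)^\gamma\,du\right)dW_r$. Then there exist constants $\kappa_3,\kappa_4\in(0,\infty)$ such that, for all $t>0$, $r\in(0,t/2)$ and $0<\varepsilon<t^{\alpha+\beta}r^{\gamma+\frac32}$, $$\exp\left(-\kappa_3\, r\, t^{\frac{2\alpha+2\beta}{2\gamma+3}}\varepsilon^{-\frac{2}{2\gamma+3}}\right)\le \mathbb{P}\left\{\sup_{|s|\le r}|X(t+s)-X(t)|\le\varepsilon\right\}\le \exp\left(-\kappa_4\, r\, t^{\frac{2\alpha+2\beta}{2\gamma+3}}\varepsilon^{-\frac{2}{2\gamma+3}}\right).$$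
   Context: $W=\{W(t),t\ge0\}$ is a standard Brownian motion, the stochastic integral is a Wiener integral, and $X(0)=0$. Under the stated conditions on the parameters, $X$ is a well-defined centered Gaussian process, self-similar with index $H$; it is taken with continuous sample paths. *)

theory Defs
  imports "HOL-Probability.Probability"
begin

locale standard_brownian_motion = prob_space M
  for M :: "'a measure" and W :: "real \<Rightarrow> 'a \<Rightarrow> real" +
  assumes random_variable_W: "0 \<le> t \<Longrightarrow> W t \<in> borel_measurable M"
    and starts_at_zero: "AE \<omega> in M. W 0 \<omega> = 0"
    and gaussian_increments: "0 \<le> s \<Longrightarrow> s < t \<Longrightarrow>
      distributed M lborel (\<lambda>\<omega>. W t \<omega> - W s \<omega>) (normal_density 0 (sqrt (t - s)))"
    and independent_increments: "0 \<le> p 0 \<Longrightarrow> strict_mono_on {..n} p \<Longrightarrow>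
      indep_vars (\<lambda>_. borel) (\<lambda>i \<omega>. W (p (Suc i)) \<omega> - W (p i) \<omega>) {..<n}"
    and continuous_paths: "AE \<omega> in M. continuous_on {0..} (\<lambda>t. W t \<omega>)"

definition step_function :: "nat \<Rightarrow> (nat \<Rightarrow> real) \<Rightarrow> (nat \<Rightarrow> real) \<Rightarrow> real \<Rightarrow> real" where
  "step_function n p c u = (\<Sum>i<n. c i * indicator {p i<..p (Suc i)} u)"

definition step_integral ::
    "(real \<Rightarrow> 'a \<Rightarrow> real) \<Rightarrow> nat \<Rightarrow> (nat \<Rightarrow> real) \<Rightarrow> (nat \<Rightarrow> real) \<Rightarrow> 'a \<Rightarrow> real" where
  "step_integral W n p c \<omega> = (\<Sum>i<n. c i * (W (p (Suc i)) \<omega> - W (p i) \<omega>))"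

text \<open>
  The Wiener integral of a deterministic square-integrable function over the interval from 0 to T
  is the mean-square limit of the integrals of step functions that approximate it in mean square.
  It is determined only up to a null set, hence a relation: \<open>Y\<close> is a version of the integral of
  \<open>f\<close> with respect to \<open>W\<close>. The distances are nonnegative integrals, so that their convergence to 0
  cannot hold merely because an integrand is not integrable.
\<close>

definition has_wiener_integral ::
    "'a measure \<Rightarrow> (real \<Rightarrow> 'a \<Rightarrow> real) \<Rightarrow> real \<Rightarrow> (real \<Rightarrow> real) \<Rightarrow> ('a \<Rightarrow> real) \<Rightarrow> bool" where
  "has_wiener_integral M W T f Y \<longleftrightarrow>
     set_borel_measurable lborel {0..T} f \<and>
     set_integrable lborel {0..T} (\<lambda>u. (f u)\<^sup>2) \<and>
     Y \<in> borel_measurable M \<and>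
     (\<exists>n p c.
        (\<forall>k. 0 \<le> p k 0 \<and> mono_on {..n k} (p k) \<and> p k (n k) \<le> T) \<and>
        (\<lambda>k. \<integral>\<^sup>+u\<in>{0..T}. ennreal ((f u - step_function (n k) (p k) (c k) u)\<^sup>2) \<partial>lborel)
          \<longlonglongrightarrow> 0 \<and>
        (\<lambda>k. \<integral>\<^sup>+\<omega>. ennreal ((Y \<omega> - step_integral W (n k) (p k) (c k) \<omega>)\<^sup>2) \<partial>M)
          \<longlonglongrightarrow> 0)"

definition volterra_kernel :: "real \<Rightarrow> real \<Rightarrow> real \<Rightarrow> real \<Rightarrow> real \<Rightarrow> real" where
  "volterra_kernel \<alpha> \<beta> \<gamma> t r =
     r powr \<alpha> * (LBINT u:{r..t}. u powr \<beta> * (u - r) powr \<gamma>)"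

definition gaussian_volterra_process ::
    "'a measure \<Rightarrow> (real \<Rightarrow> 'a \<Rightarrow> real) \<Rightarrow> real \<Rightarrow> real \<Rightarrow> real \<Rightarrow> (real \<Rightarrow> 'a \<Rightarrow> real) \<Rightarrow> bool" where
  "gaussian_volterra_process M W \<alpha> \<beta> \<gamma> X \<longleftrightarrow>
     (\<forall>t\<ge>0. has_wiener_integral M W t (volterra_kernel \<alpha> \<beta> \<gamma> t) (X t)) \<and>
     (\<forall>\<omega>\<in>space M. X 0 \<omega> = 0) \<and>
     (\<forall>\<omega>\<in>space M. continuous_on {0..} (\<lambda>t. X t \<omega>))"

end

theory Submission
  imports Defs
begin

text \<open>
  Put \<open>\<delta> = \<gamma> + 3/2 \<in> (1/2, 1)\<close> and define \<open>N > 1\<close> by \<open>\<epsilon> = t powr (\<alpha> + \<beta>) * (r / N) powr \<delta>\<close>; both bounds are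
  exponentials of negative multiples of \<open>N\<close>. At times of order \<open>t\<close>, the variance of an increment of \<open>X\<close> over a
  step \<open>h\<close> and the variance of its part that is independent of the past are both of order
  \<open>(t powr (\<alpha> + \<beta>) * h powr \<delta>)\<^sup>2\<close>.

  Upper bound: condition successively on the past at \<open>\<lfloor>N\<rfloor>\<close> equidistant times in \<open>[t, t + r]\<close>; each fresh
  innovation has standard deviation at least of order \<open>\<epsilon>\<close> and costs a fixed factor below 1.

  Lower bound: dyadic chaining reduces the event to finitely many bounds on increments, and Sidak's
  inequality bounds the probability of their conjunction from below by the product of the individual
  probabilities. Sidak's inequality follows from the Prekopa-Leindler inequality: the Gaussian measure of
  a section of a symmetric convex set is an even log-concave, hence decreasing, function of the
  distance of the section from the origin.

  Both arguments are carried out for step functions on a common time grid, where everything is a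
  linear form in independent standard normal variables, and are transferred to the Wiener integrals
  by convergence in probability.
\<close>

section \<open>The Prekopa-Leindler inequality\<close>

text \<open>\<open>has_wiener_integral\<close> allows every time its own approximating step
  functions and says nothing about the joint law of \<open>X\<close> at several times. Merging the
  partitions that belong to finitely many times produces this joint Gaussian structure. The passage
  to the limit loses a constant factor in the threshold and another in the standard deviation, which
  only affects the two constants of the theorem.

  Increments of \<open>X\<close> over different steps are correlated. Sidak's inequality takes only
  upper bounds on their variances, whatever the correlations, while the upper bound takes only lower
  bounds on the variances of the innovations.

  The delicate point of the lower bound is that every dyadic level has a cost. Coarse levels have
  few increments, but these are much larger than \<open>\<epsilon>\<close>; fine levels have
  increments much smaller than \<open>\<epsilon>\<close>, but many of them. With
  \<open>1/2 < \<delta> < 1\<close>, both families of costs can be made to decay geometrically away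
  from the level at which increments are of order \<open>\<epsilon>\<close>, even after the
  tolerances have been made summable. For this, polynomial bounds on normal probabilities
  suffice.\<close>

lemma inner_regular_lborel:
  fixes A :: "real set"
  assumes A[measurable]: "A \<in> sets borel" and fin: "emeasure lborel A < \<infinity>"
  shows "emeasure lborel A = (SUP K\<in>{K. K \<subseteq> A \<and> compact K}. emeasure lborel K)"
proof -
  \<comment> \<open>Restricting Lebesgue measure to \<open>A\<close> gives a finite measure, to
    which inner regularity by compact sets applies.\<close>
  let ?M = "density lborel (indicator A)"
  have eq: "emeasure ?M K = emeasure lborel (A \<inter> K)" if "K \<in> sets borel" for K
    using that by (subst emeasure_density) (auto simp: indicator_inter_arith[symmetric])
  have "emeasure ?M A = (SUP K\<in>{K. K \<subseteq> A \<and> compact K}. emeasure ?M K)"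
    using fin by (intro inner_regular) (auto simp: eq)
  moreover have "emeasure ?M K = emeasure lborel K" if "K \<subseteq> A" "compact K" for K
    using that eq[of K] by (simp add: Int_absorb1 compact_imp_closed)
  moreover have "emeasure ?M A = emeasure lborel A" using eq[OF A] by simp
  ultimately show ?thesis by (metis (mono_tags, lifting) SUP_cong mem_Collect_eq)
qed

lemma emeasure_lborel_translate:
  fixes A :: "real set"
  assumes [measurable]: "A \<in> sets borel"
  shows "emeasure lborel {x. x - a \<in> A} = emeasure lborel A"
proof -
  have "emeasure lborel A = \<integral>\<^sup>+x. indicator A x \<partial>lborel" by simp
  also have "\<dots> = \<integral>\<^sup>+x. indicator A (-a + 1 * x) \<partial>lborel"
    by (subst nn_integral_real_affine[where c = 1 and t = "-a"]) auto
  also have "\<dots> = \<integral>\<^sup>+x. indicator {x. x - a \<in> A} x \<partial>lborel"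
    by (auto intro!: nn_integral_cong simp: indicator_def)
  also have "\<dots> = emeasure lborel {x. x - a \<in> A}" by simp
  finally show ?thesis ..
qed

text \<open>For compact \<open>K\<close> and \<open>L\<close>, let \<open>a\<close> be the maximum
  of \<open>K\<close> and \<open>b\<close> the minimum of \<open>L\<close>: the translate of
  \<open>K\<close> by \<open>b\<close> and the translate of \<open>L\<close> by \<open>a\<close>
  both lie in the sumset and meet only at \<open>a + b\<close>. Inner regularity extends this to
  Borel sets. The set \<open>C\<close> is any Borel set containing the sumset, since the sumset
  itself need not be Borel.\<close>

lemma brunn_minkowski_real:
  fixes A B C :: "real set"
  assumes [measurable]: "A \<in> sets borel" "B \<in> sets borel" "C \<in> sets borel"
    and ne: "A \<noteq> {}" "B \<noteq> {}"
    and fin: "emeasure lborel A < \<infinity>" "emeasure lborel B < \<infinity>"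
    and sub: "\<And>x y. x \<in> A \<Longrightarrow> y \<in> B \<Longrightarrow> x + y \<in> C"
  shows "emeasure lborel A + emeasure lborel B \<le> emeasure lborel C"
proof -
  have compact: "emeasure lborel K + emeasure lborel L \<le> emeasure lborel C"
    if KL: "K \<subseteq> A" "L \<subseteq> B" "compact K" "compact L" "K \<noteq> {}" "L \<noteq> {}" for K L
  proof -
    obtain a where a: "a \<in> K" "\<And>x. x \<in> K \<Longrightarrow> x \<le> a" using compact_attains_sup[OF KL(3,5)] by auto
    obtain b where b: "b \<in> L" "\<And>x. x \<in> L \<Longrightarrow> b \<le> x" using compact_attains_inf[OF KL(4,6)] by auto
    have [measurable]: "K \<in> sets borel" "L \<in> sets borel"
      using KL by (auto simp: compact_imp_closed)
    have "emeasure lborel K + emeasure lborel L =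
        emeasure lborel {x. x - b \<in> K} + emeasure lborel ({x. x - a \<in> L} - {a + b})"
      by (subst emeasure_Diff_null_set) (auto simp: emeasure_lborel_translate intro!: finite_imp_null_set_lborel)
    also have "\<dots> = emeasure lborel ({x. x - b \<in> K} \<union> ({x. x - a \<in> L} - {a + b}))"
      using a b by (intro plus_emeasure) (auto, smt (verit, best) a b)
    also have "\<dots> \<le> emeasure lborel C"
    proof (intro emeasure_mono subsetI)
      fix x assume "x \<in> {x. x - b \<in> K} \<union> ({x. x - a \<in> L} - {a + b})"
      then show "x \<in> C" using sub[of "x - b" b] sub[of a "x - a"] KL(1,2) a(1) b(1) by auto
    qed auto
    finally show ?thesis .
  qed
  have "emeasure lborel K + emeasure lborel L \<le> emeasure lborel C"
    if KL: "K \<subseteq> A" "L \<subseteq> B" "compact K" "compact L" for K L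
  proof -
    \<comment> \<open>The suprema taken at the end also range over empty compact sets. Adding one
      point makes both sets nonempty without decreasing their measures.\<close>
    obtain a b where ab: "a \<in> A" "b \<in> B" using ne by auto
    have "emeasure lborel K + emeasure lborel L \<le>
        emeasure lborel (insert a K) + emeasure lborel (insert b L)"
      using KL by (intro add_mono emeasure_mono) (auto simp: compact_imp_closed)
    also have "\<dots> \<le> emeasure lborel C" using KL ab by (intro compact) auto
    finally show ?thesis .
  qed
  moreover have "{K. K \<subseteq> A \<and> compact K} \<noteq> {}" "{K. K \<subseteq> B \<and> compact K} \<noteq> {}" by force+
  ultimately show ?thesis
    unfolding inner_regular_lborel[OF assms(1) fin(1)] inner_regular_lborel[OF assms(2) fin(2)]
    by (simp add: ennreal_SUP_add_left[symmetric] ennreal_SUP_add_right) (auto intro!: SUP_least)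
qed

section \<open>Prekopa-Leindler on the line\<close>

lemma nn_integral_layer_cake:
  fixes f :: "real \<Rightarrow> real"
  assumes [measurable]: "f \<in> borel_measurable borel" and nn: "\<And>x. 0 \<le> f x"
  shows "(\<integral>\<^sup>+x. ennreal (f x) \<partial>lborel) =
    (\<integral>\<^sup>+s. emeasure lborel {x. s < f x} * indicator {0<..} s \<partial>lborel)"
proof -
  have "(\<integral>\<^sup>+x. ennreal (f x) \<partial>lborel) =
      (\<integral>\<^sup>+x. \<integral>\<^sup>+s. indicator {0<..<f x} s \<partial>lborel \<partial>lborel)"
    using nn by (intro nn_integral_cong) simp
  also have "\<dots> = (\<integral>\<^sup>+x. \<integral>\<^sup>+s. indicator {x. s < f x} x * indicator {0<..} s \<partial>lborel \<partial>lborel)"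
    by (intro nn_integral_cong) (auto simp: indicator_def)
  also have "\<dots> = (\<integral>\<^sup>+s. \<integral>\<^sup>+x. indicator {x. s < f x} x * indicator {0<..} s \<partial>lborel \<partial>lborel)"
    by (intro lborel_pair.Fubini') (simp add: indicator_def)
  also have "\<dots> = (\<integral>\<^sup>+s. emeasure lborel {x. s < f x} * indicator {0<..} s \<partial>lborel)"
    by (intro nn_integral_cong, subst nn_integral_multc) auto
  finally show ?thesis .
qed

text \<open>With both suprema equal to 1, the superlevel sets of \<open>f\<close> and
  \<open>g\<close> at a level in \<open>(0, 1)\<close> are both nonempty, so Brunn-Minkowski applies
  level by level; from level 1 on both are empty. Without a common supremum one set could be empty
  and the other not, and the levelwise bound would fail.\<close>

lemma prekopa_leindler_normalized:
  fixes f g h :: "real \<Rightarrow> real"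
  assumes [measurable]: "f \<in> borel_measurable borel" "g \<in> borel_measurable borel" "h \<in> borel_measurable borel"
    and nn: "\<And>x. 0 \<le> f x" "\<And>x. 0 \<le> g x" "\<And>x. 0 \<le> h x"
    and int: "integrable lborel f" "integrable lborel g"
    and le1: "\<And>x. f x \<le> 1" "\<And>x. g x \<le> 1"
    and sup1: "\<And>s. s < 1 \<Longrightarrow> \<exists>x. s < f x" "\<And>s. s < 1 \<Longrightarrow> \<exists>x. s < g x"
    and lev: "\<And>s x y. 0 < s \<Longrightarrow> s < f x \<Longrightarrow> s < g y \<Longrightarrow> s < h (x + y)"
  shows "(\<integral>\<^sup>+x. ennreal (f x) \<partial>lborel) + (\<integral>\<^sup>+x. ennreal (g x) \<partial>lborel) \<le> (\<integral>\<^sup>+x. ennreal (h x) \<partial>lborel)"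
proof -
  have fin: "emeasure lborel {x. s < u x} < \<infinity>"
    if [measurable]: "integrable lborel u" and s: "0 < s" "\<And>x. 0 \<le> u x" for u :: "real \<Rightarrow> real" and s
  proof -
    have "ennreal s * emeasure lborel {x. s < u x} = (\<integral>\<^sup>+x. ennreal s * indicator {x. s < u x} x \<partial>lborel)"
      by (subst nn_integral_cmult) auto
    also have "\<dots> \<le> (\<integral>\<^sup>+x. ennreal (u x) \<partial>lborel)"
      using s by (intro nn_integral_mono) (auto simp: indicator_def ennreal_leI)
    also have "\<dots> < \<infinity>" using that(1) s(2) by (simp add: nn_integral_eq_integral)
    finally show ?thesis using s by (auto simp: ennreal_mult_less_top)
  qed
  have "(\<integral>\<^sup>+x. ennreal (f x) \<partial>lborel) + (\<integral>\<^sup>+x. ennreal (g x) \<partial>lborel) =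
    (\<integral>\<^sup>+s. (emeasure lborel {x. s < f x} + emeasure lborel {x. s < g x}) * indicator {0<..} s \<partial>lborel)"
    unfolding nn_integral_layer_cake[OF assms(1) nn(1)] nn_integral_layer_cake[OF assms(2) nn(2)]
    by (subst nn_integral_add[symmetric]) (auto simp: distrib_right)
  also have "\<dots> \<le> (\<integral>\<^sup>+s. emeasure lborel {x. s < h x} * indicator {0<..} s \<partial>lborel)"
  proof (intro nn_integral_mono)
    fix s :: real
    show "(emeasure lborel {x. s < f x} + emeasure lborel {x. s < g x}) * indicator {0<..} s \<le>
        emeasure lborel {x. s < h x} * indicator {0<..} s"
    proof (cases "0 < s \<and> s < 1")
      case True
      then have "emeasure lborel {x. s < f x} + emeasure lborel {x. s < g x} \<le> emeasure lborel {x. s < h x}"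
        using sup1[of s] lev[of s] fin int nn by (intro brunn_minkowski_real) auto
      then show ?thesis using True by simp
    next
      case False
      then have "s > 0 \<Longrightarrow> {x. s < f x} = {} \<and> {x. s < g x} = {}"
        using le1 by (auto simp: not_less) (meson order.trans)+
      then show ?thesis by (auto simp: indicator_def)
    qed
  qed
  also have "\<dots> = (\<integral>\<^sup>+x. ennreal (h x) \<partial>lborel)"
    using nn_integral_layer_cake[OF assms(3) nn(3)] by simp
  finally show ?thesis .
qed

text \<open>Stretching \<open>f\<close> and \<open>g\<close> by the factors \<open>1 - l\<close> and
  \<open>l\<close> turns the convex combination of arguments into a plain sum, and dividing by the
  suprema \<open>m\<close> and \<open>n\<close>, finite because of \<open>b\<close>, leads to the
  normalized case. This yields a weighted arithmetic mean of the two integrals, which Young's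
  inequality bounds from below by the geometric mean.\<close>

lemma prekopa_leindler_real:
  fixes f g h :: "real \<Rightarrow> real" and l :: real
  assumes l: "0 < l" "l < 1"
    and nn: "\<And>x. 0 \<le> f x" "\<And>x. 0 \<le> g x" "\<And>x. 0 \<le> h x"
    and int: "integrable lborel f" "integrable lborel g" "integrable lborel h"
    and bdd: "\<And>x. f x \<le> b" "\<And>x. g x \<le> b"
    and le: "\<And>x y. f x powr (1 - l) * g y powr l \<le> h ((1 - l) * x + l * y)"
  shows "(LBINT x. f x) powr (1 - l) * (LBINT x. g x) powr l \<le> (LBINT x. h x)"
proof (cases "(\<exists>x. f x \<noteq> 0) \<and> (\<exists>x. g x \<noteq> 0)")
  case False
  then have "(LBINT x. f x) = 0 \<or> (LBINT x. g x) = 0" by auto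
  then show ?thesis using nn(3) by auto
next
  case True
  have [measurable]: "f \<in> borel_measurable borel" "g \<in> borel_measurable borel" "h \<in> borel_measurable borel"
    using int by (auto dest: borel_measurable_integrable)
  define m n where "m = (SUP x. f x)" and "n = (SUP x. g x)"
  have bd: "bdd_above (range f)" "bdd_above (range g)" using bdd by (auto intro!: bdd_aboveI)
  have fm: "f x \<le> m" and gn: "g x \<le> n" for x
    using bd by (auto simp: m_def n_def intro: cSUP_upper)
  have pos: "0 < m" "0 < n" using True fm gn nn by (metis order_le_less order_le_less_trans)+
  have small: "\<exists>x. s * m < f x" "\<exists>x. s * n < g x" if "s < 1" for s
    using that pos less_cSUP_iff[OF _ bd(1), of "s * m"] less_cSUP_iff[OF _ bd(2), of "s * n"]
    by (auto simp: m_def[symmetric] n_def[symmetric])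
  \<comment> \<open>The divisor of \<open>h\<close> that balances dividing \<open>f\<close> by
    \<open>m\<close> and \<open>g\<close> by \<open>n\<close> in \<open>le\<close>.\<close>
  define k where "k = m powr (1 - l) * n powr l"
  have k: "0 < k" using pos by (simp add: k_def)
  define F G H where "F = (\<lambda>x. f (x / (1 - l)) / m)" and "G = (\<lambda>x. g (x / l) / n)" and "H = (\<lambda>x. h x / k)"
  have scale: "integrable lborel (\<lambda>x. u (x / c))" "(LBINT x. u (x / c)) = c * (LBINT x. u x)"
    if "integrable lborel u" "0 < c" for u :: "real \<Rightarrow> real" and c :: real
    using lborel_integrable_real_affine[OF that(1), of "1 / c" 0] that
      lborel_integral_real_affine[of c "\<lambda>x. u (x / c)" 0] by simp_all
  have intF: "integrable lborel F" "integrable lborel G" "integrable lborel H"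
    using scale(1)[OF int(1), of "1 - l"] scale(1)[OF int(2), of l] l int(3)
    by (auto simp: F_def G_def H_def)
  have nnF: "0 \<le> F x" "0 \<le> G x" "0 \<le> H x" for x
    using nn pos k by (simp_all add: F_def G_def H_def)
  have "(\<integral>\<^sup>+x. ennreal (F x) \<partial>lborel) + (\<integral>\<^sup>+x. ennreal (G x) \<partial>lborel) \<le> (\<integral>\<^sup>+x. ennreal (H x) \<partial>lborel)"
  proof (rule prekopa_leindler_normalized[OF _ _ _ nnF intF(1,2)])
    show "F x \<le> 1" "G x \<le> 1" for x using fm gn pos by (simp_all add: F_def G_def)
    fix s :: real assume s: "s < 1"
    obtain x y where "s * m < f x" "s * n < g y" using small[OF s] by auto
    then have "s < F ((1 - l) * x)" "s < G (l * y)"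
      using pos l by (simp_all add: F_def G_def pos_less_divide_eq)
    then show "\<exists>x. s < F x" "\<exists>x. s < G x" by auto
  next
    fix s x y :: real assume s: "0 < s" "s < F x" "s < G y"
    have "s = s powr (1 - l) * s powr l" using s by (simp flip: powr_add)
    also have "\<dots> < F x powr (1 - l) * G y powr l"
      using s l by (intro mult_strict_mono powr_less_mono2) auto
    also have "\<dots> = f (x / (1 - l)) powr (1 - l) * g (y / l) powr l / k"
      using nn pos by (simp add: F_def G_def k_def powr_divide)
    also have "\<dots> \<le> h (x + y) / k"
      using le[of "x / (1 - l)" "y / l"] k l by (intro divide_right_mono) auto
    finally show "s < H (x + y)" by (simp add: H_def)
  qed (use intF in \<open>auto dest: borel_measurable_integrable\<close>)
  then have "(LBINT x. F x) + (LBINT x. G x) \<le> (LBINT x. H x)"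
    using intF nnF by (simp add: nn_integral_eq_integral integral_nonneg flip: ennreal_plus)
  then have *: "(1 - l) * ((LBINT x. f x) / m) + l * ((LBINT x. g x) / n) \<le> (LBINT x. h x) / k"
    using scale(2)[OF int(1), of "1 - l"] scale(2)[OF int(2), of l] l by (simp add: F_def G_def H_def)
  show ?thesis
  proof (cases "(LBINT x. f x) = 0 \<or> (LBINT x. g x) = 0")
    case True
    then show ?thesis using nn(3) by auto
  next
    case False
    then have "0 < (LBINT x. f x) / m" "0 < (LBINT x. g x) / n"
      using nn pos by (auto simp: less_le)
    then have "((LBINT x. f x) / m) powr (1 - l) * ((LBINT x. g x) / n) powr l \<le> (LBINT x. h x) / k"
      using Youngs_inequality_0[of "1 - l" l "(LBINT x. f x) / m" "(LBINT x. g x) / n"] l * by simp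
    then show ?thesis using pos k nn by (simp add: powr_divide k_def field_simps)
  qed
qed

section \<open>Prekopa-Leindler for Gaussian measures\<close>

abbreviation std_gauss :: "real measure" where
  "std_gauss \<equiv> std_normal_distribution"

text \<open>The normal density is log-concave, so multiplying \<open>f\<close>, \<open>g\<close> and
  \<open>h\<close> by it preserves the hypothesis of the inequality for Lebesgue measure.\<close>

lemma prekopa_leindler_std_normal:
  fixes f g h :: "real \<Rightarrow> real"
  assumes l: "0 < l" "l < 1"
    and [measurable]: "f \<in> borel_measurable borel" "g \<in> borel_measurable borel" "h \<in> borel_measurable borel"
    and bnd: "\<And>x. f x \<in> {0..1}" "\<And>x. g x \<in> {0..1}" "\<And>x. h x \<in> {0..1}"
    and le: "\<And>x y. f x powr (1 - l) * g y powr l \<le> h ((1 - l) * x + l * y)"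
  shows "(LINT x|std_gauss. f x) powr (1 - l) * (LINT x|std_gauss. g x) powr l
    \<le> (LINT x|std_gauss. h x)"
proof -
  let ?p = std_normal_density
  have eq: "(LINT x|std_gauss. u x) = (LBINT x. ?p x * u x)"
    if "u \<in> borel_measurable borel" for u :: "real \<Rightarrow> real"
    using that by (subst integral_density) auto
  have int: "integrable lborel (\<lambda>x. ?p x * u x)"
    if "u \<in> borel_measurable borel" "\<And>x. u x \<in> {0..1}" for u :: "real \<Rightarrow> real"
    using that by (intro Bochner_Integration.integrable_bound[OF integrable_std_normal_moment[of 0]])
      (auto simp: abs_mult intro!: mult_left_le)
  have le1: "?p x * u \<le> 1" if "u \<in> {0..1}" for x u
  proof -
    have "?p x \<le> ?p 0" by (auto simp: std_normal_density_def intro!: divide_right_mono)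
    also have "\<dots> \<le> 1" using pi_gt3 by (simp add: std_normal_density_def)
    finally show ?thesis using that by (intro mult_le_one) auto
  qed
  have "?p x powr (1 - l) * ?p y powr l \<le> ?p ((1 - l) * x + l * y)" for x y
  proof -
    have "?p x powr (1 - l) * ?p y powr l = (1 / sqrt (2 * pi)) * exp (- ((1 - l) * (x\<^sup>2 / 2) + l * (y\<^sup>2 / 2)))"
    proof -
      define k where "k = 1 / sqrt (2 * pi)"
      have k: "k > 0" "k powr (1 - l) * k powr l = k" by (simp_all add: k_def flip: powr_add)
      have p: "?p z = k * exp (- (z\<^sup>2 / 2))" for z by (simp add: std_normal_density_def k_def)
      have "?p x powr (1 - l) * ?p y powr l =
          (k powr (1 - l) * k powr l) * (exp (- (x\<^sup>2 / 2)) powr (1 - l) * exp (- (y\<^sup>2 / 2)) powr l)"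
        using k(1) by (simp only: p powr_mult) (simp add: mult_ac)
      also have "\<dots> = k * exp (- ((1 - l) * (x\<^sup>2 / 2) + l * (y\<^sup>2 / 2)))"
        by (simp only: k(2) exp_powr_real mult_exp_exp) (simp add: algebra_simps)
      finally show ?thesis by (simp add: k_def)
    qed
    also have "((1 - l) * x + l * y)\<^sup>2 \<le> (1 - l) * x\<^sup>2 + l * y\<^sup>2"
    proof -
      have "(1 - l) * x\<^sup>2 + l * y\<^sup>2 - ((1 - l) * x + l * y)\<^sup>2 = l * (1 - l) * (x - y)\<^sup>2"
        by (simp add: power2_eq_square algebra_simps)
      moreover have "0 \<le> l * (1 - l) * (x - y)\<^sup>2" using l by simp
      ultimately show ?thesis by linarith
    qed
    then have "(1 / sqrt (2 * pi)) * exp (- ((1 - l) * (x\<^sup>2 / 2) + l * (y\<^sup>2 / 2))) \<le> ?p ((1 - l) * x + l * y)"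
      by (auto simp: std_normal_density_def intro!: mult_left_mono divide_right_mono)
    finally show ?thesis .
  qed
  then have "(?p x * f x) powr (1 - l) * (?p y * g y) powr l \<le>
      ?p ((1 - l) * x + l * y) * h ((1 - l) * x + l * y)" for x y
  proof -
    have nn: "0 \<le> f x" "0 \<le> g y" using bnd by auto
    then have "(?p x * f x) powr (1 - l) * (?p y * g y) powr l =
        (?p x powr (1 - l) * ?p y powr l) * (f x powr (1 - l) * g y powr l)"
      by (simp add: powr_mult mult_ac)
    also have "\<dots> \<le> ?p ((1 - l) * x + l * y) * h ((1 - l) * x + l * y)"
      using \<open>\<And>x y. ?p x powr (1 - l) * ?p y powr l \<le> ?p ((1 - l) * x + l * y)\<close> le
      by (intro mult_mono) auto
    finally show ?thesis .
  qed
  then show ?thesis unfolding eq[OF assms(3)] eq[OF assms(4)] eq[OF assms(5)]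
    using bnd by (intro prekopa_leindler_real[OF l, where b = 1] int le1 assms) auto
qed

abbreviation gauss_product :: "nat set \<Rightarrow> (nat \<Rightarrow> real) measure" where
  "gauss_product I \<equiv> Pi\<^sub>M I (\<lambda>_. std_gauss)"

interpretation std_normal: real_distribution std_gauss
  by (rule real_dist_normal_dist)

interpretation gauss: product_prob_space "\<lambda>_::nat. std_gauss" I for I
  by unfold_locales

lemma measurable_gauss_component [measurable]:
  "i \<in> I \<Longrightarrow> (\<lambda>x. x i) \<in> borel_measurable (gauss_product I)"
  using measurable_component_singleton[of i I "\<lambda>_. std_gauss"]
  by (simp cong: measurable_cong_sets)

lemma measure_gauss_product_space: "measure (gauss_product I) (space (gauss_product I)) = 1"
  by (intro prob_space.prob_space prob_space_PiM std_normal.prob_space_axioms)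

text \<open>Induction on the number of coordinates: the one-dimensional inequality, applied to the
  slices of \<open>f\<close>, \<open>g\<close> and \<open>h\<close> in the new coordinate, is
  exactly the hypothesis for the functions from which that coordinate has been integrated
  out.\<close>

lemma prekopa_leindler_gauss_product:
  fixes f g h :: "(nat \<Rightarrow> real) \<Rightarrow> real"
  assumes l: "0 < l" "l < 1" and "finite I"
    and "f \<in> borel_measurable (gauss_product I)" "g \<in> borel_measurable (gauss_product I)"
      "h \<in> borel_measurable (gauss_product I)"
    and "\<And>x. f x \<in> {0..1}" "\<And>x. g x \<in> {0..1}" "\<And>x. h x \<in> {0..1}"
    and "\<And>x y. f x powr (1 - l) * g y powr l \<le> h (\<lambda>i. (1 - l) * x i + l * y i)"
  shows "(\<integral>x. f x \<partial>gauss_product I) powr (1 - l) * (\<integral>x. g x \<partial>gauss_product I) powr l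
    \<le> (\<integral>x. h x \<partial>gauss_product I)"
proof -
  \<comment> \<open>The hypotheses are restated on the space of the product because slices in one
    coordinate are known to be measurable only at points of that space. The convex combination is
    restricted to \<open>I\<close> in order to stay in it.\<close>
  define P where "P I f g h \<longleftrightarrow> (\<forall>u\<in>{f,g,h}. u \<in> borel_measurable (gauss_product I) \<and> (\<forall>x\<in>space (gauss_product I). u x \<in> {0..1})) \<and>
    (\<forall>x\<in>space (gauss_product I). \<forall>y\<in>space (gauss_product I). f x powr (1 - l) * g y powr l \<le> h (\<lambda>i\<in>I. (1 - l) * x i + l * y i))"
    for I :: "nat set" and f g h :: "(nat \<Rightarrow> real) \<Rightarrow> real"
  have "P I f g h"
  proof -
    have "h (\<lambda>i\<in>I. (1 - l) * x i + l * y i) = h (\<lambda>i. (1 - l) * x i + l * y i)"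
      if "x \<in> space (gauss_product I)" "y \<in> space (gauss_product I)" for x y
    proof -
      have "(\<lambda>i\<in>I. (1 - l) * x i + l * y i) = (\<lambda>i. (1 - l) * x i + l * y i)"
      proof
        fix i
        \<comment> \<open>Outside \<open>I\<close> both points have the default value
          \<open>undefined\<close>, and a convex combination of equal values is that value
          again.\<close>
        have "i \<notin> I \<Longrightarrow> x i = undefined \<and> y i = undefined" using that by (metis PiE_arb space_PiM)
        then show "(\<lambda>i\<in>I. (1 - l) * x i + l * y i) i = (1 - l) * x i + l * y i"
          by (cases "i \<in> I") (simp_all add: algebra_simps)
      qed
      then show ?thesis by simp
    qed
    with assms(10) have "f x powr (1 - l) * g y powr l \<le> h (\<lambda>i\<in>I. (1 - l) * x i + l * y i)"
      if "x \<in> space (gauss_product I)" "y \<in> space (gauss_product I)" for x y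
      using that by presburger
    moreover have "u \<in> borel_measurable (gauss_product I)" "u x \<in> {0..1}" if "u \<in> {f, g, h}" for u x
      using that assms(4-9) by blast+
    ultimately show ?thesis unfolding P_def by blast
  qed
  with \<open>finite I\<close> show ?thesis
  proof (induction I arbitrary: f g h rule: finite_induct)
    case empty
    then show ?case
      by (auto simp: P_def PiM_empty space_PiM lebesgue_integral_count_space_finite restrict_def)
  next
    case (insert i I)
    let ?N = "gauss_product I" and ?m = "\<lambda>x y. \<lambda>k\<in>I. (1 - l) * x k + l * y k"
    have upd: "x(i := s) \<in> space (gauss_product (insert i I))" if "x \<in> space ?N" for x s
      using that insert.hyps by (auto simp: space_PiM PiE_def extensional_def)
    have meas[measurable]: "u \<in> borel_measurable (gauss_product (insert i I))" if "u \<in> {f, g, h}" for u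
      using insert.prems that by (auto simp: P_def)
    have bnd: "u x \<in> {0..1}" if "u \<in> {f, g, h}" "x \<in> space (gauss_product (insert i I))" for u x
      using insert.prems that by (auto simp: P_def)
    have meas1: "(\<lambda>s. u (x(i := s))) \<in> borel_measurable borel" if u: "u \<in> {f, g, h}" and x: "x \<in> space ?N" for u x
      using measurable_comp[OF measurable_component_update[OF x insert.hyps(2)] meas[OF u]]
      by (simp add: comp_def cong: measurable_cong_sets)
    have fold: "(\<integral>x. u x \<partial>gauss_product (insert i I)) = (\<integral>x. (\<integral>s. u (x(i := s)) \<partial>std_gauss) \<partial>?N)"
      if u: "u \<in> {f, g, h}" for u
      using bnd[OF u] meas[OF u] insert.hyps
      by (intro gauss.product_integral_insert gauss.integrable_const_bound[where B = 1]) auto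
    have "P I (\<lambda>x. \<integral>s. f (x(i := s)) \<partial>std_gauss)
       (\<lambda>x. \<integral>s. g (x(i := s)) \<partial>std_gauss)
       (\<lambda>x. \<integral>s. h (x(i := s)) \<partial>std_gauss)"
    proof -
      have "(\<lambda>x. \<integral>s. u (x(i := s)) \<partial>std_gauss) \<in> borel_measurable ?N" if u: "u \<in> {f, g, h}" for u
        using meas[OF u] by measurable
      moreover have "(\<integral>s. u (x(i := s)) \<partial>std_gauss) \<in> {0..1}" if u: "u \<in> {f, g, h}" "x \<in> space ?N" for u x
        using bnd[OF u(1) upd[OF u(2)]]
        by (auto intro!: std_normal.integral_le_const std_normal.integrable_const_bound[where B = 1] meas1[OF u])
      moreover have "(\<integral>s. f (x(i := s)) \<partial>std_gauss) powr (1 - l) *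
          (\<integral>s. g (y(i := s)) \<partial>std_gauss) powr l
          \<le> (\<integral>s. h ((?m x y)(i := s)) \<partial>std_gauss)"
        if xy: "x \<in> space ?N" "y \<in> space ?N" for x y
      proof (rule prekopa_leindler_std_normal[OF l])
        have m: "?m x y \<in> space ?N" by (auto simp: space_PiM)
        show "(\<lambda>s. f (x(i := s))) \<in> borel_measurable borel" "(\<lambda>s. g (y(i := s))) \<in> borel_measurable borel"
          "(\<lambda>s. h ((?m x y)(i := s))) \<in> borel_measurable borel"
          using meas1 xy m by auto
        show "f (x(i := s)) \<in> {0..1}" "g (y(i := s)) \<in> {0..1}" "h ((?m x y)(i := s)) \<in> {0..1}" for s
          using bnd upd xy m by blast+
        fix s s'
        have "f (x(i := s)) powr (1 - l) * g (y(i := s')) powr l \<le>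
            h (\<lambda>k\<in>insert i I. (1 - l) * (x(i := s)) k + l * (y(i := s')) k)"
          using insert.prems upd[OF xy(1), of s] upd[OF xy(2), of s'] unfolding P_def by blast
        also have "(\<lambda>k\<in>insert i I. (1 - l) * (x(i := s)) k + l * (y(i := s')) k) = (?m x y)(i := (1 - l) * s + l * s')"
          using insert.hyps by (auto simp: fun_eq_iff)
        finally show "f (x(i := s)) powr (1 - l) * g (y(i := s')) powr l \<le> h ((?m x y)(i := (1 - l) * s + l * s'))" .
      qed
      ultimately show ?thesis by (auto simp: P_def)
    qed
    from insert.IH[OF this] show ?case by (simp only: fold insert_iff simp_thms)
  qed
qed

section \<open>Sections of symmetric convex sets under Gaussian measure\<close>

lemma distr_std_normal_uminus: "distr std_gauss borel uminus = std_gauss"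
proof -
  have "distributed std_gauss lborel (\<lambda>x. x) std_normal_density"
    by (auto simp: distributed_def distr_id2)
  from std_normal.normal_density_affine[OF this, of "-1" 0]
  have "distr std_gauss lborel uminus = std_gauss" by (simp add: distributed_def)
  then show ?thesis by (metis distr_cong sets_lborel)
qed

lemma distr_gauss_product_uminus:
  assumes "finite I"
  shows "distr (gauss_product I) (gauss_product I) (\<lambda>x. \<lambda>i\<in>I. - x i) = gauss_product I"
proof (rule gauss.PiM_eqI[OF assms])
  fix A :: "nat \<Rightarrow> real set" assume A: "\<And>i. i \<in> I \<Longrightarrow> A i \<in> sets std_gauss"
  have [measurable]: "(\<lambda>x. \<lambda>i\<in>I. - x i) \<in> measurable (gauss_product I) (gauss_product I)"
    by (intro measurable_restrict) (simp cong: measurable_cong_sets)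
  have "emeasure (distr (gauss_product I) (gauss_product I) (\<lambda>x. \<lambda>i\<in>I. - x i)) (Pi\<^sub>E I A) =
      emeasure (gauss_product I) ((\<lambda>x. \<lambda>i\<in>I. - x i) -` Pi\<^sub>E I A \<inter> space (gauss_product I))"
    using A assms by (intro emeasure_distr) (auto intro!: sets_PiM_I_finite)
  also have "(\<lambda>x. \<lambda>i\<in>I. - x i) -` Pi\<^sub>E I A \<inter> space (gauss_product I) = Pi\<^sub>E I (\<lambda>i. uminus -` A i)"
    by (auto simp: space_PiM PiE_iff)
  also have "emeasure (gauss_product I) \<dots> = (\<Prod>i\<in>I. emeasure std_gauss (uminus -` A i))"
    using A by (intro gauss.emeasure_PiM assms)
      (auto intro!: measurable_sets_borel[where f = uminus] borel_measurable_continuous_onI continuous_intros)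
  also have "\<dots> = (\<Prod>i\<in>I. emeasure std_gauss (A i))"
    using A by (intro prod.cong refl, subst (2) distr_std_normal_uminus[symmetric], subst emeasure_distr) auto
  finally show "emeasure (distr (gauss_product I) (gauss_product I) (\<lambda>x. \<lambda>i\<in>I. - x i)) (Pi\<^sub>E I A) =
      (\<Prod>i\<in>I. emeasure std_gauss (A i))" .
qed simp

text \<open>The points \<open>(s, x)\<close> with \<open>K s x\<close> form a symmetric convex set,
  and \<open>K s\<close> is its section at \<open>s\<close>. Symmetry makes the measure of the
  section even in \<open>s\<close>. If \<open>s\<close> is strictly smaller than \<open>s'\<close>
  in absolute value, it is a convex combination of \<open>s'\<close> and \<open>- s'\<close>, and
  Prekopa-Leindler bounds its section from below by a geometric mean of two equal numbers. The
  argument is that of Anderson's inequality.\<close>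

lemma gauss_section_antimono:
  fixes K :: "real \<Rightarrow> (nat \<Rightarrow> real) \<Rightarrow> bool"
  assumes "finite I" and [measurable]: "\<And>s. Measurable.pred (gauss_product I) (K s)"
    and sym: "\<And>s x. K s x \<Longrightarrow> K (- s) (\<lambda>i. - x i)"
    and ext: "\<And>s x. K s (\<lambda>i\<in>I. x i) = K s x"
    and conv: "\<And>s s' x y l. K s x \<Longrightarrow> K s' y \<Longrightarrow> 0 < l \<Longrightarrow> l < 1 \<Longrightarrow>
      K ((1 - l) * s + l * s') (\<lambda>i. (1 - l) * x i + l * y i)"
    and le: "\<bar>s\<bar> \<le> \<bar>s'\<bar>"
  shows "measure (gauss_product I) {x\<in>space (gauss_product I). K s' x}
    \<le> measure (gauss_product I) {x\<in>space (gauss_product I). K s x}"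
proof -
  let ?N = "gauss_product I"
  define p where "p s = measure ?N {x\<in>space ?N. K s x}" for s
  have p: "p s = (\<integral>x. of_bool (K s x) \<partial>?N)" for s
  proof -
    have "(\<integral>x. of_bool (K s x) \<partial>?N) = (\<integral>x. indicator {x\<in>space ?N. K s x} x \<partial>?N)"
      by (intro Bochner_Integration.integral_cong) auto
    also have "\<dots> = p s"
      unfolding p_def by (subst Bochner_Integration.integral_indicator) (auto intro!: arg_cong2[where f = measure])
    finally show ?thesis ..
  qed
  have K_uminus: "K (- s) x \<longleftrightarrow> K s (\<lambda>i. - x i)" for s x
    using sym[of s "\<lambda>i. - x i"] sym[of "- s" x] by auto
  have even: "p (- s) = p s" for s
  proof -
    have m: "(\<lambda>x. \<lambda>i\<in>I. - x i) \<in> measurable ?N ?N"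
      by (intro measurable_restrict) (simp cong: measurable_cong_sets)
    have "p s = measure (distr ?N ?N (\<lambda>x. \<lambda>i\<in>I. - x i)) {x\<in>space ?N. K s x}"
      by (simp add: p_def distr_gauss_product_uminus[OF assms(1)])
    also have "\<dots> = measure ?N ((\<lambda>x. \<lambda>i\<in>I. - x i) -` {x\<in>space ?N. K s x} \<inter> space ?N)"
      by (intro measure_distr m) measurable
    also have "(\<lambda>x. \<lambda>i\<in>I. - x i) -` {x\<in>space ?N. K s x} \<inter> space ?N = {x\<in>space ?N. K (- s) x}"
      using ext[of s "\<lambda>i. - x i" for x] by (auto simp: K_uminus space_PiM)
    finally show ?thesis by (simp add: p_def)
  qed
  show ?thesis
  proof (cases "\<bar>s\<bar> = \<bar>s'\<bar>")
    case True
    then have "s = s' \<or> s = - s'" by auto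
    with even[of s'] show ?thesis by (auto simp: p_def)
  next
    case False
    \<comment> \<open>The weight that solves \<open>s = (1 - l) * s' + l * (- s')\<close>.\<close>
    define l where "l = (s' - s) / (2 * s')"
    have l: "0 < l" "l < 1" and s: "s = (1 - l) * s' + l * (- s')"
      using le False by (auto simp: l_def field_simps abs_if split: if_splits)
    have "p s' powr (1 - l) * p (- s') powr l \<le> p s"
      unfolding p using conv[of s' _ "- s'" _ l] l s
      by (intro prekopa_leindler_gauss_product assms(1)) (auto simp: of_bool_def)
    then have "p s' powr (1 - l) * p s' powr l \<le> p s" by (simp add: even)
    moreover have "p s' powr (1 - l) * p s' powr l = p s'"
      by (simp add: p_def measure_nonneg flip: powr_add)
    ultimately show ?thesis by (simp add: p_def)
  qed
qed

section \<open>Correlation of a slab with a symmetric convex set\<close>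

text \<open>An instance of Chebyshev's association inequality. A threshold \<open>t\<close>
  separates the values of \<open>f\<close> on \<open>S\<close> from those off \<open>S\<close>, so
  the mean of \<open>f\<close> over \<open>S\<close> is at least \<open>t\<close> and its mean over
  the complement at most \<open>t\<close>. Bounds multiplied by the two probabilities avoid
  conditioning on a null set.\<close>

lemma (in prob_space) integral_decreasing_event:
  fixes f :: "'a \<Rightarrow> real"
  assumes [measurable]: "f \<in> borel_measurable M" "S \<in> sets M"
    and bnd: "\<And>x. f x \<in> {0..1}"
    and le: "\<And>x y. x \<in> S \<Longrightarrow> y \<notin> S \<Longrightarrow> f y \<le> f x"
  shows "prob S * expectation f \<le> expectation (\<lambda>x. indicator S x * f x)"
proof -
  have int: "integrable M f" "integrable M (\<lambda>x. indicator S x * f x)"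
    using bnd by (auto intro!: integrable_const_bound[where B = 1] simp: indicator_def)
  have int_t: "integrable M (\<lambda>x. indicator S x * t)" for t :: real
    by (intro integrable_const_bound[where B = "\<bar>t\<bar>"]) (auto simp: indicator_def)
  \<comment> \<open>The supremum of \<open>f\<close> off \<open>S\<close> separates. If
    \<open>S\<close> is everything, nothing lies off \<open>S\<close>, and \<open>0\<close> is below
    all values of \<open>f\<close>.\<close>
  obtain t where t: "\<And>x. x \<in> S \<Longrightarrow> t \<le> f x" "\<And>y. y \<notin> S \<Longrightarrow> f y \<le> t"
  proof (cases "S = UNIV")
    case True
    then show ?thesis using bnd by (intro that[of 0]) auto
  next
    case False
    have "bdd_above (f ` (- S))" using bnd by (auto intro!: bdd_aboveI[of _ 1])
    with False le show ?thesis
      by (intro that[of "SUP y\<in>- S. f y"]) (auto intro!: cSUP_least cSUP_upper)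
  qed
  let ?u = "expectation (\<lambda>x. indicator S x * f x)"
  have "prob S * t = expectation (\<lambda>x. indicator S x * t)" by simp
  also have "\<dots> \<le> ?u" using t by (intro integral_mono int int_t) (auto simp: indicator_def)
  finally have 1: "prob S * t \<le> ?u" .
  have "expectation f - ?u = expectation (\<lambda>x. f x - indicator S x * f x)" using int by simp
  also have "\<dots> \<le> expectation (\<lambda>x. t - indicator S x * t)"
    using t by (intro integral_mono Bochner_Integration.integrable_diff int int_t) (auto simp: indicator_def)
  also have "\<dots> = (1 - prob S) * t"
    using int_t[of t] by (subst Bochner_Integration.integral_diff) (auto simp: prob_space algebra_simps)
  finally have 2: "expectation f - ?u \<le> (1 - prob S) * t" .
  have "prob S * (expectation f - ?u) \<le> prob S * ((1 - prob S) * t)"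
    by (intro mult_left_mono 2) simp
  also have "\<dots> = (1 - prob S) * (prob S * t)" by simp
  also have "\<dots> \<le> (1 - prob S) * ?u" using prob_le_1 by (intro mult_left_mono 1) simp
  finally show ?thesis by (simp add: algebra_simps)
qed


text \<open>Given that coordinate \<open>i\<close> equals \<open>s\<close>, the event described by
  \<open>K\<close> has probability \<open>f s\<close>, which decreases in the absolute value of
  \<open>s\<close> by \<open>gauss_section_antimono\<close>. The slab is a symmetric interval in
  this coordinate, so the association inequality applies after Fubini.\<close>

lemma gauss_product_slab_correlation:
  fixes K :: "real \<Rightarrow> (nat \<Rightarrow> real) \<Rightarrow> bool"
  assumes I: "finite I" "i \<notin> I"
    and K[measurable]: "Measurable.pred (gauss_product (insert i I)) (\<lambda>x. K (x i) x)"
    and sym: "\<And>s x. K s x \<Longrightarrow> K (- s) (\<lambda>k. - x k)"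
    and ext: "\<And>s x. K s (\<lambda>k\<in>I. x k) = K s x"
    and conv: "\<And>s s' x y l. K s x \<Longrightarrow> K s' y \<Longrightarrow> 0 < l \<Longrightarrow> l < 1 \<Longrightarrow>
      K ((1 - l) * s + l * s') (\<lambda>k. (1 - l) * x k + l * y k)"
  shows "measure std_gauss {s. \<bar>d * s\<bar> \<le> c} *
      measure (gauss_product (insert i I)) {x\<in>space (gauss_product (insert i I)). K (x i) x}
    \<le> measure (gauss_product (insert i I))
        {x\<in>space (gauss_product (insert i I)). \<bar>d * x i\<bar> \<le> c \<and> K (x i) x}"
proof -
  let ?N = "gauss_product I" and ?N' = "gauss_product (insert i I)"
  \<comment> \<open>By \<open>ext\<close> and \<open>i \<notin> I\<close>, the predicate sees
    coordinate \<open>i\<close> only through its first argument.\<close>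
  have K_upd: "K s (x(i := s')) = K s x" for s s' x
    using ext[of s x] ext[of s "x(i := s')"] I(2) by (metis (no_types, lifting) fun_upd_other restrict_ext)
  have upd: "x(i := s) \<in> space ?N'" if "x \<in> space ?N" for x s
    using that I by (auto simp: space_PiM PiE_def extensional_def)
  have Ks: "Measurable.pred ?N (K s)" for s
  proof -
    have "(\<lambda>x. x(i := s)) \<in> measurable ?N ?N'"
      using I by (intro measurable_fun_upd[where J = I]) auto
    from measurable_compose[OF this K] show ?thesis by (simp add: K_upd)
  qed
  define f where "f s = measure ?N {x\<in>space ?N. K s x}" for s
  have f01: "0 \<le> f s" "f s \<le> 1" for s by (simp_all add: f_def)
  have fold: "measure ?N' {x\<in>space ?N'. P (x i) \<and> K (x i) x} =
      (\<integral>s. indicator {s. P s} s * f s \<partial>std_gauss) \<and> f \<in> borel_measurable borel"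
    if [measurable]: "Measurable.pred borel P" for P
  proof -
    let ?A = "{x\<in>space ?N'. P (x i) \<and> K (x i) x}"
    have Kp: "(\<lambda>x. K (fst x) (snd x)) \<in> measurable (std_gauss \<Otimes>\<^sub>M ?N) (count_space UNIV)"
    proof -
      have "(\<lambda>x. (snd x)(i := fst x)) \<in> measurable (std_gauss \<Otimes>\<^sub>M ?N) ?N'"
        using I by (intro measurable_fun_upd[where J = I]) auto
      from measurable_compose[OF this K] show ?thesis by (simp add: K_upd)
    qed
    have f: "f = (\<lambda>s. \<integral>x. of_bool (K s x) \<partial>?N)"
    proof
      fix s
      have "(\<integral>x. of_bool (K s x) \<partial>?N) = (\<integral>x. indicator {x\<in>space ?N. K s x} x \<partial>?N)"
        by (intro Bochner_Integration.integral_cong) auto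
      also have "\<dots> = f s"
        unfolding f_def by (subst Bochner_Integration.integral_indicator) (auto intro!: arg_cong2[where f = measure])
      finally show "f s = (\<integral>x. of_bool (K s x) \<partial>?N)" ..
    qed
    have fm: "f \<in> borel_measurable std_gauss"
      unfolding f using measurable_compose[OF Kp, of of_bool borel]
      by (intro gauss.borel_measurable_lebesgue_integral) (simp add: case_prod_beta')
    have "emeasure ?N' ?A = (\<integral>\<^sup>+x. indicator ?A x \<partial>?N')"
      by (subst nn_integral_indicator) measurable
    also have "\<dots> = (\<integral>\<^sup>+s. \<integral>\<^sup>+x. indicator ?A (x(i := s)) \<partial>?N \<partial>std_gauss)"
      by (intro gauss.product_nn_integral_insert_rev I borel_measurable_indicator) measurable
    also have "\<dots> = (\<integral>\<^sup>+s. indicator {s. P s} s * ennreal (f s) \<partial>std_gauss)"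
    proof (intro nn_integral_cong)
      fix s
      have "(\<integral>\<^sup>+x. indicator ?A (x(i := s)) \<partial>?N) = (\<integral>\<^sup>+x. indicator {s. P s} s * indicator {x\<in>space ?N. K s x} x \<partial>?N)"
        using upd by (intro nn_integral_cong) (auto simp: indicator_def K_upd)
      also have "\<dots> = indicator {s. P s} s * ennreal (f s)"
        using Ks by (subst nn_integral_cmult) (auto simp: f_def gauss.emeasure_eq_measure)
      finally show "(\<integral>\<^sup>+x. indicator ?A (x(i := s)) \<partial>?N) = indicator {s. P s} s * ennreal (f s)" .
    qed
    also have "\<dots> = (\<integral>\<^sup>+s. ennreal (indicator {s. P s} s * f s) \<partial>std_gauss)"
      by (intro nn_integral_cong) (auto simp: indicator_def f_def)
    also have "\<dots> = ennreal (\<integral>s. indicator {s. P s} s * f s \<partial>std_gauss)"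
    proof (intro nn_integral_eq_integral std_normal.integrable_const_bound[where B = 1] AE_I2)
      have [measurable]: "f \<in> borel_measurable borel" using fm by simp
      have "(\<lambda>s. indicator {s. P s} s * f s) \<in> borel_measurable borel" by measurable
      then show "(\<lambda>s. indicator {s. P s} s * f s) \<in> borel_measurable std_gauss" by simp
    qed (use f01 in \<open>auto simp: indicator_def\<close>)
    finally have "measure ?N' ?A = (\<integral>s. indicator {s. P s} s * f s \<partial>std_gauss)"
      unfolding gauss.emeasure_eq_measure
      by (subst (asm) ennreal_inj) (use f01 in \<open>auto intro!: Bochner_Integration.integral_nonneg\<close>)
    then show ?thesis using fm by simp
  qed
  have [measurable]: "f \<in> borel_measurable borel" using fold[of "\<lambda>_. True"] by simp
  have "measure std_gauss {s. \<bar>d * s\<bar> \<le> c} * (\<integral>s. f s \<partial>std_gauss)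
     \<le> (\<integral>s. indicator {s. \<bar>d * s\<bar> \<le> c} s * f s \<partial>std_gauss)"
  proof (intro std_normal.integral_decreasing_event)
    fix s s' assume "s \<in> {s. \<bar>d * s\<bar> \<le> c}" "s' \<notin> {s. \<bar>d * s\<bar> \<le> c}"
    then have "\<bar>d\<bar> * \<bar>s\<bar> < \<bar>d\<bar> * \<bar>s'\<bar>" by (simp add: abs_mult)
    then have "\<bar>s\<bar> \<le> \<bar>s'\<bar>" using mult_less_cancel_left[of "\<bar>d\<bar>"] by auto
    then show "f s' \<le> f s" unfolding f_def by (intro gauss_section_antimono I Ks sym ext conv)
  qed (use f01 in auto)
  then show ?thesis using fold[of "\<lambda>_. True"] fold[of "\<lambda>s. \<bar>d * s\<bar> \<le> c"] by simp
qed

section \<open>Rotations and Sidak's inequality\<close>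

lemma nn_integral_shear:
  fixes G :: "real \<times> real \<Rightarrow> ennreal"
  assumes [measurable]: "G \<in> borel_measurable borel"
  shows "(\<integral>\<^sup>+u. \<integral>\<^sup>+v. G (u, v + k * u) \<partial>lborel \<partial>lborel) = (\<integral>\<^sup>+u. \<integral>\<^sup>+v. G (u, v) \<partial>lborel \<partial>lborel)"
    and "(\<integral>\<^sup>+u. \<integral>\<^sup>+v. G (u + k * v, v) \<partial>lborel \<partial>lborel) = (\<integral>\<^sup>+u. \<integral>\<^sup>+v. G (u, v) \<partial>lborel \<partial>lborel)"
proof -
  have [measurable]: "G \<in> borel_measurable (borel \<Otimes>\<^sub>M borel)" by (simp add: borel_prod)
  have shift: "(\<integral>\<^sup>+v. g (v + c) \<partial>lborel) = (\<integral>\<^sup>+v. g v \<partial>lborel)"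
    if "g \<in> borel_measurable borel" for g :: "real \<Rightarrow> ennreal" and c
    using nn_integral_real_affine[OF that, of 1 c] by (simp add: add.commute)
  show "(\<integral>\<^sup>+u. \<integral>\<^sup>+v. G (u, v + k * u) \<partial>lborel \<partial>lborel) = (\<integral>\<^sup>+u. \<integral>\<^sup>+v. G (u, v) \<partial>lborel \<partial>lborel)"
    using shift[of "\<lambda>v. G (u, v)" "k * u" for u] by simp
  have "(\<integral>\<^sup>+u. \<integral>\<^sup>+v. G (u + k * v, v) \<partial>lborel \<partial>lborel) = (\<integral>\<^sup>+v. \<integral>\<^sup>+u. G (u + k * v, v) \<partial>lborel \<partial>lborel)"
    by (intro lborel_pair.Fubini'[symmetric]) measurable
  also have "\<dots> = (\<integral>\<^sup>+v. \<integral>\<^sup>+u. G (u, v) \<partial>lborel \<partial>lborel)"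
    using shift[of "\<lambda>u. G (u, v)" "k * v" for v] by simp
  also have "\<dots> = (\<integral>\<^sup>+u. \<integral>\<^sup>+v. G (u, v) \<partial>lborel \<partial>lborel)" by (intro lborel_pair.Fubini') measurable
  finally show "(\<integral>\<^sup>+u. \<integral>\<^sup>+v. G (u + k * v, v) \<partial>lborel \<partial>lborel) = (\<integral>\<^sup>+u. \<integral>\<^sup>+v. G (u, v) \<partial>lborel \<partial>lborel)" .
qed

text \<open>A plane rotation is a product of three shears.\<close>

lemma nn_integral_rotation_lborel:
  fixes G :: "real \<times> real \<Rightarrow> ennreal"
  assumes [measurable]: "G \<in> borel_measurable borel" and cs: "c\<^sup>2 + s\<^sup>2 = 1" "s \<noteq> 0"
  shows "(\<integral>\<^sup>+u. \<integral>\<^sup>+v. G (c * u + s * v, c * v - s * u) \<partial>lborel \<partial>lborel) = (\<integral>\<^sup>+u. \<integral>\<^sup>+v. G (u, v) \<partial>lborel \<partial>lborel)"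
proof -
  \<comment> \<open>If \<open>c\<close> and \<open>s\<close> are the cosine and sine of an angle,
    \<open>k\<close> is the tangent of half of it. The shears have the parameters \<open>k\<close>,
    \<open>- s\<close> and \<open>k\<close>, which is why \<open>s\<close> must be nonzero.\<close>
  define k where "k = (1 - c) / s"
  have ks: "k * s = 1 - c" using cs by (simp add: k_def)
  have "k * (1 + c) = s" using cs by (simp add: k_def field_simps power2_eq_square)
  then have kc: "k + k * c = s" by (simp add: algebra_simps)
  have [measurable]: "G \<in> borel_measurable (borel \<Otimes>\<^sub>M borel)" by (simp add: borel_prod)
  define G1 where "G1 = (\<lambda>(u, v). G (u + k * v, v))"
  define G2 where "G2 = (\<lambda>(u, v). G1 (u, v + (- s) * u))"
  have G1[measurable]: "G1 \<in> borel_measurable borel"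
    unfolding G1_def borel_prod[symmetric] by measurable
  have [measurable]: "G1 \<in> borel_measurable (borel \<Otimes>\<^sub>M borel)" by (simp add: borel_prod)
  have G2[measurable]: "G2 \<in> borel_measurable borel"
    unfolding G2_def borel_prod[symmetric] by measurable
  have "G (c * u + s * v, c * v - s * u) = G2 (u + k * v, v)" for u v
  proof -
    have "c * u + s * v = u + k * v + k * (v - s * (u + k * v))"
    proof -
      have "u + k * v + k * (v - s * (u + k * v)) = u - (k * s) * u + (k + k) * v - (k * s) * k * v"
        by (simp add: algebra_simps)
      also have "\<dots> = c * u + (k + k * c) * v" by (simp add: ks algebra_simps)
      finally show ?thesis by (simp add: kc)
    qed
    moreover have "c * v - s * u = v - s * (u + k * v)"
    proof -
      have "v - s * (u + k * v) = v - s * u - (k * s) * v" by (simp add: algebra_simps)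
      then show ?thesis by (simp add: ks algebra_simps)
    qed
    ultimately show ?thesis by (simp add: G2_def G1_def)
  qed
  then have "(\<integral>\<^sup>+u. \<integral>\<^sup>+v. G (c * u + s * v, c * v - s * u) \<partial>lborel \<partial>lborel) =
      (\<integral>\<^sup>+u. \<integral>\<^sup>+v. G2 (u + k * v, v) \<partial>lborel \<partial>lborel)" by simp
  also have "\<dots> = (\<integral>\<^sup>+u. \<integral>\<^sup>+v. G2 (u, v) \<partial>lborel \<partial>lborel)" by (rule nn_integral_shear(2)[OF G2])
  also have "\<dots> = (\<integral>\<^sup>+u. \<integral>\<^sup>+v. G1 (u, v + (- s) * u) \<partial>lborel \<partial>lborel)" by (simp add: G2_def)
  also have "\<dots> = (\<integral>\<^sup>+u. \<integral>\<^sup>+v. G1 (u, v) \<partial>lborel \<partial>lborel)" by (rule nn_integral_shear(1)[OF G1])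
  also have "\<dots> = (\<integral>\<^sup>+u. \<integral>\<^sup>+v. G (u + k * v, v) \<partial>lborel \<partial>lborel)" by (simp add: G1_def)
  also have "\<dots> = (\<integral>\<^sup>+u. \<integral>\<^sup>+v. G (u, v) \<partial>lborel \<partial>lborel)" by (rule nn_integral_shear(2)[OF assms(1)])
  finally show ?thesis .
qed

text \<open>The density of two independent standard normal variables depends only on the distance
  from the origin, so invariance carries over from Lebesgue measure.\<close>

lemma nn_integral_rotation_std_normal:
  fixes F :: "real \<times> real \<Rightarrow> ennreal"
  assumes F: "F \<in> borel_measurable borel" and cs: "c\<^sup>2 + s\<^sup>2 = 1" "s \<noteq> 0"
  shows "(\<integral>\<^sup>+u. \<integral>\<^sup>+v. F (c * u + s * v, c * v - s * u) \<partial>std_gauss \<partial>std_gauss)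
    = (\<integral>\<^sup>+u. \<integral>\<^sup>+v. F (u, v) \<partial>std_gauss \<partial>std_gauss)"
proof -
  let ?p = std_normal_density
  define G where "G = (\<lambda>(u, v). ennreal (?p u * ?p v) * F (u, v))"
  have FF[measurable]: "F \<in> borel_measurable (borel \<Otimes>\<^sub>M borel)" using F by (simp add: borel_prod)
  have G[measurable]: "G \<in> borel_measurable borel"
    unfolding G_def borel_prod[symmetric] by measurable
  have dens: "(\<integral>\<^sup>+u. \<integral>\<^sup>+v. H u v \<partial>std_gauss \<partial>std_gauss) =
      (\<integral>\<^sup>+u. \<integral>\<^sup>+v. ennreal (?p u * ?p v) * H u v \<partial>lborel \<partial>lborel)"
    if [measurable]: "case_prod H \<in> borel_measurable (borel \<Otimes>\<^sub>M borel)" for H :: "real \<Rightarrow> real \<Rightarrow> ennreal"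
    by (simp add: nn_integral_density nn_integral_cmult[symmetric] ennreal_mult mult.assoc)
  have rad: "?p u * ?p v = ?p (c * u + s * v) * ?p (c * v - s * u)" for u v
  proof -
    have "(c * u + s * v)\<^sup>2 + (c * v - s * u)\<^sup>2 = (c\<^sup>2 + s\<^sup>2) * (u\<^sup>2 + v\<^sup>2)"
      by (simp add: power2_eq_square algebra_simps)
    then have eq: "u\<^sup>2 + v\<^sup>2 = (c * u + s * v)\<^sup>2 + (c * v - s * u)\<^sup>2" using cs by simp
    have p: "?p u * ?p v = 1 / (2 * pi) * exp (- (u\<^sup>2 + v\<^sup>2) / 2)" for u v
      by (simp add: std_normal_density_def mult_exp_exp field_simps)
    show ?thesis by (simp only: p eq)
  qed
  have "(\<integral>\<^sup>+u. \<integral>\<^sup>+v. F (c * u + s * v, c * v - s * u) \<partial>std_gauss \<partial>std_gauss) =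
      (\<integral>\<^sup>+u. \<integral>\<^sup>+v. G (c * u + s * v, c * v - s * u) \<partial>lborel \<partial>lborel)"
    by (subst dens) (simp_all add: G_def flip: rad)
  also have "\<dots> = (\<integral>\<^sup>+u. \<integral>\<^sup>+v. G (u, v) \<partial>lborel \<partial>lborel)"
    by (rule nn_integral_rotation_lborel[OF G cs])
  also have "\<dots> = (\<integral>\<^sup>+u. \<integral>\<^sup>+v. F (u, v) \<partial>std_gauss \<partial>std_gauss)"
    by (subst dens) (simp_all add: G_def)
  finally show ?thesis .
qed

section \<open>Rotations of a Gaussian product measure\<close>

definition givens :: "nat \<Rightarrow> nat \<Rightarrow> real \<Rightarrow> real \<Rightarrow> (nat \<Rightarrow> real) \<Rightarrow> nat \<Rightarrow> real" where
  "givens i j c s x = x(i := c * x i + s * x j, j := c * x j - s * x i)"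

lemma measurable_givens [measurable]:
  assumes "i \<in> I" "j \<in> I"
  shows "givens i j c s \<in> measurable (gauss_product I) (gauss_product I)"
proof -
  have "I = insert j I" "I = insert i I" using assms by auto
  then show ?thesis unfolding givens_def using assms
    by (intro measurable_fun_upd[where J = I]) (auto cong: measurable_cong_sets)
qed

text \<open>Fubini isolates the two coordinates that are rotated. Integrating out the others first
  leaves a function \<open>H\<close> on the plane, to which the planar rotation invariance
  applies.\<close>

lemma distr_givens:
  assumes I: "finite I" "i \<in> I" "j \<in> I" "i \<noteq> j" and cs: "c\<^sup>2 + s\<^sup>2 = 1" "s \<noteq> 0"
  shows "distr (gauss_product I) (gauss_product I) (givens i j c s) = gauss_product I"
proof (rule measure_eqI)
  fix A assume "A \<in> sets (distr (gauss_product I) (gauss_product I) (givens i j c s))"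
  then have A[measurable]: "A \<in> sets (gauss_product I)" by simp
  define L where "L = I - {i, j}"
  have L: "I = insert i (insert j L)" "finite L" "i \<notin> insert j L" "j \<notin> L" "finite (insert j L)"
    using I by (auto simp: L_def)
  let ?g = "std_gauss"
  have fold: "(\<integral>\<^sup>+x. F x \<partial>gauss_product I) =
      (\<integral>\<^sup>+u. \<integral>\<^sup>+v. \<integral>\<^sup>+x. F (x(j := v, i := u)) \<partial>gauss_product L \<partial>?g \<partial>?g)"
    if [measurable]: "F \<in> borel_measurable (gauss_product I)" for F :: "_ \<Rightarrow> ennreal"
  proof -
    have "(\<integral>\<^sup>+x. F x \<partial>gauss_product I) = (\<integral>\<^sup>+u. \<integral>\<^sup>+x. F (x(i := u)) \<partial>gauss_product (insert j L) \<partial>?g)"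
      using that unfolding L(1) by (intro gauss.product_nn_integral_insert_rev L)
    also have "\<dots> = (\<integral>\<^sup>+u. \<integral>\<^sup>+v. \<integral>\<^sup>+x. F (x(j := v, i := u)) \<partial>gauss_product L \<partial>?g \<partial>?g)"
    proof (intro nn_integral_cong gauss.product_nn_integral_insert_rev L)
      fix u
      have "(\<lambda>x. x(i := u)) \<in> measurable (gauss_product (insert j L)) (gauss_product I)"
        using L by (intro measurable_fun_upd[where J = "insert j L"]) auto
      then show "(\<lambda>x. F (x(i := u))) \<in> borel_measurable (gauss_product (insert j L))"
        by measurable
    qed
    finally show ?thesis .
  qed
  define H where "H = (\<lambda>(u, v). \<integral>\<^sup>+x. indicator A (x(j := v, i := u)) \<partial>gauss_product L)"
  have [measurable]: "H \<in> borel_measurable borel"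
  proof -
    have upd: "(\<lambda>z. (snd z)(j := snd (fst z), i := fst (fst z))) \<in>
        measurable ((?g \<Otimes>\<^sub>M ?g) \<Otimes>\<^sub>M gauss_product L) (gauss_product I)"
    proof (rule measurable_fun_upd[where J = "insert j L"])
      show "(\<lambda>z. (snd z)(j := snd (fst z))) \<in> measurable ((?g \<Otimes>\<^sub>M ?g) \<Otimes>\<^sub>M gauss_product L) (gauss_product (insert j L))"
        using L by (intro measurable_fun_upd[where J = L]) auto
    qed (use L in auto)
    have "(\<lambda>z. \<integral>\<^sup>+x. indicator A (x(j := snd z, i := fst z)) \<partial>gauss_product L) \<in> borel_measurable (?g \<Otimes>\<^sub>M ?g)"
      by (rule gauss.borel_measurable_nn_integral)
        (use measurable_compose[OF upd borel_measurable_indicator[OF A]] in \<open>simp add: case_prod_beta'\<close>)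
    then show ?thesis unfolding H_def case_prod_beta' borel_prod[symmetric]
      by (simp cong: measurable_cong_sets sets_pair_measure_cong)
  qed
  have "emeasure (distr (gauss_product I) (gauss_product I) (givens i j c s)) A =
      (\<integral>\<^sup>+x. indicator A (givens i j c s x) \<partial>gauss_product I)"
    using measurable_givens[OF I(2,3), of c s]
    by (subst nn_integral_indicator[symmetric], simp, subst nn_integral_distr) auto
  also have "\<dots> = (\<integral>\<^sup>+u. \<integral>\<^sup>+v. H (c * u + s * v, c * v - s * u) \<partial>?g \<partial>?g)"
  proof -
    have "givens i j c s (x(j := v, i := u)) = x(j := c * v - s * u, i := c * u + s * v)" for x u v
      using I(4) by (auto simp: givens_def fun_eq_iff)
    then show ?thesis
      using measurable_givens[OF I(2,3), of c s] by (subst fold) (simp_all add: H_def)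
  qed
  also have "\<dots> = (\<integral>\<^sup>+u. \<integral>\<^sup>+v. H (u, v) \<partial>?g \<partial>?g)"
    by (intro nn_integral_rotation_std_normal cs) measurable
  also have "\<dots> = (\<integral>\<^sup>+x. indicator A x \<partial>gauss_product I)" by (subst fold) (simp_all add: H_def)
  finally show "emeasure (distr (gauss_product I) (gauss_product I) (givens i j c s)) A = emeasure (gauss_product I) A"
    by simp
qed simp

text \<open>The transpose of a rotation is the rotation by the opposite angle. This moves a rotation
  from the variables to the coefficients of a linear form.\<close>

lemma sum_givens:
  assumes "finite I" "i \<in> I" "j \<in> I" "i \<noteq> j"
  shows "(\<Sum>k\<in>I. b k * givens i j c s x k) = (\<Sum>k\<in>I. givens i j c (- s) b k * x k)"
proof -
  have I: "I = insert i (insert j (I - {i, j}))" using assms by auto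
  have "(\<Sum>k\<in>I - {i, j}. b k * givens i j c s x k) = (\<Sum>k\<in>I - {i, j}. givens i j c (- s) b k * x k)"
    by (intro sum.cong) (auto simp: givens_def)
  then show ?thesis using assms by (subst (1 2) I) (simp add: givens_def algebra_simps)
qed

text \<open>Givens rotations successively annihilate the coordinates of the coefficient vector \<open>a\<close>.\<close>

lemma gauss_product_rotate:
  assumes "finite I" "i \<in> I"
  shows "\<exists>T d. T \<in> measurable (gauss_product I) (gauss_product I) \<and>
    distr (gauss_product I) (gauss_product I) T = gauss_product I \<and>
    d\<^sup>2 = (\<Sum>k\<in>I. (a k)\<^sup>2) \<and> (\<forall>x. (\<Sum>k\<in>I. a k * T x k) = d * x i) \<and>
    (\<forall>b. \<exists>b'. \<forall>x. (\<Sum>k\<in>I. b k * T x k) = (\<Sum>k\<in>I. b' k * x k))"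
proof (induction "card {k\<in>I. k \<noteq> i \<and> a k \<noteq> 0}" arbitrary: a)
  case 0
  then have a: "k \<in> I \<Longrightarrow> k \<noteq> i \<Longrightarrow> a k = 0" for k using assms by auto
  have "(\<Sum>k\<in>I. (a k)\<^sup>2) = (a i)\<^sup>2" "(\<Sum>k\<in>I. a k * x k) = a i * x i" for x
    using assms a by (simp_all add: sum.remove[of I i])
  \<comment> \<open>The remaining coefficient \<open>a i\<close> may be negative, so only the square
    of \<open>d\<close> is prescribed.\<close>
  then show ?case by (intro exI[of _ "\<lambda>x. x"] exI[of _ "a i"]) (auto simp: distr_id2)
next
  case (Suc n)
  have "{k\<in>I. k \<noteq> i \<and> a k \<noteq> 0} \<noteq> {}" using Suc.hyps(2) by (metis card.empty nat.simps(3))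
  then obtain j where j: "j \<in> I" "j \<noteq> i" "a j \<noteq> 0" by auto
  define r where "r = sqrt ((a i)\<^sup>2 + (a j)\<^sup>2)"
  have r: "r > 0" "r\<^sup>2 = (a i)\<^sup>2 + (a j)\<^sup>2" using j by (simp_all add: r_def add_nonneg_pos)
  \<comment> \<open>The angle for which the rotated coefficient vector has \<open>0\<close> at
    \<open>j\<close> and the length \<open>r\<close> at \<open>i\<close>. Since \<open>a j\<close>
    is nonzero, \<open>r\<close> is positive and \<open>s\<close> is nonzero.\<close>
  define c s where "c = a i / r" and "s = - a j / r"
  have cs: "c\<^sup>2 + s\<^sup>2 = 1" "s \<noteq> 0"
    using r j by (simp_all add: c_def s_def power_divide flip: add_divide_distrib)
  define a' where "a' = givens i j c (- s) a"
  have a': "a' i = r" "a' j = 0" "k \<noteq> i \<Longrightarrow> k \<noteq> j \<Longrightarrow> a' k = a k" for k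
    using r(1) j by (auto simp: a'_def givens_def c_def s_def field_simps power2_eq_square[symmetric] r(2))
  have "k \<in> {k\<in>I. k \<noteq> i \<and> a k \<noteq> 0} \<longleftrightarrow> k \<in> insert j {k\<in>I. k \<noteq> i \<and> a' k \<noteq> 0}" for k
    using a' j by (cases "k = i"; cases "k = j") auto
  then have "{k\<in>I. k \<noteq> i \<and> a k \<noteq> 0} = insert j {k\<in>I. k \<noteq> i \<and> a' k \<noteq> 0}" by blast
  then have "n = card {k\<in>I. k \<noteq> i \<and> a' k \<noteq> 0}" using Suc.hyps(2) a' assms by simp
  from Suc.hyps(1)[OF this] obtain T d where T[measurable]: "T \<in> measurable (gauss_product I) (gauss_product I)"
    and dT: "distr (gauss_product I) (gauss_product I) T = gauss_product I"
    and d: "d\<^sup>2 = (\<Sum>k\<in>I. (a' k)\<^sup>2)" "\<forall>x. (\<Sum>k\<in>I. a' k * T x k) = d * x i"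
    and b: "\<forall>b. \<exists>b'. \<forall>x. (\<Sum>k\<in>I. b k * T x k) = (\<Sum>k\<in>I. b' k * x k)" by blast
  let ?G = "givens i j c s"
  have G: "?G \<in> measurable (gauss_product I) (gauss_product I)" using assms j by measurable
  have "distr (gauss_product I) (gauss_product I) (?G \<circ> T) = gauss_product I"
    using distr_distr[OF G T] dT distr_givens[OF assms(1,2) j(1) j(2)[symmetric] cs] by simp
  moreover have "d\<^sup>2 = (\<Sum>k\<in>I. (a k)\<^sup>2)"
  proof -
    have I: "I = insert i (insert j (I - {i, j}))" using assms j by auto
    have "(\<Sum>k\<in>I - {i, j}. (a' k)\<^sup>2) = (\<Sum>k\<in>I - {i, j}. (a k)\<^sup>2)" using a' by (intro sum.cong) auto
    then show ?thesis unfolding d(1) using assms j a' r by (subst (1 2) I) simp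
  qed
  moreover have "(\<Sum>k\<in>I. b k * (?G \<circ> T) x k) = (\<Sum>k\<in>I. givens i j c (- s) b k * T x k)" for b x
    using sum_givens[OF assms j(1) j(2)[symmetric]] by simp
  ultimately show ?case
    using d(2) b G T by (intro exI[of _ "?G \<circ> T"] exI[of _ d]) (auto simp: a'_def intro: measurable_comp)
qed


section \<open>Linear forms and Sidak's inequality\<close>

lemma distr_linear_form:
  assumes "finite I" "I \<noteq> {}"
  obtains d where "d\<^sup>2 = (\<Sum>k\<in>I. (a k)\<^sup>2)"
    and "distr (gauss_product I) borel (\<lambda>x. \<Sum>k\<in>I. a k * x k) = distr std_gauss borel (\<lambda>s. d * s)"
proof -
  obtain i where i: "i \<in> I" using assms(2) by auto
  let ?N = "gauss_product I"
  obtain T d where T[measurable]: "T \<in> measurable ?N ?N" and dT: "distr ?N ?N T = ?N"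
    and d: "d\<^sup>2 = (\<Sum>k\<in>I. (a k)\<^sup>2)" "\<forall>x. (\<Sum>k\<in>I. a k * T x k) = d * x i"
    using gauss_product_rotate[OF assms(1) i, of a] by blast
  have "distr ?N borel (\<lambda>x. \<Sum>k\<in>I. a k * x k) = distr (distr ?N ?N T) borel (\<lambda>x. \<Sum>k\<in>I. a k * x k)"
    by (simp only: dT)
  also have "\<dots> = distr ?N borel (\<lambda>x. d * x i)" by (subst distr_distr) (simp_all add: comp_def d)
  also have "\<dots> = distr (distr ?N std_gauss (\<lambda>x. x i)) borel (\<lambda>s. d * s)"
    using i by (subst distr_distr) (auto simp: comp_def cong: measurable_cong_sets)
  also have "distr ?N std_gauss (\<lambda>x. x i) = std_gauss"
    by (rule distr_PiM_component[OF std_normal.prob_space_axioms i])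
  finally show ?thesis using d by (intro that[of d]) auto
qed

text \<open>The slabs are split off one at a time. A rotation that preserves the measure turns the
  linear form of the new slab into a multiple of the single coordinate \<open>i\<close>; the other
  forms stay linear, so their slabs still intersect in a symmetric convex set, and
  \<open>gauss_product_slab_correlation\<close> applies.\<close>

lemma sidak_inequality:
  fixes a :: "'j \<Rightarrow> nat \<Rightarrow> real" and c :: "'j \<Rightarrow> real"
  assumes I: "finite I" "I \<noteq> {}" and J: "finite J"
  shows "(\<Prod>j\<in>J. measure std_gauss {s. \<bar>sqrt (\<Sum>k\<in>I. (a j k)\<^sup>2) * s\<bar> \<le> c j})
    \<le> measure (gauss_product I) {x\<in>space (gauss_product I). \<forall>j\<in>J. \<bar>\<Sum>k\<in>I. a j k * x k\<bar> \<le> c j}"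
proof -
  obtain i where i: "i \<in> I" using I(2) by auto
  let ?N = "gauss_product I"
  define L where "L = I - {i}"
  have L: "I = insert i L" "finite L" "i \<notin> L" using i I by (auto simp: L_def)
  show ?thesis using J
  proof (induction J)
    case empty
    then show ?case using measure_gauss_product_space[of I] by simp
  next
    case (insert j J)
    obtain T d where T[measurable]: "T \<in> measurable ?N ?N" and dT: "distr ?N ?N T = ?N"
      and d: "d\<^sup>2 = (\<Sum>k\<in>I. (a j k)\<^sup>2)" "\<forall>x. (\<Sum>k\<in>I. a j k * T x k) = d * x i"
      and bT: "\<forall>b. \<exists>b'. \<forall>x. (\<Sum>k\<in>I. b k * T x k) = (\<Sum>k\<in>I. b' k * x k)"
      using gauss_product_rotate[OF I(1) i, of "a j"] by blast
    have "\<forall>m. \<exists>b'. \<forall>x. (\<Sum>k\<in>I. a m k * T x k) = (\<Sum>k\<in>I. b' k * x k)" using bT by blast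
    then obtain b where b: "\<And>m x. (\<Sum>k\<in>I. a m k * T x k) = (\<Sum>k\<in>I. b m k * x k)" by metis
    have tr: "measure ?N {x\<in>space ?N. P x} = measure ?N {x\<in>space ?N. P (T x)}"
      if [measurable]: "Measurable.pred ?N P" for P
    proof -
      have "measure ?N {x\<in>space ?N. P x} = measure (distr ?N ?N T) {x\<in>space ?N. P x}"
        by (simp only: dT)
      also have "\<dots> = measure ?N (T -` {x\<in>space ?N. P x} \<inter> space ?N)"
        by (intro measure_distr) measurable
      also have "T -` {x\<in>space ?N. P x} \<inter> space ?N = {x\<in>space ?N. P (T x)}"
        using measurable_space[OF T] by auto
      finally show ?thesis .
    qed
    \<comment> \<open>The rotated constraints of the remaining slabs, with the contribution of
      coordinate \<open>i\<close> written separately.\<close>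
    define K where "K s x \<longleftrightarrow> (\<forall>m\<in>J. \<bar>b m i * s + (\<Sum>k\<in>L. b m k * x k)\<bar> \<le> c m)" for s x
    have K: "K (x i) x \<longleftrightarrow> (\<forall>m\<in>J. \<bar>\<Sum>k\<in>I. a m k * T x k\<bar> \<le> c m)" for x
      unfolding b using L by (simp add: K_def)
    have "(\<Prod>j\<in>insert j J. measure std_gauss {s. \<bar>sqrt (\<Sum>k\<in>I. (a j k)\<^sup>2) * s\<bar> \<le> c j}) \<le>
      measure std_gauss {s. \<bar>sqrt (\<Sum>k\<in>I. (a j k)\<^sup>2) * s\<bar> \<le> c j} *
      measure ?N {x\<in>space ?N. \<forall>j\<in>J. \<bar>\<Sum>k\<in>I. a j k * x k\<bar> \<le> c j}"
      using insert by (auto intro!: mult_left_mono)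
    also have "\<dots> = measure std_gauss {s. \<bar>d * s\<bar> \<le> c j} *
        measure ?N {x\<in>space ?N. K (x i) x}"
      using insert.hyps by (subst tr) (simp_all add: K abs_mult flip: d(1))
    also have "\<dots> \<le> measure ?N {x\<in>space ?N. \<bar>d * x i\<bar> \<le> c j \<and> K (x i) x}" unfolding L(1)
    proof (rule gauss_product_slab_correlation[OF L(2,3), where K = K])
      show "Measurable.pred (gauss_product (insert i L)) (\<lambda>x. K (x i) x)"
        unfolding K L(1)[symmetric] using insert.hyps by measurable
      show "K (- s) (\<lambda>k. - x k)" if "K s x" for s x
      proof -
        have "b m i * - s + (\<Sum>k\<in>L. b m k * - x k) = - (b m i * s + (\<Sum>k\<in>L. b m k * x k))" for m
          by (simp add: sum_negf)
        with that show ?thesis by (simp only: K_def abs_minus)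
      qed
      show "K ((1 - l) * s + l * s') (\<lambda>k. (1 - l) * x k + l * y k)"
        if *: "K s x" "K s' y" "0 < l" "l < 1" for s s' x y l
        unfolding K_def
      proof
        fix m assume m: "m \<in> J"
        let ?u = "b m i * s + (\<Sum>k\<in>L. b m k * x k)" and ?v = "b m i * s' + (\<Sum>k\<in>L. b m k * y k)"
        have "b m i * ((1 - l) * s + l * s') + (\<Sum>k\<in>L. b m k * ((1 - l) * x k + l * y k)) = (1 - l) * ?u + l * ?v"
          by (simp add: distrib_left sum.distrib sum_distrib_left mult_ac)
        also have "\<bar>\<dots>\<bar> \<le> (1 - l) * \<bar>?u\<bar> + l * \<bar>?v\<bar>"
          using *(3,4) by (intro order.trans[OF abs_triangle_ineq]) (simp add: abs_mult)
        also have "\<dots> \<le> (1 - l) * c m + l * c m"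
          using *(1,2) m *(3,4) by (intro add_mono mult_left_mono) (auto simp: K_def)
        finally show "\<bar>b m i * ((1 - l) * s + l * s') + (\<Sum>k\<in>L. b m k * ((1 - l) * x k + l * y k))\<bar> \<le> c m"
          by (simp add: algebra_simps)
      qed
    qed (auto simp: K_def)
    also have "\<dots> = measure ?N {x\<in>space ?N. \<forall>j\<in>insert j J. \<bar>\<Sum>k\<in>I. a j k * x k\<bar> \<le> c j}"
      using insert.hyps by (subst (2) tr) (simp_all add: K d(2))
    finally show ?case .
  qed
qed

text \<open>One step of a sequential conditioning argument, with the coordinates in \<open>A\<close> as the past.\<close>

lemma gauss_product_fresh_noise:
  assumes AB: "finite A" "finite B" "A \<inter> B = {}"
    and P[measurable]: "Measurable.pred (gauss_product (A \<union> B)) P"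
    and loc: "\<And>x y. (\<forall>k\<in>A. x k = y k) \<Longrightarrow> P x = P y"
    and \<sigma>: "0 < \<sigma>" "\<sigma>\<^sup>2 \<le> (\<Sum>k\<in>B. (a k)\<^sup>2)" and e: "0 \<le> e"
  shows "measure (gauss_product (A \<union> B))
      {x\<in>space (gauss_product (A \<union> B)). P x \<and> \<bar>\<Sum>k\<in>A \<union> B. a k * x k\<bar> \<le> e}
    \<le> measure std_gauss {..e / \<sigma>} *
      measure (gauss_product (A \<union> B)) {x\<in>space (gauss_product (A \<union> B)). P x}"
proof -
  let ?N = "gauss_product (A \<union> B)" and ?m = "\<lambda>x y. merge A B (x, y)"
  let ?q = "measure std_gauss {..e / \<sigma>}"
  let ?S = "{x\<in>space ?N. P x \<and> \<bar>\<Sum>k\<in>A \<union> B. a k * x k\<bar> \<le> e}" and ?S' = "{x\<in>space ?N. P x}"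
  have B: "B \<noteq> {}" using \<sigma> by auto
  obtain d where d: "d\<^sup>2 = (\<Sum>k\<in>B. (a k)\<^sup>2)"
    and dd: "distr (gauss_product B) borel (\<lambda>x. \<Sum>k\<in>B. a k * x k) = distr std_gauss borel (\<lambda>s. d * s)"
    using distr_linear_form[OF AB(2) B] by blast
  have d\<sigma>: "\<sigma> \<le> \<bar>d\<bar>" using \<sigma> d by (metis abs_le_square_iff abs_of_pos)
  have neg: "measure std_gauss {- t..} = measure std_gauss {..t}" for t
  proof -
    have "measure std_gauss {..t} = measure (distr std_gauss borel uminus) {..t}"
      by (simp only: distr_std_normal_uminus)
    also have "\<dots> = measure std_gauss {- t..}"
      by (subst measure_distr) (auto intro!: arg_cong2[where f = measure] borel_measurable_continuous_onI
        continuous_intros cong: measurable_cong_sets)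
    finally show ?thesis ..
  qed
  have q: "measure (gauss_product B) {y\<in>space (gauss_product B). \<bar>h + (\<Sum>k\<in>B. a k * y k)\<bar> \<le> e} \<le> ?q" for h
  proof -
    have "measure (gauss_product B) {y\<in>space (gauss_product B). \<bar>h + (\<Sum>k\<in>B. a k * y k)\<bar> \<le> e} =
        measure (distr (gauss_product B) borel (\<lambda>x. \<Sum>k\<in>B. a k * x k)) {s. \<bar>h + s\<bar> \<le> e}"
      by (subst measure_distr) (auto intro!: arg_cong2[where f = measure])
    also have "\<dots> = measure std_gauss {s. \<bar>h + d * s\<bar> \<le> e}"
      unfolding dd by (subst measure_distr) (auto intro!: arg_cong2[where f = measure])
    also have "\<dots> \<le> ?q"
    proof -
      \<comment> \<open>The set is an interval whose half-width is at most
        \<open>e / \<sigma>\<close>, so the half-line to use is decided by the sign of its centre.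
        The two half-lines have equal measure by \<open>neg\<close>. Bounding an interval by a
        half-line is crude, but any bound below 1 that depends only on \<open>e / \<sigma>\<close>
        will do.\<close>
      have "{s. \<bar>h + d * s\<bar> \<le> e} \<subseteq> {..e / \<sigma>} \<or> {s. \<bar>h + d * s\<bar> \<le> e} \<subseteq> {- (e / \<sigma>)..}"
      proof -
        have small: "s \<le> e / \<sigma>" if "\<bar>d\<bar> * s \<le> e" for s
        proof (cases "s \<le> 0")
          case False
          then have "\<sigma> * s \<le> \<bar>d\<bar> * s" using d\<sigma> by (intro mult_right_mono) auto
          then have "\<sigma> * s \<le> e" using that by simp
          then show ?thesis using \<sigma> by (simp add: field_simps)
        qed (use e \<sigma> in \<open>auto intro: order.trans[of _ 0]\<close>)
        have "s \<le> e / \<sigma>" if "\<bar>h + d * s\<bar> \<le> e" "0 \<le> h * sgn d" for s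
        proof (rule small)
          have "\<bar>d\<bar> * s = d * sgn d * s" by (simp add: abs_sgn mult.commute)
          then show "\<bar>d\<bar> * s \<le> e" using that d\<sigma> \<sigma> by (auto simp: sgn_if abs_if split: if_splits)
        qed
        moreover have "- s \<le> e / \<sigma>" if "\<bar>h + d * s\<bar> \<le> e" "h * sgn d \<le> 0" for s
        proof (rule small)
          show "\<bar>d\<bar> * - s \<le> e" using that d\<sigma> \<sigma> by (auto simp: sgn_if abs_if split: if_splits)
        qed
        ultimately show ?thesis by (cases "0 \<le> h * sgn d") force+
      qed
      then show ?thesis
        by (metis (no_types, lifting) neg std_normal.finite_measure_mono sets_density sets_lborel atMost_borel atLeast_borel)
    qed
    finally show ?thesis .
  qed
  have [measurable]: "?S \<in> sets ?N" "?S' \<in> sets ?N" using AB by measurable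
  have "emeasure ?N ?S = (\<integral>\<^sup>+x. indicator ?S x \<partial>?N)" by simp
  also have "\<dots> = (\<integral>\<^sup>+x. \<integral>\<^sup>+y. indicator ?S (?m x y) \<partial>gauss_product B \<partial>gauss_product A)"
    using AB by (intro gauss.product_nn_integral_fold) auto
  also have "\<dots> \<le> (\<integral>\<^sup>+x. \<integral>\<^sup>+y. ennreal ?q * indicator ?S' (?m x y) \<partial>gauss_product B \<partial>gauss_product A)"
  proof (rule nn_integral_mono)
    \<comment> \<open>Fixing the past \<open>x\<close> decides \<open>P\<close> and turns the linear
      form into a constant plus a form in the coordinates of \<open>B\<close>. The bound
      \<open>q\<close> holds uniformly in that constant.\<close>
    fix x assume x: "x \<in> space (gauss_product A)"
    have mS: "?m x y \<in> space ?N" if "y \<in> space (gauss_product B)" for y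
      using x that AB by (auto simp: space_PiM)
    have Pm: "P (?m x y) = P x" for y using AB by (intro loc) (auto simp: merge_def)
    have sm: "(\<Sum>k\<in>A \<union> B. a k * ?m x y k) = (\<Sum>k\<in>A. a k * x k) + (\<Sum>k\<in>B. a k * y k)" for y
    proof -
      have "(\<Sum>k\<in>A. a k * ?m x y k) = (\<Sum>k\<in>A. a k * x k)" "(\<Sum>k\<in>B. a k * ?m x y k) = (\<Sum>k\<in>B. a k * y k)"
        using AB by (auto intro!: sum.cong simp: merge_def)
      then show ?thesis using AB by (simp add: sum.union_disjoint)
    qed
    let ?R = "{y\<in>space (gauss_product B). \<bar>(\<Sum>k\<in>A. a k * x k) + (\<Sum>k\<in>B. a k * y k)\<bar> \<le> e}"
    have 1: "(\<integral>\<^sup>+y. indicator ?S (?m x y) \<partial>gauss_product B) = (\<integral>\<^sup>+y. of_bool (P x) * indicator ?R y \<partial>gauss_product B)"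
      using mS by (intro nn_integral_cong) (auto simp: indicator_def Pm sm)
    have 2: "(\<integral>\<^sup>+y. of_bool (P x) * indicator ?R y \<partial>gauss_product B) = of_bool (P x) * emeasure (gauss_product B) ?R"
      by (subst nn_integral_cmult) auto
    have 3: "of_bool (P x) * emeasure (gauss_product B) ?R \<le> of_bool (P x) * ennreal ?q"
      using q by (intro mult_left_mono) (auto simp: gauss.emeasure_eq_measure ennreal_leI)
    have 4: "of_bool (P x) * ennreal ?q = (\<integral>\<^sup>+y. ennreal ?q * of_bool (P x) \<partial>gauss_product B)"
      by (simp add: gauss.emeasure_space_1 mult.commute)
    have 5: "(\<integral>\<^sup>+y. ennreal ?q * of_bool (P x) \<partial>gauss_product B) = (\<integral>\<^sup>+y. ennreal ?q * indicator ?S' (?m x y) \<partial>gauss_product B)"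
      using mS by (intro nn_integral_cong) (auto simp: indicator_def Pm)
    show "(\<integral>\<^sup>+y. indicator ?S (?m x y) \<partial>gauss_product B) \<le>
        (\<integral>\<^sup>+y. ennreal ?q * indicator ?S' (?m x y) \<partial>gauss_product B)"
      using 3 by (simp only: 1 2 4 5)
  qed
  also have "\<dots> = (\<integral>\<^sup>+x. ennreal ?q * indicator ?S' x \<partial>?N)"
    using AB by (intro gauss.product_nn_integral_fold[symmetric]) auto
  also have "\<dots> = ennreal ?q * emeasure ?N ?S'" by (subst nn_integral_cmult) auto
  finally show ?thesis by (simp add: gauss.emeasure_eq_measure flip: ennreal_mult)
qed

text \<open>As a global rule, its pattern \<open>x i\<close> would match every application.\<close>

declare measurable_gauss_component [measurable del]

section \<open>Small balls of Wiener integrals\<close>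

text \<open>The cells are open on the left and closed on the right, so the value on a cell is the
  value at its right end. The coefficients can thus be read off from \<open>\<phi>\<close>, and the
  same ones tie \<open>Y\<close> to \<open>\<phi>\<close>.\<close>

definition elementary_on_grid ::
    "(real \<Rightarrow> 'a \<Rightarrow> real) \<Rightarrow> nat \<Rightarrow> (nat \<Rightarrow> real) \<Rightarrow> (real \<Rightarrow> real) \<Rightarrow> ('a \<Rightarrow> real) \<Rightarrow> bool" where
  "elementary_on_grid W N P \<phi> Y \<longleftrightarrow>
     (\<forall>u. \<phi> u = (\<Sum>l<N. \<phi> (P (Suc l)) * indicator {P l<..P (Suc l)} u)) \<and>
     (\<forall>\<omega>. Y \<omega> = (\<Sum>l<N. \<phi> (P (Suc l)) * (W (P (Suc l)) \<omega> - W (P l) \<omega>)))"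

lemma elementary_on_grid_sum:
  assumes "\<And>i. i < n \<Longrightarrow> elementary_on_grid W N P (\<phi> i) (Y i)"
  shows "elementary_on_grid W N P (\<lambda>u. \<Sum>i<n. c i * \<phi> i u) (\<lambda>\<omega>. \<Sum>i<n. c i * Y i \<omega>)"
  unfolding elementary_on_grid_def
proof (intro conjI allI)
  fix u
  have "(\<Sum>i<n. c i * \<phi> i u) = (\<Sum>i<n. c i * (\<Sum>l<N. \<phi> i (P (Suc l)) * indicator {P l<..P (Suc l)} u))"
    using assms unfolding elementary_on_grid_def by (intro sum.cong refl arg_cong2[where f = times]) blast
  also have "\<dots> = (\<Sum>l<N. (\<Sum>i<n. c i * \<phi> i (P (Suc l))) * indicator {P l<..P (Suc l)} u)"
    by (simp only: sum_distrib_left sum_distrib_right mult.assoc) (rule sum.swap)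
  finally show "(\<Sum>i<n. c i * \<phi> i u) = (\<Sum>l<N. (\<Sum>i<n. c i * \<phi> i (P (Suc l))) * indicator {P l<..P (Suc l)} u)" .
next
  fix \<omega>
  have "(\<Sum>i<n. c i * Y i \<omega>) = (\<Sum>i<n. c i * (\<Sum>l<N. \<phi> i (P (Suc l)) * (W (P (Suc l)) \<omega> - W (P l) \<omega>)))"
    using assms unfolding elementary_on_grid_def by (intro sum.cong refl arg_cong2[where f = times]) blast
  also have "\<dots> = (\<Sum>l<N. (\<Sum>i<n. c i * \<phi> i (P (Suc l))) * (W (P (Suc l)) \<omega> - W (P l) \<omega>))"
    by (simp only: sum_distrib_left sum_distrib_right mult.assoc) (rule sum.swap)
  finally show "(\<Sum>i<n. c i * Y i \<omega>) =
      (\<Sum>l<N. (\<Sum>i<n. c i * \<phi> i (P (Suc l))) * (W (P (Suc l)) \<omega> - W (P l) \<omega>))" .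
qed

lemma elementary_on_grid_diff:
  assumes "elementary_on_grid W N P \<phi> Y" "elementary_on_grid W N P \<psi> Z"
  shows "elementary_on_grid W N P (\<lambda>u. \<phi> u - \<psi> u) (\<lambda>\<omega>. Y \<omega> - Z \<omega>)"
  using elementary_on_grid_sum[of "2 :: nat" W N P "\<lambda>i. if i = 0 then \<phi> else \<psi>" "\<lambda>i. if i = 0 then Y else Z"
      "\<lambda>i. if i = 0 then 1 else -1"] assms
  by (simp add: numeral_2_eq_2)

lemma grid_less_iff:
  assumes "strict_mono_on {..N} (P :: nat \<Rightarrow> real)" "i \<le> N" "j \<le> N"
  shows "P i < P j \<longleftrightarrow> i < j" "P i \<le> P j \<longleftrightarrow> i \<le> j"
  using assms by (auto simp: strict_mono_on_less strict_mono_on_less_eq)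

lemma elementary_on_grid_interval:
  assumes P: "strict_mono_on {..N} P" and ab: "a \<le> b" "b \<le> N"
  shows "elementary_on_grid W N P (indicator {P a<..P b}) (\<lambda>\<omega>. W (P b) \<omega> - W (P a) \<omega>)"
proof -
  \<comment> \<open>This telescoping sum serves twice: with a path of \<open>W\<close> as
    \<open>f\<close> it represents the increment, and with the indicator of \<open>u \<le> x\<close>
    as a function of \<open>x\<close> it represents the step function.\<close>
  have tel: "f (P b) - f (P a) = (\<Sum>l<N. indicator {P a<..P b} (P (Suc l)) * (f (P (Suc l)) - f (P l)))"
    for f :: "real \<Rightarrow> real"
  proof -
    have "f (P b) - f (P a) = (\<Sum>l\<in>{a..<b}. f (P (Suc l)) - f (P l))"
      using ab by (subst sum_Suc_diff') auto
    also have "\<dots> = (\<Sum>l\<in>{a..<b}. indicator {P a<..P b} (P (Suc l)) * (f (P (Suc l)) - f (P l)))"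
      using ab by (intro sum.cong) (auto simp: grid_less_iff[OF P])
    also have "\<dots> = (\<Sum>l<N. indicator {P a<..P b} (P (Suc l)) * (f (P (Suc l)) - f (P l)))"
      using ab by (intro sum.mono_neutral_left) (auto simp: grid_less_iff[OF P] indicator_def)
    finally show ?thesis .
  qed
  have "indicator {P a<..P b} u = (\<Sum>l<N. indicator {P a<..P b} (P (Suc l)) * (indicator {P l<..P (Suc l)} u :: real))" for u
  proof -
    have ind: "indicator {x<..y} u = of_bool (u \<le> y) - (of_bool (u \<le> x) :: real)" if "x \<le> y" for x y :: real
      using that by (auto simp: indicator_def)
    have "indicator {P a<..P b} u = of_bool (u \<le> P b) - (of_bool (u \<le> P a) :: real)"
      using ab by (intro ind) (simp add: grid_less_iff[OF P])
    also have "\<dots> = (\<Sum>l<N. indicator {P a<..P b} (P (Suc l)) * (of_bool (u \<le> P (Suc l)) - of_bool (u \<le> P l)))"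
      by (rule tel)
    also have "\<dots> = (\<Sum>l<N. indicator {P a<..P b} (P (Suc l)) * indicator {P l<..P (Suc l)} u)"
      by (intro sum.cong refl arg_cong2[where f = times] ind[symmetric]) (simp add: grid_less_iff[OF P])
    finally show ?thesis .
  qed
  then show ?thesis
    unfolding elementary_on_grid_def using tel[of "\<lambda>x. W x \<omega>" for \<omega>] by (intro conjI allI) assumption+
qed

lemma elementary_on_grid_step:
  assumes P: "strict_mono_on {..N} P" and p: "mono_on {..n} p" "p ` {..n} \<subseteq> P ` {..N}"
  shows "elementary_on_grid W N P (step_function n p c) (step_integral W n p c)"
proof -
  have "elementary_on_grid W N P (indicator {p i<..p (Suc i)}) (\<lambda>\<omega>. W (p (Suc i)) \<omega> - W (p i) \<omega>)"
    if "i < n" for i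
  proof -
    have "p i \<in> P ` {..N}" "p (Suc i) \<in> P ` {..N}" using p(2) that by auto
    then obtain a b where ab: "a \<le> N" "b \<le> N" "p i = P a" "p (Suc i) = P b" by blast
    moreover have "p i \<le> p (Suc i)" using p(1) that by (auto simp: mono_on_def)
    ultimately show ?thesis
      using elementary_on_grid_interval[OF P, of a b W] by (simp add: grid_less_iff[OF P])
  qed
  then show ?thesis
    unfolding step_function_def[abs_def] step_integral_def[abs_def] by (rule elementary_on_grid_sum)
qed

text \<open>The isometry on a grid: it identifies the \<open>L2\<close> norm of a kernel with the
  Euclidean norm of the coefficients that multiply the normalized increments. Starting at
  \<open>P m\<close> picks out the part that is independent of \<open>W\<close> up to time
  \<open>P m\<close>.\<close>

lemma elementary_on_grid_L2:
  assumes P: "strict_mono_on {..N} P" and \<phi>: "elementary_on_grid W N P \<phi> Y" and m: "m \<le> N"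
  shows "(\<integral>\<^sup>+u\<in>{P m<..}. ennreal ((\<phi> u)\<^sup>2) \<partial>lborel) =
    ennreal (\<Sum>l\<in>{m..<N}. (\<phi> (P (Suc l)) * sqrt (P (Suc l) - P l))\<^sup>2)"
proof -
  have \<phi>_eq: "\<phi> u = (\<Sum>l<N. \<phi> (P (Suc l)) * indicator {P l<..P (Suc l)} u)" for u
    using \<phi> unfolding elementary_on_grid_def by blast
  have le: "P i \<le> P j" if "i \<le> j" "j \<le> N" for i j
    using grid_less_iff(2)[OF P, of i j] that by simp
  have "ennreal ((\<phi> u)\<^sup>2) * indicator {P m<..} u =
      (\<Sum>l\<in>{m..<N}. ennreal ((\<phi> (P (Suc l)))\<^sup>2) * indicator {P l<..P (Suc l)} u)" for u
  proof (cases "\<exists>l<N. u \<in> {P l<..P (Suc l)}")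
    case True
    then obtain l where l: "l < N" "P l < u" "u \<le> P (Suc l)" by auto
    have ind: "u \<in> {P l'<..P (Suc l')} \<longleftrightarrow> l' = l" if "l' < N" for l'
    proof
      assume *: "u \<in> {P l'<..P (Suc l')}"
      show "l' = l"
      proof (rule ccontr)
        assume "l' \<noteq> l"
        then consider "Suc l' \<le> l" | "Suc l \<le> l'" by linarith
        then show False using le[of "Suc l'" l] le[of "Suc l" l'] l that * by cases auto
      qed
    qed (use l in auto)
    have "\<phi> u = (\<Sum>l'<N. if l' = l then \<phi> (P (Suc l)) else 0)"
      by (subst \<phi>_eq, intro sum.cong) (auto simp: indicator_def ind simp del: greaterThanAtMost_iff)
    then have "\<phi> u = \<phi> (P (Suc l))" using l by simp
    moreover have "(\<Sum>l'\<in>{m..<N}. ennreal ((\<phi> (P (Suc l')))\<^sup>2) * indicator {P l'<..P (Suc l')} u) =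
        (\<Sum>l'\<in>{m..<N}. if l' = l then ennreal ((\<phi> (P (Suc l)))\<^sup>2) else 0)"
      by (intro sum.cong) (auto simp: indicator_def ind simp del: greaterThanAtMost_iff)
    moreover have "P m < u \<longleftrightarrow> m \<le> l" using l le[of m l] le[of "Suc l" m] m by (cases "m \<le> l") auto
    ultimately show ?thesis using l by (auto simp: indicator_def)
  next
    case False
    then have "\<phi> u = 0" by (subst \<phi>_eq) (auto simp: indicator_def intro!: sum.neutral)
    moreover have "(\<Sum>l\<in>{m..<N}. ennreal ((\<phi> (P (Suc l)))\<^sup>2) * indicator {P l<..P (Suc l)} u) = 0"
    proof (intro sum.neutral ballI)
      fix l assume "l \<in> {m..<N}"
      with False have "u \<notin> {P l<..P (Suc l)}" by auto
      then show "ennreal ((\<phi> (P (Suc l)))\<^sup>2) * indicator {P l<..P (Suc l)} u = 0"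
        by (simp add: indicator_def)
    qed
    ultimately show ?thesis by simp
  qed
  then have "(\<integral>\<^sup>+u\<in>{P m<..}. ennreal ((\<phi> u)\<^sup>2) \<partial>lborel) =
      (\<integral>\<^sup>+u. (\<Sum>l\<in>{m..<N}. ennreal ((\<phi> (P (Suc l)))\<^sup>2) * indicator {P l<..P (Suc l)} u) \<partial>lborel)"
    by simp
  also have "\<dots> = (\<Sum>l\<in>{m..<N}. ennreal ((\<phi> (P (Suc l)))\<^sup>2) * ennreal (P (Suc l) - P l))"
    using le by (subst nn_integral_sum) (auto intro!: sum.cong simp: nn_integral_cmult)
  also have "\<dots> = (\<Sum>l\<in>{m..<N}. ennreal ((\<phi> (P (Suc l)) * sqrt (P (Suc l) - P l))\<^sup>2))"
    using le by (intro sum.cong) (auto simp: power_mult_distrib ennreal_mult)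
  finally show ?thesis by simp
qed

text \<open>For each \<open>k\<close> there is a single grid for all times in \<open>S\<close>,
  which makes the approximants linear forms in one family of increments. The times in
  \<open>S\<close> are themselves grid points, so that past and future of such a time are unions of
  cells. Since \<open>\<phi> k \<tau>\<close> vanishes outside \<open>{0..\<tau>}\<close>, distances
  can be taken over the whole line and the approximants remain adapted.\<close>

definition wiener_approximation ::
    "'a measure \<Rightarrow> (real \<Rightarrow> 'a \<Rightarrow> real) \<Rightarrow> real set \<Rightarrow> (real \<Rightarrow> real \<Rightarrow> real) \<Rightarrow> (real \<Rightarrow> 'a \<Rightarrow> real) \<Rightarrow>
      (nat \<Rightarrow> nat) \<Rightarrow> (nat \<Rightarrow> nat \<Rightarrow> real) \<Rightarrow> (nat \<Rightarrow> real \<Rightarrow> real \<Rightarrow> real) \<Rightarrow> (nat \<Rightarrow> real \<Rightarrow> 'a \<Rightarrow> real) \<Rightarrow> bool" where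
  "wiener_approximation M W S K X N P \<phi> Y \<longleftrightarrow>
     (\<forall>k. 0 < N k \<and> 0 \<le> P k 0 \<and> strict_mono_on {..N k} (P k) \<and> S \<subseteq> P k ` {..N k}) \<and>
     (\<forall>k. \<forall>\<tau>\<in>S. elementary_on_grid W (N k) (P k) (\<phi> k \<tau>) (Y k \<tau>) \<and> (\<forall>u. u \<notin> {0..\<tau>} \<longrightarrow> \<phi> k \<tau> u = 0) \<and>
       \<phi> k \<tau> \<in> borel_measurable borel \<and> Y k \<tau> \<in> borel_measurable M) \<and>
     (\<forall>\<tau>\<in>S. (\<lambda>k. \<integral>\<^sup>+u. ennreal ((indicator {0..\<tau>} u * K \<tau> u - \<phi> k \<tau> u)\<^sup>2) \<partial>lborel) \<longlonglongrightarrow> 0 \<and>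
       (\<lambda>k. \<integral>\<^sup>+\<omega>. ennreal ((X \<tau> \<omega> - Y k \<tau> \<omega>)\<^sup>2) \<partial>M) \<longlonglongrightarrow> 0)"

lemma wiener_approximation_grid:
  assumes "wiener_approximation M W S K X N P \<phi> Y"
  shows "0 < N k" "0 \<le> P k 0" "strict_mono_on {..N k} (P k)" "S \<subseteq> P k ` {..N k}"
  using assms unfolding wiener_approximation_def by blast+

lemma wiener_approximationD:
  assumes "wiener_approximation M W S K X N P \<phi> Y" "\<tau> \<in> S"
  shows "elementary_on_grid W (N k) (P k) (\<phi> k \<tau>) (Y k \<tau>)"
    and "u \<notin> {0..\<tau>} \<Longrightarrow> \<phi> k \<tau> u = 0"
    and "\<phi> k \<tau> \<in> borel_measurable borel"
    and "Y k \<tau> \<in> borel_measurable M"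
    and "(\<lambda>k. \<integral>\<^sup>+u. ennreal ((indicator {0..\<tau>} u * K \<tau> u - \<phi> k \<tau> u)\<^sup>2) \<partial>lborel) \<longlonglongrightarrow> 0"
    and "(\<lambda>k. \<integral>\<^sup>+\<omega>. ennreal ((X \<tau> \<omega> - Y k \<tau> \<omega>)\<^sup>2) \<partial>M) \<longlonglongrightarrow> 0"
  using assms unfolding wiener_approximation_def by blast+

section \<open>The law of the grid increments and small balls of elementary integrals\<close>

context standard_brownian_motion
begin

text \<open>The normalized increments over disjoint cells are independent and standard normal, so
  their joint law is the product measure on which the Gaussian inequalities were proved.\<close>

lemma grid_law:
  assumes N: "0 < N" and P: "0 \<le> P 0" "strict_mono_on {..N} P"
    and Q: "Measurable.pred (gauss_product {..<N}) Q"
  shows "prob {\<omega>\<in>space M. Q (\<lambda>l\<in>{..<N}. (W (P (Suc l)) \<omega> - W (P l) \<omega>) / sqrt (P (Suc l) - P l))} =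
    measure (gauss_product {..<N}) {x\<in>space (gauss_product {..<N}). Q x}"
proof -
  define \<xi> where "\<xi> l \<omega> = (W (P (Suc l)) \<omega> - W (P l) \<omega>) / sqrt (P (Suc l) - P l)" for l \<omega>
  have pos: "0 \<le> P l" if "l \<le> N" for l using P(1) grid_less_iff(2)[OF P(2), of 0 l] that by simp
  have less: "P l < P (Suc l)" if "l < N" for l
    using grid_less_iff(1)[OF P(2), of l "Suc l"] that by simp
  have rv: "\<xi> l \<in> borel_measurable M" if "l < N" for l
    using random_variable_W pos that unfolding \<xi>_def[abs_def]
    by (intro borel_measurable_divide borel_measurable_diff) auto
  have "indep_vars (\<lambda>_. borel) \<xi> {..<N}"
    using indep_vars_compose2[OF independent_increments[OF P],
      of "\<lambda>l x. x / sqrt (P (Suc l) - P l)" "\<lambda>_. borel"]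
    by (simp add: \<xi>_def[abs_def])
  moreover have "distr M borel (\<xi> l) = std_gauss" if l: "l < N" for l
  proof -
    have "distributed M lborel (\<xi> l) std_normal_density"
      using normal_density_affine[OF gaussian_increments[OF pos less], of l "1 / sqrt (P (Suc l) - P l)" 0] l less[OF l]
      by (simp add: \<xi>_def[abs_def])
    then have "distr M lborel (\<xi> l) = std_gauss" by (simp add: distributed_def)
    then show ?thesis by (metis distr_cong sets_lborel)
  qed
  ultimately have law: "distr M (\<Pi>\<^sub>M l\<in>{..<N}. borel) (\<lambda>\<omega>. \<lambda>l\<in>{..<N}. \<xi> l \<omega>) = gauss_product {..<N}"
    using N rv by (subst (asm) indep_vars_iff_distr_eq_PiM') (auto intro!: PiM_cong)
  have "measure (gauss_product {..<N}) {x\<in>space (gauss_product {..<N}). Q x} =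
      measure (distr M (\<Pi>\<^sub>M l\<in>{..<N}. borel) (\<lambda>\<omega>. \<lambda>l\<in>{..<N}. \<xi> l \<omega>)) {x\<in>space (gauss_product {..<N}). Q x}"
    by (simp only: law)
  also have "\<dots> = prob ((\<lambda>\<omega>. \<lambda>l\<in>{..<N}. \<xi> l \<omega>) -` {x\<in>space (gauss_product {..<N}). Q x} \<inter> space M)"
  proof (rule measure_distr)
    show "(\<lambda>\<omega>. \<lambda>l\<in>{..<N}. \<xi> l \<omega>) \<in> measurable M (\<Pi>\<^sub>M l\<in>{..<N}. borel)"
      using rv by (intro measurable_restrict) auto
    have "{x\<in>space (gauss_product {..<N}). Q x} \<in> sets (gauss_product {..<N})" using Q by measurable
    also have "sets (gauss_product {..<N}) = sets (\<Pi>\<^sub>M l\<in>{..<N}. borel)"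
      by (intro sets_PiM_cong) auto
    finally show "{x\<in>space (gauss_product {..<N}). Q x} \<in> sets (\<Pi>\<^sub>M l\<in>{..<N}. borel)" .
  qed
  also have "(\<lambda>\<omega>. \<lambda>l\<in>{..<N}. \<xi> l \<omega>) -` {x\<in>space (gauss_product {..<N}). Q x} \<inter> space M =
      {\<omega>\<in>space M. Q (\<lambda>l\<in>{..<N}. \<xi> l \<omega>)}"
    by (auto simp: space_PiM)
  finally show ?thesis by (simp add: \<xi>_def)
qed

lemma elementary_on_grid_normalized:
  assumes "strict_mono_on {..N} P" "elementary_on_grid W N P \<phi> Y"
  shows "Y \<omega> = (\<Sum>l<N. \<phi> (P (Suc l)) * sqrt (P (Suc l) - P l) *
    (\<lambda>l\<in>{..<N}. (W (P (Suc l)) \<omega> - W (P l) \<omega>) / sqrt (P (Suc l) - P l)) l)"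
proof -
  have "Y \<omega> = (\<Sum>l<N. \<phi> (P (Suc l)) * (W (P (Suc l)) \<omega> - W (P l) \<omega>))"
    using assms(2) unfolding elementary_on_grid_def by blast
  also have "\<dots> = (\<Sum>l<N. \<phi> (P (Suc l)) * sqrt (P (Suc l) - P l) *
    (\<lambda>l\<in>{..<N}. (W (P (Suc l)) \<omega> - W (P l) \<omega>) / sqrt (P (Suc l) - P l)) l)"
    using grid_less_iff(1)[OF assms(1), of l "Suc l" for l] by (intro sum.cong) auto
  finally show ?thesis .
qed

text \<open>Each factor in Sidak's product decreases as the standard deviation grows, so upper
  bounds \<open>\<sigma> j\<close> on the deviations suffice.\<close>

lemma elementary_small_ball_ge:
  assumes N: "0 < N" and P: "0 \<le> P 0" "strict_mono_on {..N} P" and J: "finite J"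
    and \<phi>: "\<And>j. j \<in> J \<Longrightarrow> elementary_on_grid W N P (\<phi> j) (Y j)"
    and \<sigma>: "\<And>j. j \<in> J \<Longrightarrow> 0 < \<sigma> j"
    and L2: "\<And>j. j \<in> J \<Longrightarrow> (\<integral>\<^sup>+u. ennreal ((\<phi> j u)\<^sup>2) \<partial>lborel) \<le> ennreal ((\<sigma> j)\<^sup>2)"
    and c: "\<And>j. j \<in> J \<Longrightarrow> 0 \<le> c j"
  shows "(\<Prod>j\<in>J. measure std_gauss {s. \<bar>s\<bar> \<le> c j / \<sigma> j}) \<le>
    prob {\<omega>\<in>space M. \<forall>j\<in>J. \<bar>Y j \<omega>\<bar> \<le> c j}"
proof -
  define a where "a j l = \<phi> j (P (Suc l)) * sqrt (P (Suc l) - P l)" for j l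
  have "(\<Prod>j\<in>J. measure std_gauss {s. \<bar>s\<bar> \<le> c j / \<sigma> j}) \<le>
      (\<Prod>j\<in>J. measure std_gauss {s. \<bar>sqrt (\<Sum>l<N. (a j l)\<^sup>2) * s\<bar> \<le> c j})"
  proof (intro prod_mono conjI measure_nonneg std_normal.finite_measure_mono subsetI)
    fix j s assume j: "j \<in> J" and s: "s \<in> {s. \<bar>s\<bar> \<le> c j / \<sigma> j}"
    have "ennreal (\<Sum>l<N. (a j l)\<^sup>2) = (\<integral>\<^sup>+u\<in>{P 0<..}. ennreal ((\<phi> j u)\<^sup>2) \<partial>lborel)"
      using elementary_on_grid_L2[OF P(2) \<phi>[OF j], of 0] by (simp add: a_def atLeast0LessThan)
    also have "\<dots> \<le> (\<integral>\<^sup>+u. ennreal ((\<phi> j u)\<^sup>2) \<partial>lborel)"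
      by (intro nn_integral_mono) (auto simp: indicator_def)
    also note L2[OF j]
    finally have "(\<Sum>l<N. (a j l)\<^sup>2) \<le> (\<sigma> j)\<^sup>2" by simp
    then have "sqrt (\<Sum>l<N. (a j l)\<^sup>2) \<le> \<sigma> j" using \<sigma>[OF j] by (simp add: real_le_lsqrt sum_nonneg)
    then have "\<bar>sqrt (\<Sum>l<N. (a j l)\<^sup>2) * s\<bar> \<le> \<sigma> j * \<bar>s\<bar>"
      by (simp add: abs_mult mult_right_mono sum_nonneg)
    also have "\<dots> \<le> c j" using s \<sigma>[OF j] by (simp add: field_simps)
    finally show "s \<in> {s. \<bar>sqrt (\<Sum>l<N. (a j l)\<^sup>2) * s\<bar> \<le> c j}" by simp
  qed simp
  also have "\<dots> \<le> measure (gauss_product {..<N})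
      {x\<in>space (gauss_product {..<N}). \<forall>j\<in>J. \<bar>\<Sum>l<N. a j l * x l\<bar> \<le> c j}"
    using N by (intro sidak_inequality[OF _ _ J]) auto
  also have "\<dots> = prob {\<omega>\<in>space M. \<forall>j\<in>J. \<bar>Y j \<omega>\<bar> \<le> c j}"
    using elementary_on_grid_normalized[OF P(2) \<phi>] J
    by (subst grid_law[OF N P, symmetric]) (auto simp: a_def intro!: arg_cong2[where f = measure])
  finally show ?thesis .
qed

text \<open>Induction on the number of events. The earlier integrals depend only on cells before
  \<open>\<tau> k\<close>, while the next one still has variance at least the square of
  \<open>\<sigma>\<close> on the cells after \<open>\<tau> k\<close>;
  \<open>gauss_product_fresh_noise\<close> then contributes one more factor.\<close>

lemma elementary_small_ball_le:
  assumes N: "0 < N" and P: "0 \<le> P 0" "strict_mono_on {..N} P"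
    and \<phi>: "\<And>i. i < n \<Longrightarrow> elementary_on_grid W N P (\<phi> i) (Y i)"
    and \<tau>: "\<And>i. i \<le> n \<Longrightarrow> \<tau> i \<in> P ` {..N}" "mono_on {..n} \<tau>"
    and adapted: "\<And>i u. i < n \<Longrightarrow> \<tau> (Suc i) < u \<Longrightarrow> \<phi> i u = 0"
    and \<sigma>: "0 < \<sigma>"
    and L2: "\<And>i. i < n \<Longrightarrow> ennreal (\<sigma>\<^sup>2) \<le> (\<integral>\<^sup>+u\<in>{\<tau> i<..}. ennreal ((\<phi> i u)\<^sup>2) \<partial>lborel)"
    and e: "0 \<le> e"
  shows "prob {\<omega>\<in>space M. \<forall>i<n. \<bar>Y i \<omega>\<bar> \<le> e} \<le> measure std_gauss {..e / \<sigma>} ^ n"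
proof -
  define a where "a j l = \<phi> j (P (Suc l)) * sqrt (P (Suc l) - P l)" for j l
  let ?N = "gauss_product {..<N}"
  have "measure ?N {x\<in>space ?N. \<forall>i<k. \<bar>\<Sum>l<N. a i l * x l\<bar> \<le> e} \<le> measure std_gauss {..e / \<sigma>} ^ k"
    if "k \<le> n" for k
    using that
  proof (induction k)
    case 0
    show ?case using measure_gauss_product_space[of "{..<N}"] by simp
  next
    case (Suc k)
    obtain m where m: "m \<le> N" "\<tau> k = P m" using \<tau>(1)[of k] Suc.prems by auto
    have un: "{..<N} = {..<m} \<union> {m..<N}" using m by auto
    \<comment> \<open>The integral with index \<open>i < k\<close> ends at
      \<open>\<tau> (Suc i) \<le> \<tau> k = P m\<close>, so the cells from \<open>m\<close> on
      carry the coefficient 0.\<close>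
    have zero: "a i l = 0" if "i < k" "m \<le> l" "l < N" for i l
    proof -
      have "\<tau> (Suc i) \<le> \<tau> k" using \<tau>(2) that Suc.prems by (auto simp: mono_on_def)
      also have "\<dots> < P (Suc l)" using m that grid_less_iff(1)[OF P(2), of m "Suc l"] by simp
      finally show ?thesis using adapted[of i] that Suc.prems by (simp add: a_def)
    qed
    have eq: "{x\<in>space ?N. \<forall>i<Suc k. \<bar>\<Sum>l<N. a i l * x l\<bar> \<le> e} =
        {x\<in>space ?N. (\<forall>i<k. \<bar>\<Sum>l<N. a i l * x l\<bar> \<le> e) \<and> \<bar>\<Sum>l<N. a k l * x l\<bar> \<le> e}"
      by (auto simp: less_Suc_eq)
    have "measure ?N {x\<in>space ?N. (\<forall>i<k. \<bar>\<Sum>l<N. a i l * x l\<bar> \<le> e) \<and> \<bar>\<Sum>l<N. a k l * x l\<bar> \<le> e} \<le>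
      measure std_gauss {..e / \<sigma>} *
        measure ?N {x\<in>space ?N. \<forall>i<k. \<bar>\<Sum>l<N. a i l * x l\<bar> \<le> e}"
    proof -
      let ?P = "\<lambda>x. \<forall>i<k. \<bar>\<Sum>l<N. a i l * x l\<bar> \<le> e"
      have meas: "Measurable.pred (gauss_product ({..<m} \<union> {m..<N})) ?P"
        unfolding un[symmetric] by measurable
      have loc: "?P x = ?P y" if "\<forall>l\<in>{..<m}. x l = y l" for x y
      proof -
        have "(\<Sum>l<N. a i l * x l) = (\<Sum>l<N. a i l * y l)" if "i < k" for i
        proof (intro sum.cong refl)
          fix l assume "l \<in> {..<N}"
          then show "a i l * x l = a i l * y l"
            using zero[OF that, of l] \<open>\<forall>l\<in>{..<m}. x l = y l\<close> by (cases "l < m") auto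
        qed
        then show ?thesis by simp
      qed
      have "ennreal (\<sigma>\<^sup>2) \<le> ennreal (\<Sum>l\<in>{m..<N}. (a k l)\<^sup>2)"
        using L2[of k] elementary_on_grid_L2[OF P(2) \<phi> m(1), of k] Suc.prems m by (simp add: a_def)
      then have "\<sigma>\<^sup>2 \<le> (\<Sum>l\<in>{m..<N}. (a k l)\<^sup>2)" by (simp add: sum_nonneg)
      from gauss_product_fresh_noise[OF finite_lessThan finite_atLeastLessThan ivl_disj_int_one(2) meas loc \<sigma> this e]
      show ?thesis unfolding un[symmetric] .
    qed
    also have "\<dots> \<le> measure std_gauss {..e / \<sigma>} * measure std_gauss {..e / \<sigma>} ^ k"
      by (rule mult_left_mono[OF Suc.IH]) (use Suc.prems in simp_all)
    finally show ?case unfolding eq by simp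
  qed
  note bound = this[OF order.refl]
  let ?\<xi> = "\<lambda>\<omega>. \<lambda>l\<in>{..<N}. (W (P (Suc l)) \<omega> - W (P l) \<omega>) / sqrt (P (Suc l) - P l)"
  have "Y i \<omega> = (\<Sum>l<N. a i l * ?\<xi> \<omega> l)" if "i < n" for i \<omega>
    unfolding a_def by (rule elementary_on_grid_normalized[OF P(2) \<phi>[OF that]])
  then have 1: "{\<omega>\<in>space M. \<forall>i<n. \<bar>Y i \<omega>\<bar> \<le> e} = {\<omega>\<in>space M. \<forall>i<n. \<bar>\<Sum>l<N. a i l * ?\<xi> \<omega> l\<bar> \<le> e}"
    by (intro Collect_cong conj_cong refl all_cong) simp
  have 2: "prob {\<omega>\<in>space M. \<forall>i<n. \<bar>\<Sum>l<N. a i l * ?\<xi> \<omega> l\<bar> \<le> e} =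
      measure ?N {x\<in>space ?N. \<forall>i<n. \<bar>\<Sum>l<N. a i l * x l\<bar> \<le> e}"
    by (rule grid_law[OF N P, where Q = "\<lambda>x. \<forall>i<n. \<bar>\<Sum>l<N. a i l * x l\<bar> \<le> e"]) measurable
  show ?thesis unfolding 1 2 by (rule bound)
qed


section \<open>From elementary integrals to Wiener integrals\<close>

text \<open>For each \<open>k\<close>, the partition points of the step functions of all times in
  \<open>S\<close> are collected and sorted into one grid. Refining a partition changes neither the
  step function nor its integral.\<close>

lemma wiener_integral_approx:
  assumes S: "finite S" "S \<subseteq> {0..}"
    and X: "\<And>\<tau>. \<tau> \<in> S \<Longrightarrow> has_wiener_integral M W \<tau> (K \<tau>) (X \<tau>)"
  shows "\<exists>N P \<phi> Y. wiener_approximation M W S K X N P \<phi> Y"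
proof -
  define R where "R \<tau> n p c \<longleftrightarrow>
      (\<forall>k. 0 \<le> p k 0 \<and> mono_on {..n k} (p k) \<and> p k (n k) \<le> \<tau>) \<and>
      (\<lambda>k. \<integral>\<^sup>+u\<in>{0..\<tau>}. ennreal ((K \<tau> u - step_function (n k) (p k) (c k) u)\<^sup>2) \<partial>lborel) \<longlonglongrightarrow> 0 \<and>
      (\<lambda>k. \<integral>\<^sup>+\<omega>. ennreal ((X \<tau> \<omega> - step_integral W (n k) (p k) (c k) \<omega>)\<^sup>2) \<partial>M) \<longlonglongrightarrow> 0"
    for \<tau> n p c
  have "\<forall>\<tau>\<in>S. \<exists>n p c. R \<tau> n p c" using X unfolding has_wiener_integral_def R_def by blast
  then obtain n p c where R: "\<And>\<tau>. \<tau> \<in> S \<Longrightarrow> R \<tau> (n \<tau>) (p \<tau>) (c \<tau>)" by metis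
  note * = R[unfolded R_def]
  have p: "0 \<le> p \<tau> k i" "p \<tau> k i \<le> \<tau>" if "\<tau> \<in> S" "i \<le> n \<tau> k" for \<tau> k i
  proof -
    have "mono_on {..n \<tau> k} (p \<tau> k)" using * that by blast
    then have "p \<tau> k 0 \<le> p \<tau> k i" "p \<tau> k i \<le> p \<tau> k (n \<tau> k)" using that by (auto simp: mono_on_def)
    then show "0 \<le> p \<tau> k i" "p \<tau> k i \<le> \<tau>" using *[OF that(1)] by (meson order.trans)+
  qed
  \<comment> \<open>Including \<open>0\<close> and \<open>1\<close> guarantees at least one cell,
    even if \<open>S\<close> is empty or contains only \<open>0\<close>.\<close>
  define Q where "Q k = insert 0 (insert 1 (S \<union> (\<Union>\<tau>\<in>S. p \<tau> k ` {..n \<tau> k})))" for k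
  have Q: "finite (Q k)" "Q k \<subseteq> {0..}" "{0, 1} \<subseteq> Q k" for k using S p by (auto simp: Q_def)
  define N where "N k = card (Q k) - 1" for k
  define P where "P k i = sorted_list_of_set (Q k) ! i" for k i
  have card2: "2 \<le> card (Q k)" for k using card_mono[OF Q(1) Q(3), of k] by simp
  have lt: "i \<le> N k \<longleftrightarrow> i < length (sorted_list_of_set (Q k))" for i k
    unfolding N_def length_sorted_list_of_set using card2[of k] by arith
  have smono: "strict_mono_on {..N k} (P k)" for k using strict_sorted_list_of_set[of "Q k"]
    by (auto simp: strict_mono_on_def P_def lt sorted_wrt_iff_nth_less)
  have img: "P k ` {..N k} = Q k" for k
  proof -
    have "P k ` {..N k} = (!) (sorted_list_of_set (Q k)) ` {..<length (sorted_list_of_set (Q k))}"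
      unfolding P_def by (intro image_cong) (auto simp: lt)
    also have "\<dots> = Q k"
      using Q(1) by (metis lessThan_atLeast0 nth_image set_sorted_list_of_set take_all_iff order.refl)
    finally show ?thesis .
  qed
  define \<phi> where "\<phi> k \<tau> = step_function (n \<tau> k) (p \<tau> k) (c \<tau> k)" for k \<tau>
  define Y where "Y k \<tau> = step_integral W (n \<tau> k) (p \<tau> k) (c \<tau> k)" for k \<tau>
  have zero: "\<phi> k \<tau> u = 0" if "\<tau> \<in> S" "u \<notin> {0..\<tau>}" for k \<tau> u unfolding \<phi>_def step_function_def
  proof (intro sum.neutral ballI)
    fix i assume i: "i \<in> {..<n \<tau> k}"
    have "u \<notin> {p \<tau> k i<..p \<tau> k (Suc i)}"
      using p[OF that(1), of i k] p[OF that(1), of "Suc i" k] i that(2) by auto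
    then show "c \<tau> k i * indicator {p \<tau> k i<..p \<tau> k (Suc i)} u = 0" by (simp add: indicator_def)
  qed
  have "wiener_approximation M W S K X N P \<phi> Y" unfolding wiener_approximation_def
  proof (intro conjI allI ballI impI)
    show "0 < N k" for k using card2[of k] by (simp add: N_def)
    show "0 \<le> P k 0" for k using Q(2)[of k] img[of k] by auto
    show "strict_mono_on {..N k} (P k)" for k by (rule smono)
    show "S \<subseteq> P k ` {..N k}" for k unfolding img by (auto simp: Q_def)
    show "elementary_on_grid W (N k) (P k) (\<phi> k \<tau>) (Y k \<tau>)" if "\<tau> \<in> S" for k \<tau>
      unfolding \<phi>_def Y_def using *[OF that] that
      by (intro elementary_on_grid_step smono) (auto simp: img Q_def)
    show "\<phi> k \<tau> u = 0" if "\<tau> \<in> S" "u \<notin> {0..\<tau>}" for k \<tau> u using that by (rule zero)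
    show "\<phi> k \<tau> \<in> borel_measurable borel" for k \<tau>
      unfolding \<phi>_def step_function_def[abs_def] by measurable
    show "Y k \<tau> \<in> borel_measurable M" if "\<tau> \<in> S" for k \<tau>
      unfolding Y_def step_integral_def[abs_def] using p[OF that]
      by (intro borel_measurable_sum borel_measurable_times borel_measurable_diff random_variable_W) auto
    fix \<tau> assume \<tau>: "\<tau> \<in> S"
    have "(indicator {0..\<tau>} u * K \<tau> u - \<phi> k \<tau> u)\<^sup>2 = indicator {0..\<tau>} u * (K \<tau> u - \<phi> k \<tau> u)\<^sup>2" for k u
      using zero[OF \<tau>, of u k] by (cases "u \<in> {0..\<tau>}") (simp_all add: indicator_def)
    then have "(\<integral>\<^sup>+u. ennreal ((indicator {0..\<tau>} u * K \<tau> u - \<phi> k \<tau> u)\<^sup>2) \<partial>lborel) =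
        (\<integral>\<^sup>+u\<in>{0..\<tau>}. ennreal ((K \<tau> u - step_function (n \<tau> k) (p \<tau> k) (c \<tau> k) u)\<^sup>2) \<partial>lborel)" for k
      unfolding \<phi>_def by (intro nn_integral_cong) (auto simp: indicator_def)
    then show "(\<lambda>k. \<integral>\<^sup>+u. ennreal ((indicator {0..\<tau>} u * K \<tau> u - \<phi> k \<tau> u)\<^sup>2) \<partial>lborel) \<longlonglongrightarrow> 0"
      using *[OF \<tau>] by simp
    show "(\<lambda>k. \<integral>\<^sup>+\<omega>. ennreal ((X \<tau> \<omega> - Y k \<tau> \<omega>)\<^sup>2) \<partial>M) \<longlonglongrightarrow> 0" using *[OF \<tau>] by (simp add: Y_def)
  qed
  then show ?thesis by blast
qed

lemma L2_tendsto_imp_prob_tendsto: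
  assumes [measurable]: "X \<in> borel_measurable M" "\<And>k. Y k \<in> borel_measurable M"
    and lim: "(\<lambda>k. \<integral>\<^sup>+\<omega>. ennreal ((X \<omega> - Y k \<omega>)\<^sup>2) \<partial>M) \<longlonglongrightarrow> 0" and h: "0 < (h :: real)"
  shows "(\<lambda>k. prob {\<omega>\<in>space M. h < \<bar>X \<omega> - Y k \<omega>\<bar>}) \<longlonglongrightarrow> 0"
proof -
  have "emeasure M {\<omega>\<in>space M. h < \<bar>X \<omega> - Y k \<omega>\<bar>} \<le> ennreal (1 / h\<^sup>2) * (\<integral>\<^sup>+\<omega>. ennreal ((X \<omega> - Y k \<omega>)\<^sup>2) \<partial>M)" for k
  proof -
    have "emeasure M {\<omega>\<in>space M. h < \<bar>X \<omega> - Y k \<omega>\<bar>} = (\<integral>\<^sup>+\<omega>. indicator {\<omega>\<in>space M. h < \<bar>X \<omega> - Y k \<omega>\<bar>} \<omega> \<partial>M)"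
      by simp
    also have "\<dots> \<le> (\<integral>\<^sup>+\<omega>. ennreal (1 / h\<^sup>2) * ennreal ((X \<omega> - Y k \<omega>)\<^sup>2) \<partial>M)"
    proof (rule nn_integral_mono)
      fix \<omega>
      have "h < \<bar>X \<omega> - Y k \<omega>\<bar> \<Longrightarrow> 1 \<le> (X \<omega> - Y k \<omega>)\<^sup>2 / h\<^sup>2"
        using h power_mono[of h "\<bar>X \<omega> - Y k \<omega>\<bar>" 2] by simp
      then show "indicator {\<omega>\<in>space M. h < \<bar>X \<omega> - Y k \<omega>\<bar>} \<omega> \<le> ennreal (1 / h\<^sup>2) * ennreal ((X \<omega> - Y k \<omega>)\<^sup>2)"
        by (auto simp: indicator_def ennreal_mult[symmetric])
    qed
    also have "\<dots> = ennreal (1 / h\<^sup>2) * (\<integral>\<^sup>+\<omega>. ennreal ((X \<omega> - Y k \<omega>)\<^sup>2) \<partial>M)"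
      by (rule nn_integral_cmult) measurable
    finally show ?thesis .
  qed
  note bound = this
  have "(\<lambda>k. ennreal (1 / h\<^sup>2) * (\<integral>\<^sup>+\<omega>. ennreal ((X \<omega> - Y k \<omega>)\<^sup>2) \<partial>M)) \<longlonglongrightarrow> ennreal (1 / h\<^sup>2) * 0"
    by (rule ennreal_tendsto_cmult[OF _ lim]) simp
  then have lim': "(\<lambda>k. ennreal (1 / h\<^sup>2) * (\<integral>\<^sup>+\<omega>. ennreal ((X \<omega> - Y k \<omega>)\<^sup>2) \<partial>M)) \<longlonglongrightarrow> 0" by simp
  have "(\<lambda>k. emeasure M {\<omega>\<in>space M. h < \<bar>X \<omega> - Y k \<omega>\<bar>}) \<longlonglongrightarrow> 0"
    by (rule tendsto_sandwich[OF _ _ tendsto_const lim']) (simp_all add: bound)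
  then show ?thesis
    using tendsto_enn2real[of "\<lambda>k. emeasure M {\<omega>\<in>space M. h < \<bar>X \<omega> - Y k \<omega>\<bar>}" 0 sequentially]
    by (simp add: measure_def)
qed


lemma ennreal_three_sum:
  "0 \<le> x \<Longrightarrow> 0 \<le> y \<Longrightarrow> 0 \<le> z \<Longrightarrow> 3 * (ennreal x + ennreal y + ennreal z) = ennreal (3 * (x + y + z))"
  by (simp add: ennreal_mult del: distrib_left_numeral)

lemma nn_integral_square_3:
  fixes f g h :: "real \<Rightarrow> real"
  assumes [measurable]: "f \<in> borel_measurable borel" "g \<in> borel_measurable borel" "h \<in> borel_measurable borel"
  shows "(\<integral>\<^sup>+u. ennreal ((f u + g u + h u)\<^sup>2) \<partial>lborel) \<le>
    3 * ((\<integral>\<^sup>+u. ennreal ((f u)\<^sup>2) \<partial>lborel) + (\<integral>\<^sup>+u. ennreal ((g u)\<^sup>2) \<partial>lborel) + (\<integral>\<^sup>+u. ennreal ((h u)\<^sup>2) \<partial>lborel))"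
proof -
  have "(a + b + c)\<^sup>2 \<le> 3 * (a\<^sup>2 + b\<^sup>2 + c\<^sup>2)" for a b c :: real
    using zero_le_power2[of "a - b"] zero_le_power2[of "b - c"] zero_le_power2[of "a - c"]
    by (simp add: power2_eq_square algebra_simps)
  then have "(\<integral>\<^sup>+u. ennreal ((f u + g u + h u)\<^sup>2) \<partial>lborel) \<le>
      (\<integral>\<^sup>+u. ennreal (3 * ((f u)\<^sup>2 + (g u)\<^sup>2 + (h u)\<^sup>2)) \<partial>lborel)"
    by (intro nn_integral_mono ennreal_leI)
  also have "\<dots> = (\<integral>\<^sup>+u. 3 * (ennreal ((f u)\<^sup>2) + ennreal ((g u)\<^sup>2) + ennreal ((h u)\<^sup>2)) \<partial>lborel)"
    by (simp only: ennreal_three_sum zero_le_power2)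
  also have "\<dots> = 3 * ((\<integral>\<^sup>+u. ennreal ((f u)\<^sup>2) \<partial>lborel) + (\<integral>\<^sup>+u. ennreal ((g u)\<^sup>2) \<partial>lborel) + (\<integral>\<^sup>+u. ennreal ((h u)\<^sup>2) \<partial>lborel))"
    by (simp add: nn_integral_cmult nn_integral_add del: distrib_left_numeral)
  finally show ?thesis .
qed

lemma prob_near_event:
  fixes X Y :: "'i \<Rightarrow> 'a \<Rightarrow> real"
  assumes S: "finite S"
    and "\<And>\<tau>. \<tau> \<in> S \<Longrightarrow> X \<tau> \<in> borel_measurable M" "\<And>\<tau>. \<tau> \<in> S \<Longrightarrow> Y \<tau> \<in> borel_measurable M"
    and AB: "A \<in> events" "B \<in> events"
    and sub: "\<And>\<omega>. \<omega> \<in> A \<Longrightarrow> (\<And>\<tau>. \<tau> \<in> S \<Longrightarrow> \<bar>X \<tau> \<omega> - Y \<tau> \<omega>\<bar> \<le> h) \<Longrightarrow> \<omega> \<in> B"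
  shows "prob A \<le> prob B + (\<Sum>\<tau>\<in>S. prob {\<omega>\<in>space M. h < \<bar>X \<tau> \<omega> - Y \<tau> \<omega>\<bar>})"
proof -
  let ?E = "\<lambda>\<tau>. {\<omega>\<in>space M. h < \<bar>X \<tau> \<omega> - Y \<tau> \<omega>\<bar>}"
  have E: "?E \<tau> \<in> events" if "\<tau> \<in> S" for \<tau>
  proof -
    have "(\<lambda>\<omega>. \<bar>X \<tau> \<omega> - Y \<tau> \<omega>\<bar>) \<in> borel_measurable M"
      by (intro borel_measurable_abs borel_measurable_diff assms(2,3) that)
    from borel_measurable_less[OF borel_measurable_const this, of h] show ?thesis .
  qed
  have U: "(\<Union>\<tau>\<in>S. ?E \<tau>) \<in> events" by (rule sets.finite_UN[OF S E])
  have 1: "prob A \<le> prob (B \<union> (\<Union>\<tau>\<in>S. ?E \<tau>))"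
  proof (rule finite_measure_mono)
    show "A \<subseteq> B \<union> (\<Union>\<tau>\<in>S. ?E \<tau>)"
    proof
      fix \<omega> assume \<omega>: "\<omega> \<in> A"
      then have "\<omega> \<in> space M" using sets.sets_into_space[OF AB(1)] by blast
      then show "\<omega> \<in> B \<union> (\<Union>\<tau>\<in>S. ?E \<tau>)" using sub[OF \<omega>] by (auto simp: not_le[symmetric])
    qed
    show "B \<union> (\<Union>\<tau>\<in>S. ?E \<tau>) \<in> events" by (rule sets.Un[OF AB(2) U])
  qed
  have 2: "prob (B \<union> (\<Union>\<tau>\<in>S. ?E \<tau>)) \<le> prob B + prob (\<Union>\<tau>\<in>S. ?E \<tau>)"
    by (rule measure_Un_le[OF AB(2) U])
  have 3: "prob (\<Union>\<tau>\<in>S. ?E \<tau>) \<le> (\<Sum>\<tau>\<in>S. prob (?E \<tau>))" by (rule measure_UNION_le[OF S E])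
  show ?thesis by (rule order.trans[OF 1 order.trans[OF 2 add_left_mono[OF 3]]])
qed

lemma sets_abs_diff_le:
  fixes f g :: "'b \<Rightarrow> real"
  assumes [measurable]: "f \<in> borel_measurable A" "g \<in> borel_measurable A"
  shows "{x\<in>space A. \<bar>f x - g x\<bar> \<le> c} \<in> sets A"
  by measurable

text \<open>The factor \<open>4\<close> is the price of approximation: the approximants have at most
  twice the deviation, and they are held to half the threshold, so that the limits meet the full
  one.\<close>

lemma wiener_integral_small_ball_ge:
  fixes u v c \<sigma> :: "'j \<Rightarrow> real"
  assumes X: "\<And>\<tau>. 0 \<le> \<tau> \<Longrightarrow> has_wiener_integral M W \<tau> (K \<tau>) (X \<tau>)"
    and J: "finite J" and uv: "\<And>j. j \<in> J \<Longrightarrow> 0 \<le> u j" "\<And>j. j \<in> J \<Longrightarrow> 0 \<le> v j"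
    and \<sigma>: "\<And>j. j \<in> J \<Longrightarrow> 0 < \<sigma> j" and c: "\<And>j. j \<in> J \<Longrightarrow> 0 < c j"
    and L2: "\<And>j. j \<in> J \<Longrightarrow> (\<integral>\<^sup>+s. ennreal ((indicator {0..u j} s * K (u j) s - indicator {0..v j} s * K (v j) s)\<^sup>2) \<partial>lborel)
      \<le> ennreal ((\<sigma> j)\<^sup>2)"
  shows "(\<Prod>j\<in>J. measure std_gauss {s. \<bar>s\<bar> \<le> c j / (4 * \<sigma> j)}) \<le>
    prob {\<omega>\<in>space M. \<forall>j\<in>J. \<bar>X (u j) \<omega> - X (v j) \<omega>\<bar> \<le> c j}"
proof -
  define S where "S = u ` J \<union> v ` J"
  have S: "finite S" "S \<subseteq> {0..}" using J uv by (auto simp: S_def)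
  have S_mem: "u j \<in> S" "v j \<in> S" if "j \<in> J" for j using that by (auto simp: S_def)
  have X': "has_wiener_integral M W \<tau> (K \<tau>) (X \<tau>)" if "\<tau> \<in> S" for \<tau> using X S that by auto
  obtain N P \<phi> Y where A: "wiener_approximation M W S K X N P \<phi> Y"
    using wiener_integral_approx[OF S X'] by blast
  note N = wiener_approximation_grid[OF A] and el = wiener_approximationD(1)[OF A]
    and zero = wiener_approximationD(2)[OF A] and \<phi>m = wiener_approximationD(3)[OF A]
    and Ym = wiener_approximationD(4)[OF A] and lim\<phi> = wiener_approximationD(5)[OF A]
    and limY = wiener_approximationD(6)[OF A]
  have Xm: "X \<tau> \<in> borel_measurable M" if "\<tau> \<in> S" for \<tau>
    using X'[OF that] by (simp add: has_wiener_integral_def)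
  have Km: "(\<lambda>s. indicator {0..\<tau>} s * K \<tau> s) \<in> borel_measurable borel" if "\<tau> \<in> S" for \<tau>
    using X'[OF that] by (simp add: has_wiener_integral_def set_borel_measurable_def)
  let ?d = "\<lambda>k \<tau>. \<integral>\<^sup>+u. ennreal ((indicator {0..\<tau>} u * K \<tau> u - \<phi> k \<tau> u)\<^sup>2) \<partial>lborel"
  have ev: "\<forall>\<^sub>F k in sequentially. \<forall>j\<in>J. (\<integral>\<^sup>+s. ennreal ((\<phi> k (u j) s - \<phi> k (v j) s)\<^sup>2) \<partial>lborel) \<le> ennreal ((2 * \<sigma> j)\<^sup>2)"
    unfolding eventually_ball_finite_distrib[OF J]
  proof
    fix j assume j: "j \<in> J"
    \<comment> \<open>A square of a sum of three terms is at most three times the sum of squares,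
      and \<open>3 * (1/6 + 1 + 1/6) = 4\<close> is the square of the permitted factor 2.\<close>
    have "0 < ennreal ((\<sigma> j)\<^sup>2 / 6)" using \<sigma>[OF j] by simp
    then have "\<forall>\<^sub>F k in sequentially. ?d k (u j) < ennreal ((\<sigma> j)\<^sup>2 / 6)" "\<forall>\<^sub>F k in sequentially. ?d k (v j) < ennreal ((\<sigma> j)\<^sup>2 / 6)"
      using order_tendstoD(2)[OF lim\<phi>[OF S_mem(1)[OF j]]] order_tendstoD(2)[OF lim\<phi>[OF S_mem(2)[OF j]]] by blast+
    then show "\<forall>\<^sub>F k in sequentially. (\<integral>\<^sup>+s. ennreal ((\<phi> k (u j) s - \<phi> k (v j) s)\<^sup>2) \<partial>lborel) \<le> ennreal ((2 * \<sigma> j)\<^sup>2)"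
    proof eventually_elim
      case (elim k)
      let ?f = "\<lambda>s. \<phi> k (u j) s - indicator {0..u j} s * K (u j) s"
        and ?g = "\<lambda>s. indicator {0..u j} s * K (u j) s - indicator {0..v j} s * K (v j) s"
        and ?h = "\<lambda>s. indicator {0..v j} s * K (v j) s - \<phi> k (v j) s"
      have f: "(\<integral>\<^sup>+s. ennreal ((?f s)\<^sup>2) \<partial>lborel) = ?d k (u j)"
        by (intro nn_integral_cong) (simp add: power2_commute)
      have "(\<integral>\<^sup>+s. ennreal ((\<phi> k (u j) s - \<phi> k (v j) s)\<^sup>2) \<partial>lborel) = (\<integral>\<^sup>+s. ennreal ((?f s + ?g s + ?h s)\<^sup>2) \<partial>lborel)"
        by simp
      also have "\<dots> \<le> 3 * ((\<integral>\<^sup>+s. ennreal ((?f s)\<^sup>2) \<partial>lborel) + (\<integral>\<^sup>+s. ennreal ((?g s)\<^sup>2) \<partial>lborel) + (\<integral>\<^sup>+s. ennreal ((?h s)\<^sup>2) \<partial>lborel))"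
        using S_mem[OF j] by (intro nn_integral_square_3 borel_measurable_diff Km \<phi>m)
      also have "\<dots> \<le> 3 * (ennreal ((\<sigma> j)\<^sup>2 / 6) + ennreal ((\<sigma> j)\<^sup>2) + ennreal ((\<sigma> j)\<^sup>2 / 6))"
        unfolding f using elim L2[OF j] by (intro mult_left_mono add_mono) (auto intro: less_imp_le)
      also have "\<dots> = ennreal (3 * ((\<sigma> j)\<^sup>2 / 6 + (\<sigma> j)\<^sup>2 + (\<sigma> j)\<^sup>2 / 6))"
        by (rule ennreal_three_sum) simp_all
      also have "3 * ((\<sigma> j)\<^sup>2 / 6 + (\<sigma> j)\<^sup>2 + (\<sigma> j)\<^sup>2 / 6) = (2 * \<sigma> j)\<^sup>2" by (simp add: power_mult_distrib)
      finally show ?case .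
    qed
  qed
  \<comment> \<open>An increment involves two times, so errors up to a quarter of the threshold at
    each of them use up the half that was kept in reserve. For empty \<open>J\<close> any positive
    number serves.\<close>
  obtain h where h: "0 < h" "\<And>j. j \<in> J \<Longrightarrow> h \<le> c j / 4"
  proof (cases "J = {}")
    case False
    then show ?thesis using J c by (intro that[of "Min ((\<lambda>j. c j / 4) ` J)"] Min_le) auto
  qed (use that[of 1] in simp)
  let ?err = "\<lambda>k. \<Sum>\<tau>\<in>S. prob {\<omega>\<in>space M. h < \<bar>Y k \<tau> \<omega> - X \<tau> \<omega>\<bar>}"
  let ?L = "\<Prod>j\<in>J. measure std_gauss {s. \<bar>s\<bar> \<le> c j / (4 * \<sigma> j)}"
    and ?R = "prob {\<omega>\<in>space M. \<forall>j\<in>J. \<bar>X (u j) \<omega> - X (v j) \<omega>\<bar> \<le> c j}"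
  have "?err \<longlonglongrightarrow> (\<Sum>\<tau>\<in>S. 0)"
    using L2_tendsto_imp_prob_tendsto[OF Xm Ym limY h(1)] by (intro tendsto_sum) (simp add: abs_minus_commute)
  then have "(\<lambda>k. ?R + ?err k) \<longlonglongrightarrow> ?R" using tendsto_add[OF tendsto_const[of ?R]] by fastforce
  moreover have "\<forall>\<^sub>F k in sequentially. ?L \<le> ?R + ?err k" using ev
  proof eventually_elim
    case (elim k)
    have "?L = (\<Prod>j\<in>J. measure std_gauss {s. \<bar>s\<bar> \<le> (c j / 2) / (2 * \<sigma> j)})" by simp
    also have "\<dots> \<le> prob {\<omega>\<in>space M. \<forall>j\<in>J. \<bar>Y k (u j) \<omega> - Y k (v j) \<omega>\<bar> \<le> c j / 2}"
    proof (rule elementary_small_ball_ge[OF N(1) N(2) N(3) J])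
      show "elementary_on_grid W (N k) (P k) (\<lambda>s. \<phi> k (u j) s - \<phi> k (v j) s) (\<lambda>\<omega>. Y k (u j) \<omega> - Y k (v j) \<omega>)"
        if "j \<in> J" for j
        using that S_mem by (intro elementary_on_grid_diff el) auto
    qed (use elim \<sigma> c in \<open>auto simp: less_imp_le\<close>)
    also have "\<dots> \<le> ?R + ?err k"
    proof (rule prob_near_event[OF S(1) Ym Xm])
      show "{\<omega> \<in> space M. \<forall>j\<in>J. \<bar>Y k (u j) \<omega> - Y k (v j) \<omega>\<bar> \<le> c j / 2} \<in> events"
        by (intro sets.sets_Collect_finite_All sets_abs_diff_le Ym S_mem J)
      show "{\<omega> \<in> space M. \<forall>j\<in>J. \<bar>X (u j) \<omega> - X (v j) \<omega>\<bar> \<le> c j} \<in> events"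
        by (intro sets.sets_Collect_finite_All sets_abs_diff_le Xm S_mem J)
      fix \<omega> assume \<omega>: "\<omega> \<in> {\<omega> \<in> space M. \<forall>j\<in>J. \<bar>Y k (u j) \<omega> - Y k (v j) \<omega>\<bar> \<le> c j / 2}"
        and near: "\<And>\<tau>. \<tau> \<in> S \<Longrightarrow> \<bar>Y k \<tau> \<omega> - X \<tau> \<omega>\<bar> \<le> h"
      have "\<bar>X (u j) \<omega> - X (v j) \<omega>\<bar> \<le> c j" if "j \<in> J" for j
      proof -
        have "\<bar>Y k (u j) \<omega> - Y k (v j) \<omega>\<bar> \<le> c j / 2" using \<omega> that by auto
        then show ?thesis
          using near[OF S_mem(1)[OF that]] near[OF S_mem(2)[OF that]] h(2)[OF that] by linarith
      qed
      with \<omega> show "\<omega> \<in> {\<omega> \<in> space M. \<forall>j\<in>J. \<bar>X (u j) \<omega> - X (v j) \<omega>\<bar> \<le> c j}" by auto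
    qed
    finally show ?case .
  qed
  ultimately show ?thesis by (rule tendsto_lowerbound) simp
qed

text \<open>All increments start at \<open>\<tau> 0\<close>, whose kernel does not reach beyond
  \<open>\<tau> 0\<close>. The innovation after \<open>\<tau> i\<close> therefore comes from the
  kernel at \<open>\<tau> (Suc i)\<close> alone, and this is the only kernel in \<open>L2\<close>.
  The factor \<open>4\<close> arises from doubling the threshold and halving the deviation for the
  approximants.\<close>

lemma wiener_integral_small_ball_le:
  assumes X: "\<And>\<tau>. 0 \<le> \<tau> \<Longrightarrow> has_wiener_integral M W \<tau> (K \<tau>) (X \<tau>)"
    and \<tau>: "0 \<le> \<tau> 0" "mono_on {..n} \<tau>" and \<sigma>: "0 < \<sigma>" and e: "0 < e"
    and L2: "\<And>i. i < n \<Longrightarrow> ennreal (\<sigma>\<^sup>2) \<le>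
      (\<integral>\<^sup>+s\<in>{\<tau> i<..}. ennreal ((indicator {0..\<tau> (Suc i)} s * K (\<tau> (Suc i)) s)\<^sup>2) \<partial>lborel)"
  shows "prob {\<omega>\<in>space M. \<forall>i<n. \<bar>X (\<tau> (Suc i)) \<omega> - X (\<tau> 0) \<omega>\<bar> \<le> e} \<le>
    measure std_gauss {..4 * e / \<sigma>} ^ n"
proof -
  define S where "S = \<tau> ` {..n}"
  have \<tau>0: "\<tau> 0 \<le> \<tau> i" if "i \<le> n" for i using \<tau>(2) that by (auto simp: mono_on_def)
  have S: "finite S" "S \<subseteq> {0..}" using \<tau>(1) \<tau>0 by (auto simp: S_def intro: order.trans)
  have S_mem: "\<tau> i \<in> S" if "i \<le> n" for i using that by (auto simp: S_def)
  have X': "has_wiener_integral M W s (K s) (X s)" if "s \<in> S" for s using X S that by auto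
  obtain N P \<phi> Y where A: "wiener_approximation M W S K X N P \<phi> Y"
    using wiener_integral_approx[OF S X'] by blast
  note N = wiener_approximation_grid[OF A] and el = wiener_approximationD(1)[OF A]
    and zero = wiener_approximationD(2)[OF A] and \<phi>m = wiener_approximationD(3)[OF A]
    and Ym = wiener_approximationD(4)[OF A] and lim\<phi> = wiener_approximationD(5)[OF A]
    and limY = wiener_approximationD(6)[OF A]
  have Xm: "X s \<in> borel_measurable M" if "s \<in> S" for s
    using X'[OF that] by (simp add: has_wiener_integral_def)
  have Km: "(\<lambda>u. indicator {0..s} u * K s u) \<in> borel_measurable borel" if "s \<in> S" for s
    using X'[OF that] by (simp add: has_wiener_integral_def set_borel_measurable_def)
  let ?d = "\<lambda>k s. \<integral>\<^sup>+u. ennreal ((indicator {0..s} u * K s u - \<phi> k s u)\<^sup>2) \<partial>lborel"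
  let ?\<psi> = "\<lambda>k i u. \<phi> k (\<tau> (Suc i)) u - \<phi> k (\<tau> 0) u"
  have ev: "\<forall>\<^sub>F k in sequentially. \<forall>i\<in>{..<n}. ennreal ((\<sigma> / 2)\<^sup>2) \<le> (\<integral>\<^sup>+u\<in>{\<tau> i<..}. ennreal ((?\<psi> k i u)\<^sup>2) \<partial>lborel)"
    unfolding eventually_ball_finite_distrib[OF finite_lessThan]
  proof
    fix i assume "i \<in> {..<n}"
    then have i: "i < n" "i \<le> n" "Suc i \<le> n" by auto
    \<comment> \<open>If \<open>x\<close> is the squared norm of the approximant after
      \<open>\<tau> i\<close>, the bound on squares of sums gives
      \<open>\<sigma>\<^sup>2 \<le> 3 * (x + \<sigma>\<^sup>2 / 12)\<close>, that is,
      \<open>x\<close> is at least a quarter of \<open>\<sigma>\<^sup>2\<close>.\<close>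
    have "0 < ennreal (\<sigma>\<^sup>2 / 12)" using \<sigma> by simp
    then have "\<forall>\<^sub>F k in sequentially. ?d k (\<tau> (Suc i)) < ennreal (\<sigma>\<^sup>2 / 12)"
      using order_tendstoD(2)[OF lim\<phi>[OF S_mem[OF i(3)]]] by blast
    then show "\<forall>\<^sub>F k in sequentially. ennreal ((\<sigma> / 2)\<^sup>2) \<le> (\<integral>\<^sup>+u\<in>{\<tau> i<..}. ennreal ((?\<psi> k i u)\<^sup>2) \<partial>lborel)"
    proof eventually_elim
      case (elim k)
      let ?T = "\<tau> (Suc i)"
      \<comment> \<open>Beyond \<open>\<tau> i \<ge> \<tau> 0\<close> the approximant for
        \<open>\<tau> 0\<close> vanishes.\<close>
      have ind: "indicator {\<tau> i<..} u * ?\<psi> k i u = indicator {\<tau> i<..} u * \<phi> k ?T u" for u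
        using zero[OF S_mem[of 0], of u k] \<tau>0[OF i(2)] by (auto simp: indicator_def)
      let ?f = "\<lambda>u. indicator {\<tau> i<..} u * ?\<psi> k i u"
        and ?g = "\<lambda>u. indicator {\<tau> i<..} u * (indicator {0..?T} u * K ?T u - \<phi> k ?T u)"
      have "ennreal (\<sigma>\<^sup>2) \<le> (\<integral>\<^sup>+u\<in>{\<tau> i<..}. ennreal ((indicator {0..?T} u * K ?T u)\<^sup>2) \<partial>lborel)"
        by (rule L2[OF i(1)])
      also have "\<dots> = (\<integral>\<^sup>+u. ennreal ((?f u + ?g u + 0)\<^sup>2) \<partial>lborel)"
        unfolding ind by (intro nn_integral_cong) (auto simp: indicator_def)
      also have "\<dots> \<le> 3 * ((\<integral>\<^sup>+u. ennreal ((?f u)\<^sup>2) \<partial>lborel) + (\<integral>\<^sup>+u. ennreal ((?g u)\<^sup>2) \<partial>lborel) + (\<integral>\<^sup>+u. ennreal (0\<^sup>2) \<partial>(lborel :: real measure)))"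
      proof (rule nn_integral_square_3)
        show "?f \<in> borel_measurable borel"
          using i by (intro borel_measurable_times borel_measurable_diff \<phi>m S_mem) auto
        show "?g \<in> borel_measurable borel"
          using borel_measurable_diff[OF Km[OF S_mem[OF i(3)]] \<phi>m[OF S_mem[OF i(3)]]]
          by (intro borel_measurable_times) auto
      qed simp
      also have "\<dots> \<le> 3 * ((\<integral>\<^sup>+u\<in>{\<tau> i<..}. ennreal ((?\<psi> k i u)\<^sup>2) \<partial>lborel) + ennreal (\<sigma>\<^sup>2 / 12) + 0)"
      proof (intro mult_left_mono add_mono)
        show "(\<integral>\<^sup>+u. ennreal ((?f u)\<^sup>2) \<partial>lborel) \<le> (\<integral>\<^sup>+u\<in>{\<tau> i<..}. ennreal ((?\<psi> k i u)\<^sup>2) \<partial>lborel)"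
          by (intro nn_integral_mono) (auto simp: indicator_def)
        have "(\<integral>\<^sup>+u. ennreal ((?g u)\<^sup>2) \<partial>lborel) \<le> ?d k ?T"
          by (intro nn_integral_mono) (auto simp: indicator_def)
        with elim show "(\<integral>\<^sup>+u. ennreal ((?g u)\<^sup>2) \<partial>lborel) \<le> ennreal (\<sigma>\<^sup>2 / 12)" by simp
      qed simp_all
      finally have *: "ennreal (\<sigma>\<^sup>2) \<le> 3 * ((\<integral>\<^sup>+u\<in>{\<tau> i<..}. ennreal ((?\<psi> k i u)\<^sup>2) \<partial>lborel) + ennreal (\<sigma>\<^sup>2 / 12))"
        by simp
      show ?case
      proof (cases "\<integral>\<^sup>+u\<in>{\<tau> i<..}. ennreal ((?\<psi> k i u)\<^sup>2) \<partial>lborel")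
        case (real x)
        with * have "ennreal (\<sigma>\<^sup>2) \<le> ennreal (3 * (x + \<sigma>\<^sup>2 / 12 + 0))"
          using ennreal_three_sum[of x "\<sigma>\<^sup>2 / 12" 0] by simp
        then have "\<sigma>\<^sup>2 \<le> 3 * (x + \<sigma>\<^sup>2 / 12 + 0)" using real(1) by (subst (asm) ennreal_le_iff) auto
        then show ?thesis using real by (simp add: power_divide ennreal_leI)
      qed simp
    qed
  qed
  let ?err = "\<lambda>k. \<Sum>s\<in>S. prob {\<omega>\<in>space M. e / 2 < \<bar>X s \<omega> - Y k s \<omega>\<bar>}"
  let ?L = "prob {\<omega>\<in>space M. \<forall>i<n. \<bar>X (\<tau> (Suc i)) \<omega> - X (\<tau> 0) \<omega>\<bar> \<le> e}"
    and ?R = "measure std_gauss {..4 * e / \<sigma>} ^ n"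
  have "?err \<longlonglongrightarrow> (\<Sum>s\<in>S. 0)"
    using L2_tendsto_imp_prob_tendsto[OF Xm Ym limY, of _ "e / 2"] e by (intro tendsto_sum) simp
  then have "(\<lambda>k. ?R + ?err k) \<longlonglongrightarrow> ?R" using tendsto_add[OF tendsto_const[of ?R]] by fastforce
  moreover have "\<forall>\<^sub>F k in sequentially. ?L \<le> ?R + ?err k" using ev
  proof eventually_elim
    case (elim k)
    have "?L \<le> prob {\<omega>\<in>space M. \<forall>i<n. \<bar>Y k (\<tau> (Suc i)) \<omega> - Y k (\<tau> 0) \<omega>\<bar> \<le> 2 * e} + ?err k"
    proof (rule prob_near_event[OF S(1) Xm Ym])
      have "{\<omega>\<in>space M. \<forall>i\<in>{..<n}. \<bar>Y k (\<tau> (Suc i)) \<omega> - Y k (\<tau> 0) \<omega>\<bar> \<le> 2 * e} \<in> events"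
        "{\<omega>\<in>space M. \<forall>i\<in>{..<n}. \<bar>X (\<tau> (Suc i)) \<omega> - X (\<tau> 0) \<omega>\<bar> \<le> e} \<in> events"
        by (intro sets.sets_Collect_finite_All sets_abs_diff_le Ym Xm S_mem finite_lessThan; simp)+
      then show "{\<omega>\<in>space M. \<forall>i<n. \<bar>Y k (\<tau> (Suc i)) \<omega> - Y k (\<tau> 0) \<omega>\<bar> \<le> 2 * e} \<in> events"
        "{\<omega>\<in>space M. \<forall>i<n. \<bar>X (\<tau> (Suc i)) \<omega> - X (\<tau> 0) \<omega>\<bar> \<le> e} \<in> events"
        by (simp_all only: Ball_def lessThan_iff)
      fix \<omega> assume \<omega>: "\<omega> \<in> {\<omega>\<in>space M. \<forall>i<n. \<bar>X (\<tau> (Suc i)) \<omega> - X (\<tau> 0) \<omega>\<bar> \<le> e}"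
        and near: "\<And>s. s \<in> S \<Longrightarrow> \<bar>X s \<omega> - Y k s \<omega>\<bar> \<le> e / 2"
      have "\<bar>Y k (\<tau> (Suc i)) \<omega> - Y k (\<tau> 0) \<omega>\<bar> \<le> 2 * e" if "i < n" for i
      proof -
        have "\<bar>X (\<tau> (Suc i)) \<omega> - X (\<tau> 0) \<omega>\<bar> \<le> e" using \<omega> that by auto
        moreover have "Suc i \<le> n" using that by simp
        ultimately show ?thesis
          using near[OF S_mem[of "Suc i"]] near[OF S_mem[OF le0]] by linarith
      qed
      with \<omega> show "\<omega> \<in> {\<omega>\<in>space M. \<forall>i<n. \<bar>Y k (\<tau> (Suc i)) \<omega> - Y k (\<tau> 0) \<omega>\<bar> \<le> 2 * e}" by auto
    qed
    also have "prob {\<omega>\<in>space M. \<forall>i<n. \<bar>Y k (\<tau> (Suc i)) \<omega> - Y k (\<tau> 0) \<omega>\<bar> \<le> 2 * e} \<le>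
        measure std_gauss {..2 * e / (\<sigma> / 2)} ^ n"
    proof (rule elementary_small_ball_le[OF N(1) N(2) N(3), where \<tau> = \<tau> and \<phi> = "?\<psi> k"])
      show "elementary_on_grid W (N k) (P k) (?\<psi> k i) (\<lambda>\<omega>. Y k (\<tau> (Suc i)) \<omega> - Y k (\<tau> 0) \<omega>)" if "i < n" for i
        using that by (intro elementary_on_grid_diff el S_mem) auto
      show "\<tau> i \<in> P k ` {..N k}" if "i \<le> n" for i using N(4) S_mem[OF that] by blast
      show "?\<psi> k i u = 0" if "i < n" "\<tau> (Suc i) < u" for i u
        using zero[OF S_mem[of "Suc i"], of u k] zero[OF S_mem[of 0], of u k] \<tau>0[of "Suc i"] that by simp
      show "ennreal ((\<sigma> / 2)\<^sup>2) \<le> (\<integral>\<^sup>+u\<in>{\<tau> i<..}. ennreal ((?\<psi> k i u)\<^sup>2) \<partial>lborel)" if "i < n" for i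
        using elim that by blast
    qed (use \<sigma> e \<tau> in auto)
    finally show ?case by simp
  qed
  ultimately show ?thesis by (rule tendsto_lowerbound) simp
qed

end

section \<open>Estimates for the Volterra kernel\<close>

lemma powr_squared: "(x powr a)\<^sup>2 = x powr (2 * a)" for x a :: real
  by (simp add: power2_eq_square flip: powr_add)

text \<open>Taking logarithms treats both signs of the exponent \<open>b\<close> at once.\<close>

lemma powr_comparable:
  fixes x t q b :: real
  assumes "0 < t" "1 \<le> q" "t / q \<le> x" "x \<le> q * t"
  shows "q powr - \<bar>b\<bar> * t powr b \<le> x powr b" "x powr b \<le> q powr \<bar>b\<bar> * t powr b"
proof -
  have q: "0 < q" and x: "0 < x" using assms by (auto intro: less_le_trans[of 0 "t / q"])
  have y: "1 / q \<le> x / t" "x / t \<le> q" "0 < x / t" using assms q x by (auto simp: field_simps)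
  have "ln (1 / q) \<le> ln (x / t)" "ln (x / t) \<le> ln q" using y q by (subst ln_le_cancel_iff; simp)+
  then have "\<bar>ln (x / t)\<bar> \<le> ln q" using q by (simp add: ln_div abs_le_iff)
  then have "\<bar>b * ln (x / t)\<bar> \<le> \<bar>b\<bar> * ln q" by (simp add: abs_mult mult_left_mono)
  then have "- \<bar>b\<bar> * ln q \<le> b * ln (x / t)" "b * ln (x / t) \<le> \<bar>b\<bar> * ln q" by linarith+
  then have "q powr - \<bar>b\<bar> \<le> (x / t) powr b" "(x / t) powr b \<le> q powr \<bar>b\<bar>"
    using x assms(1) less_imp_neq[OF q] by (simp_all add: powr_def)
  moreover have "x powr b = (x / t) powr b * t powr b" using assms x by (simp add: powr_divide)
  ultimately show "q powr - \<bar>b\<bar> * t powr b \<le> x powr b" "x powr b \<le> q powr \<bar>b\<bar> * t powr b"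
    by (auto intro: mult_right_mono)
qed

lemma powr_singularity:
  fixes g r T :: real
  assumes g: "-1 < g" and T: "r \<le> T"
  shows "set_integrable lborel {r..T} (\<lambda>u. (u - r) powr g)"
    and "(LBINT u:{r..T}. (u - r) powr g) = (T - r) powr (g + 1) / (g + 1)"
proof -
  let ?c = "T - r"
  let ?f = "\<lambda>x. indicator {0..?c} x * x powr g"
  have "((\<lambda>x. x powr g) has_integral (?c powr (g + 1) / (g + 1))) {0..?c}"
    using assms by (intro has_integral_powr_from_0) auto
  then have "(\<integral>\<^sup>+x. ennreal (?f x) \<partial>lborel) = ennreal (?c powr (g + 1) / (g + 1))"
    by (intro nn_integral_has_integral_lebesgue) auto
  then have "has_bochner_integral lborel ?f (?c powr (g + 1) / (g + 1))"
    using g by (intro has_bochner_integral_nn_integral) (auto simp: indicator_def)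
  from lborel_has_bochner_integral_real_affine_iff[THEN iffD1, OF _ this, of 1 "- r"]
  have "has_bochner_integral lborel (\<lambda>x. ?f (- r + x)) (?c powr (g + 1) / (g + 1))" by simp
  moreover have eq: "(\<lambda>x. ?f (- r + x)) = (\<lambda>x. indicator {r..T} x *\<^sub>R (x - r) powr g)"
    by (auto simp: indicator_def fun_eq_iff)
  ultimately have "has_bochner_integral lborel (\<lambda>x. indicator {r..T} x *\<^sub>R (x - r) powr g) (?c powr (g + 1) / (g + 1))"
    by (simp only: eq)
  then show "set_integrable lborel {r..T} (\<lambda>u. (u - r) powr g)"
    "(LBINT u:{r..T}. (u - r) powr g) = (T - r) powr (g + 1) / (g + 1)"
    by (auto simp: set_integrable_def set_lebesgue_integral_def has_bochner_integral_iff)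
qed

lemma volterra_integrand_integrable:
  fixes b g r T :: real
  assumes g: "-1 < g" and r: "0 < r" and A: "A \<in> sets borel" "A \<subseteq> {r..T}"
  shows "set_integrable lborel A (\<lambda>u. u powr b * (u - r) powr g)" "set_integrable lborel A (\<lambda>u. (u - r) powr g)"
proof -
  have "set_integrable lborel A (\<lambda>u. (u - r) powr g) \<and> set_integrable lborel A (\<lambda>u. u powr b * (u - r) powr g)"
  proof (cases "r \<le> T")
    case True
    have *: "set_integrable lborel {r..T} (\<lambda>u. (u - r) powr g)"
      by (rule powr_singularity[OF g True])
    have "set_integrable lborel {r..T} (\<lambda>u. u powr b * (u - r) powr g)"
    proof (rule set_integrable_bound)
      show "set_integrable lborel {r..T} (\<lambda>u. (r powr b + T powr b) * (u - r) powr g)"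
        using * by simp
      show "set_borel_measurable lborel {r..T} (\<lambda>u. u powr b * (u - r) powr g)"
        unfolding set_borel_measurable_def by measurable
      have "u powr b \<le> r powr b + T powr b" if "r \<le> u" "u \<le> T" for u
      proof (cases "0 \<le> b")
        case True
        then have "u powr b \<le> T powr b" using that r by (intro powr_mono2) auto
        then show ?thesis by (simp add: add_increasing)
      next
        case False
        then have "u powr b \<le> r powr b" using that r by (intro powr_mono2') auto
        then show ?thesis by (simp add: add_increasing2)
      qed
      then show "AE u in lborel. u \<in> {r..T} \<longrightarrow>
          norm (u powr b * (u - r) powr g) \<le> norm ((r powr b + T powr b) * (u - r) powr g)"
        by (auto simp: abs_mult intro!: mult_right_mono)
    qed
    with * A show ?thesis by (auto intro: set_integrable_subset)
  next
    case False
    with A have "A = {}" by auto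
    then show ?thesis by (simp add: set_integrable_def)
  qed
  then show "set_integrable lborel A (\<lambda>u. u powr b * (u - r) powr g)" "set_integrable lborel A (\<lambda>u. (u - r) powr g)"
    by auto
qed

text \<open>At times of order \<open>t\<close> the factor \<open>u powr b\<close> can be frozen at
  \<open>t powr b\<close> up to a constant, which leaves the explicitly integrable
  singularity.\<close>

lemma volterra_integral_comparable:
  fixes b g r T t :: real
  assumes g: "-1 < g" and r: "0 < r" and A: "A \<in> sets borel" "A \<subseteq> {r..T}" and t: "0 < t" "A \<subseteq> {t / 2..3 * t / 2}"
  shows "2 powr - \<bar>b\<bar> * t powr b * (LBINT u:A. (u - r) powr g) \<le> (LBINT u:A. u powr b * (u - r) powr g)"
    and "(LBINT u:A. u powr b * (u - r) powr g) \<le> 2 powr \<bar>b\<bar> * t powr b * (LBINT u:A. (u - r) powr g)"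
proof -
  note int = volterra_integrand_integrable[OF g r A]
  have comp: "2 powr - \<bar>b\<bar> * t powr b \<le> u powr b" "u powr b \<le> 2 powr \<bar>b\<bar> * t powr b" if "u \<in> A" for u
    using powr_comparable[of t 2 u b] t that by (auto simp: subset_iff)
  have "(LBINT u:A. (2 powr - \<bar>b\<bar> * t powr b) * (u - r) powr g) \<le> (LBINT u:A. u powr b * (u - r) powr g)"
    using int by (intro set_integral_mono) (auto intro!: mult_right_mono comp)
  then show "2 powr - \<bar>b\<bar> * t powr b * (LBINT u:A. (u - r) powr g) \<le> (LBINT u:A. u powr b * (u - r) powr g)"
    by simp
  have "(LBINT u:A. u powr b * (u - r) powr g) \<le> (LBINT u:A. (2 powr \<bar>b\<bar> * t powr b) * (u - r) powr g)"
    using int by (intro set_integral_mono) (auto intro!: mult_right_mono comp)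
  then show "(LBINT u:A. u powr b * (u - r) powr g) \<le> 2 powr \<bar>b\<bar> * t powr b * (LBINT u:A. (u - r) powr g)"
    by simp
qed

text \<open>Only the first half of the last step, \<open>s\<close> between \<open>T - h\<close> and
  \<open>T - h / 2\<close>, is kept. There \<open>T - s\<close> is at least \<open>h / 2\<close>, so
  the kernel is at least of order
  \<open>t powr (\<alpha> + \<beta>) * h powr (\<gamma> + 1)\<close>; integrating its square over a
  length \<open>h / 2\<close> raises the exponent of \<open>h\<close> to
  \<open>2 * \<gamma> + 3\<close>.\<close>

lemma volterra_kernel_lower:
  fixes \<alpha> \<beta> \<gamma> :: real
  assumes g: "-1 < \<gamma>"
  shows "\<exists>c>0. \<forall>t>0. \<forall>h T. 0 < h \<longrightarrow> t / 2 \<le> T - h \<longrightarrow> T \<le> 3 * t / 2 \<longrightarrow>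
    ennreal ((c * t powr (\<alpha> + \<beta>) * h powr (\<gamma> + 3/2))\<^sup>2) \<le>
      (\<integral>\<^sup>+s\<in>{T - h<..}. ennreal ((indicator {0..T} s * volterra_kernel \<alpha> \<beta> \<gamma> T s)\<^sup>2) \<partial>lborel)"
proof -
  define k where "k = 2 powr - \<bar>\<alpha>\<bar> * 2 powr - \<bar>\<beta>\<bar> * (1 / 2) powr (\<gamma> + 1) / (\<gamma> + 1)"
  have k: "0 < k" using g by (simp add: k_def)
  \<comment> \<open>The square of \<open>w\<close> is the share of the step over which the kernel is
    integrated.\<close>
  define w where "w = sqrt (1 / 2)"
  have w: "0 < w" "w\<^sup>2 = 1 / 2" by (simp_all add: w_def)
  show ?thesis
  proof (intro exI[of _ "k * w"] conjI allI impI)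
    show "0 < k * w" using k w by simp
    fix t h T :: real
    assume t: "0 < t" and h: "0 < h" "t / 2 \<le> T - h" "T \<le> 3 * t / 2"
    let ?K = "volterra_kernel \<alpha> \<beta> \<gamma> T"
    let ?m = "k * t powr (\<alpha> + \<beta>) * h powr (\<gamma> + 1)"
    have low: "?m \<le> ?K s" if s: "s \<in> {T - h<..T - h / 2}" for s
    proof -
      have s0: "0 < s" "s \<le> T" using s t h by auto
      have "2 powr - \<bar>\<alpha>\<bar> * t powr \<alpha> \<le> s powr \<alpha>" using s t h by (intro powr_comparable) auto
      moreover have "2 powr - \<bar>\<beta>\<bar> * t powr \<beta> * ((1 / 2) powr (\<gamma> + 1) * h powr (\<gamma> + 1) / (\<gamma> + 1)) \<le>
          (LBINT u:{s..T}. u powr \<beta> * (u - s) powr \<gamma>)"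
      proof -
        have "(1 / 2) powr (\<gamma> + 1) * h powr (\<gamma> + 1) = (h / 2) powr (\<gamma> + 1)"
          using h by (simp add: powr_divide)
        also have "\<dots> \<le> (T - s) powr (\<gamma> + 1)" using s g h by (intro powr_mono2) auto
        finally have "2 powr - \<bar>\<beta>\<bar> * t powr \<beta> * ((1 / 2) powr (\<gamma> + 1) * h powr (\<gamma> + 1) / (\<gamma> + 1)) \<le>
            2 powr - \<bar>\<beta>\<bar> * t powr \<beta> * (LBINT u:{s..T}. (u - s) powr \<gamma>)"
          unfolding powr_singularity(2)[OF g s0(2)] using g by (intro mult_left_mono divide_right_mono) auto
        also have "\<dots> \<le> (LBINT u:{s..T}. u powr \<beta> * (u - s) powr \<gamma>)"
          using s t h by (intro volterra_integral_comparable(1)[OF g s0(1) _ order.refl t]) auto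
        finally show ?thesis .
      qed
      ultimately have "(2 powr - \<bar>\<alpha>\<bar> * t powr \<alpha>) * (2 powr - \<bar>\<beta>\<bar> * t powr \<beta> * ((1 / 2) powr (\<gamma> + 1) * h powr (\<gamma> + 1) / (\<gamma> + 1))) \<le> ?K s"
        unfolding volterra_kernel_def using g by (intro mult_mono) auto
      then show ?thesis by (simp add: k_def powr_add mult_ac)
    qed
    have "ennreal ((k * w * t powr (\<alpha> + \<beta>) * h powr (\<gamma> + 3/2))\<^sup>2) = ennreal (?m\<^sup>2 * (h / 2))"
    proof -
      have "(h powr (\<gamma> + 3/2))\<^sup>2 = (h powr (\<gamma> + 1))\<^sup>2 * h"
      proof -
        have e: "\<gamma> + 3/2 = (\<gamma> + 1) + 1 / 2" by simp
        have "h powr (\<gamma> + 3/2) = h powr (\<gamma> + 1) * h powr (1 / 2)" unfolding e by (rule powr_add)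
        moreover have "(h powr (1 / 2))\<^sup>2 = h" using h by (subst powr_squared) simp
        ultimately show ?thesis by (simp add: power_mult_distrib)
      qed
      then show ?thesis by (simp add: power_mult_distrib w mult_ac)
    qed
    also have "\<dots> = (\<integral>\<^sup>+s. ennreal (?m\<^sup>2) * indicator {T - h<..T - h / 2} s \<partial>lborel)"
      using h by (simp add: nn_integral_cmult flip: ennreal_mult)
    also have "\<dots> \<le> (\<integral>\<^sup>+s\<in>{T - h<..}. ennreal ((indicator {0..T} s * ?K s)\<^sup>2) \<partial>lborel)"
    proof (rule nn_integral_mono)
      fix s
      show "ennreal (?m\<^sup>2) * indicator {T - h<..T - h / 2} s \<le>
          ennreal ((indicator {0..T} s * ?K s)\<^sup>2) * indicator {T - h<..} s"
      proof (cases "s \<in> {T - h<..T - h / 2}")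
        case True
        moreover have "?m\<^sup>2 \<le> (?K s)\<^sup>2" using low[OF True] k by (intro power_mono) auto
        ultimately show ?thesis using t h by (simp add: ennreal_leI)
      qed simp
    qed
    finally show "ennreal ((k * w * t powr (\<alpha> + \<beta>) * h powr (\<gamma> + 3/2))\<^sup>2) \<le>
      (\<integral>\<^sup>+s\<in>{T - h<..}. ennreal ((indicator {0..T} s * ?K s)\<^sup>2) \<partial>lborel)" .
  qed
qed

text \<open>Two bounds for one integral over the times after \<open>s\<close>. Moving the
  singularity to \<open>s\<close> gives \<open>(s' - s) powr (\<gamma> + 1)\<close>, which is good
  for \<open>r\<close> close to the diagonal. Bounding the decreasing integrand by its value at
  \<open>s\<close> gives \<open>(s' - s) * (s - r) powr \<gamma>\<close>, which is good for
  \<open>r\<close> far below \<open>s\<close>.\<close>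

lemma volterra_kernel_increment_bound:
  fixes \<alpha> \<beta> \<gamma> t s s' r :: real
  assumes g: "-1 < \<gamma>" "\<gamma> < 0" and t: "0 < t" "t / 2 \<le> s" "s < s'" "s' \<le> 3 * t / 2" and r: "0 < r" "r \<le> s'"
  defines "D \<equiv> indicator {0..s'} r * volterra_kernel \<alpha> \<beta> \<gamma> s' r - indicator {0..s} r * volterra_kernel \<alpha> \<beta> \<gamma> s r"
  shows "0 \<le> D"
    and "D \<le> r powr \<alpha> * (2 powr \<bar>\<beta>\<bar> * t powr \<beta> * ((s' - s) powr (\<gamma> + 1) / (\<gamma> + 1)))"
    and "r < s \<Longrightarrow> D \<le> r powr \<alpha> * (2 powr \<bar>\<beta>\<bar> * t powr \<beta> * ((s' - s) * (s - r) powr \<gamma>))"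
proof -
  let ?F = "\<lambda>u. u powr \<beta> * (u - r) powr \<gamma>"
  \<comment> \<open>The part of the integration range for \<open>s'\<close> that is missing for
    \<open>s\<close>: what comes after \<open>s\<close> if \<open>r < s\<close>, and everything
    otherwise.\<close>
  define A where "A = (if r < s then {s<..s'} else {r..s'})"
  have A: "A \<in> sets borel" "A \<subseteq> {r..s'}" "A \<subseteq> {t / 2..3 * t / 2}" using t r by (auto simp: A_def)
  have D: "D = r powr \<alpha> * (LBINT u:A. ?F u)"
  proof (cases "r < s")
    case True
    have "{r..s'} = {r..s} \<union> {s<..s'}" using True t by auto
    then have "(LBINT u:{r..s'}. ?F u) = (LBINT u:{r..s}. ?F u) + (LBINT u:{s<..s'}. ?F u)"
      using True t r by (simp only:) (intro set_integral_Un volterra_integrand_integrable(1)[OF g(1) r(1), of _ s'], auto)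
    then show ?thesis using True t r by (simp add: D_def A_def volterra_kernel_def algebra_simps)
  next
    case False
    have "indicator {0..s} r * volterra_kernel \<alpha> \<beta> \<gamma> s r = 0"
    proof (cases "r = s")
      case True
      \<comment> \<open>On the single point of the domain the integrand vanishes, because
        \<open>0 powr \<gamma>\<close> is \<open>0\<close>.\<close>
      have "(LBINT u:{s}. u powr \<beta> * (u - s) powr \<gamma>) = (LBINT (u::real). 0)"
        unfolding set_lebesgue_integral_def by (intro Bochner_Integration.integral_cong) (auto simp: indicator_def)
      then show ?thesis using True by (simp add: volterra_kernel_def)
    qed (use False in auto)
    then show ?thesis using False r by (simp add: D_def A_def volterra_kernel_def)
  qed
  have "0 \<le> (LBINT u:A. ?F u)"
    unfolding set_lebesgue_integral_def by (intro Bochner_Integration.integral_nonneg) (auto simp: indicator_def)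
  then show "0 \<le> D" by (simp add: D)
  let ?B = "LBINT u:A. (u - r) powr \<gamma>"
  have le: "D \<le> r powr \<alpha> * (2 powr \<bar>\<beta>\<bar> * t powr \<beta> * x)" if "?B \<le> x" for x
  proof -
    have "(LBINT u:A. ?F u) \<le> 2 powr \<bar>\<beta>\<bar> * t powr \<beta> * ?B"
      by (rule volterra_integral_comparable(2)[OF g(1) r(1) A(1,2) t(1) A(3)])
    also have "\<dots> \<le> 2 powr \<bar>\<beta>\<bar> * t powr \<beta> * x" using that by (intro mult_left_mono) auto
    finally show ?thesis unfolding D by (intro mult_left_mono) auto
  qed
  show "D \<le> r powr \<alpha> * (2 powr \<bar>\<beta>\<bar> * t powr \<beta> * ((s' - s) powr (\<gamma> + 1) / (\<gamma> + 1)))"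
  proof (rule le, cases "r < s")
    case True
    have "?B \<le> (LBINT u:A. (u - s) powr \<gamma>)"
    proof (rule set_integral_mono)
      show "set_integrable lborel A (\<lambda>u. (u - r) powr \<gamma>)"
        by (rule volterra_integrand_integrable(2)[OF g(1) r(1) A(1,2)])
      show "set_integrable lborel A (\<lambda>u. (u - s) powr \<gamma>)"
        using True t by (intro volterra_integrand_integrable(2)[OF g(1), of s A s']) (auto simp: A_def)
      show "(u - r) powr \<gamma> \<le> (u - s) powr \<gamma>" if "u \<in> A" for u
        using True g that by (intro powr_mono2') (auto simp: A_def)
    qed
    also have "\<dots> \<le> (LBINT u:{s..s'}. (u - s) powr \<gamma>)"
    proof -
      have "set_integrable lborel {s..s'} (\<lambda>u. (u - s) powr \<gamma>)"
        using t by (intro powr_singularity(1) g) auto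
      moreover from this have "set_integrable lborel A (\<lambda>u. (u - s) powr \<gamma>)"
        by (rule set_integrable_subset) (use True in \<open>auto simp: A_def\<close>)
      ultimately show ?thesis unfolding set_lebesgue_integral_def set_integrable_def
        using True by (intro integral_mono) (auto simp: A_def indicator_def)
    qed
    also have "\<dots> = (s' - s) powr (\<gamma> + 1) / (\<gamma> + 1)" using t by (intro powr_singularity(2) g) auto
    finally show "?B \<le> (s' - s) powr (\<gamma> + 1) / (\<gamma> + 1)" .
  next
    case False
    then have "?B = (s' - r) powr (\<gamma> + 1) / (\<gamma> + 1)"
      unfolding A_def using r by (simp add: powr_singularity(2)[OF g(1)])
    also have "\<dots> \<le> (s' - s) powr (\<gamma> + 1) / (\<gamma> + 1)"
      using False g r by (intro divide_right_mono powr_mono2) auto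
    finally show "?B \<le> (s' - s) powr (\<gamma> + 1) / (\<gamma> + 1)" .
  qed
  show "D \<le> r powr \<alpha> * (2 powr \<bar>\<beta>\<bar> * t powr \<beta> * ((s' - s) * (s - r) powr \<gamma>))" if rs: "r < s"
  proof (rule le)
    have "?B \<le> (LBINT u:A. (s - r) powr \<gamma>)"
    proof (rule set_integral_mono)
      show "set_integrable lborel A (\<lambda>u. (u - r) powr \<gamma>)"
        by (rule volterra_integrand_integrable(2)[OF g(1) r(1) A(1,2)])
      show "set_integrable lborel A (\<lambda>u. (s - r) powr \<gamma>)"
        using rs t by (auto simp: A_def set_integrable_def intro!: integrable_real_indicator)
      show "(u - r) powr \<gamma> \<le> (s - r) powr \<gamma>" if "u \<in> A" for u
        using rs g that by (intro powr_mono2') (auto simp: A_def)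
    qed
    also have "\<dots> = (s' - s) * (s - r) powr \<gamma>"
      using rs t by (simp add: A_def set_lebesgue_integral_def)
    finally show "?B \<le> (s' - s) * (s - r) powr \<gamma>" .
  qed
qed

text \<open>With \<open>h = s' - s\<close>, three zones of \<open>r\<close> contribute
  \<open>k1\<close>, \<open>k2\<close> and \<open>k3\<close>. For \<open>r \<le> t / 4\<close>, the
  singularity of \<open>r powr \<alpha>\<close> is square-integrable because
  \<open>2 * \<alpha> > -1\<close>, and the surplus power \<open>t powr (2 * \<gamma> + 1)\<close>
  is at most \<open>h powr (2 * \<gamma> + 1)\<close> since \<open>h \<le> t\<close> and
  \<open>2 * \<gamma> + 1 < 0\<close>. For \<open>t / 4 < r \<le> s - h\<close>, the integral of
  \<open>(s - r) powr (2 * \<gamma>)\<close> is dominated by its end at distance \<open>h\<close>,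
  again because \<open>2 * \<gamma> < -1\<close>. The rest has length at most \<open>2 * h\<close>
  and is covered by the bound near the diagonal.\<close>

lemma volterra_kernel_upper:
  fixes \<alpha> \<beta> \<gamma> :: real
  assumes a: "-1/2 < \<alpha>" and g: "-1 < \<gamma>" "\<gamma> < -1/2"
  shows "\<exists>C>0. \<forall>t>0. \<forall>s s'. t / 2 \<le> s \<longrightarrow> s < s' \<longrightarrow> s' \<le> 3 * t / 2 \<longrightarrow>
    (\<integral>\<^sup>+r. ennreal ((indicator {0..s'} r * volterra_kernel \<alpha> \<beta> \<gamma> s' r -
        indicator {0..s} r * volterra_kernel \<alpha> \<beta> \<gamma> s r)\<^sup>2) \<partial>lborel)
    \<le> ennreal ((C * t powr (\<alpha> + \<beta>) * (s' - s) powr (\<gamma> + 3/2))\<^sup>2)"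
proof -
  define b where "b = (2 :: real) powr \<bar>\<beta>\<bar>"
  define a4 where "a4 = (4 :: real) powr \<bar>\<alpha>\<bar>"
  define k1 where "k1 = b\<^sup>2 * (1 / 4) powr (2 * \<alpha> + 2 * \<gamma> + 1) / (2 * \<alpha> + 1)"
  define k2 where "k2 = a4\<^sup>2 * b\<^sup>2 / (- 2 * \<gamma> - 1)"
  define k3 where "k3 = a4\<^sup>2 * b\<^sup>2 * 2 / (\<gamma> + 1)\<^sup>2"
  have k: "0 < b" "0 < a4" "0 < k1" "0 < k2" "0 < k3"
    using a g by (simp_all add: b_def a4_def k1_def k2_def k3_def)
  show ?thesis
  proof (intro exI[of _ "sqrt (k1 + k2 + k3)"] conjI allI impI)
    show "0 < sqrt (k1 + k2 + k3)" using k by simp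
    fix t s s' :: real
    assume t: "0 < t" "t / 2 \<le> s" "s < s'" "s' \<le> 3 * t / 2"
    define h where "h = s' - s"
    have h: "0 < h" "h \<le> t" using t by (auto simp: h_def)
    define D where "D r = indicator {0..s'} r * volterra_kernel \<alpha> \<beta> \<gamma> s' r -
        indicator {0..s} r * volterra_kernel \<alpha> \<beta> \<gamma> s r" for r
    define c1 where "c1 = b\<^sup>2 * t powr (2 * \<beta>) * h\<^sup>2 * (t / 4) powr (2 * \<gamma>)"
    define c2 where "c2 = a4\<^sup>2 * b\<^sup>2 * t powr (2 * \<alpha> + 2 * \<beta>) * h\<^sup>2"
    define c3 where "c3 = a4\<^sup>2 * b\<^sup>2 * t powr (2 * \<alpha> + 2 * \<beta>) * (h powr (\<gamma> + 1) / (\<gamma> + 1))\<^sup>2"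
    define f1 where "f1 r = indicator {0..t / 4} r * r powr (2 * \<alpha>)" for r
    \<comment> \<open>The middle zone is extended to minus infinity, where the integral stays finite
      and has a closed form.\<close>
    define f2 where "f2 r = indicator {h..} (s - r) * (s - r) powr (2 * \<gamma>)" for r
    have c: "0 \<le> c1" "0 \<le> c2" "0 \<le> c3" by (simp_all add: c1_def c2_def c3_def)
    have [measurable]: "f1 \<in> borel_measurable borel" "f2 \<in> borel_measurable borel"
      unfolding f1_def[abs_def] f2_def[abs_def] by measurable
    have pt: "(D r)\<^sup>2 \<le> c1 * f1 r + c2 * f2 r + c3 * indicator {s - h..s'} r" for r
    proof -
      have nn: "0 \<le> c1 * f1 r" "0 \<le> c2 * f2 r" "0 \<le> c3 * indicator {s - h..s'} r"
        using c by (simp_all add: f1_def f2_def)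
      show ?thesis
      proof (cases "0 < r \<and> r \<le> s'")
        case False
        \<comment> \<open>At \<open>r = 0\<close> both kernels vanish because
          \<open>0 powr \<alpha>\<close> is \<open>0\<close>; for all other excluded
          \<open>r\<close> both indicators are \<open>0\<close>.\<close>
        then have "D r = 0" using t by (auto simp: D_def indicator_def volterra_kernel_def)
        with nn show ?thesis by simp
      next
        case True
        then have r: "0 < r" "r \<le> s'" by auto
        note D = volterra_kernel_increment_bound[OF g(1) _ t r, of \<alpha> \<beta>, folded D_def h_def b_def]
        have D0: "0 \<le> D r" using D(1) g by simp
        have alpha: "(r powr \<alpha>)\<^sup>2 \<le> a4\<^sup>2 * t powr (2 * \<alpha>)" if "t / 4 < r"
        proof -
          have "r powr \<alpha> \<le> a4 * t powr \<alpha>"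
            unfolding a4_def using that t r by (intro powr_comparable(2)) auto
          then have "(r powr \<alpha>)\<^sup>2 \<le> (a4 * t powr \<alpha>)\<^sup>2" by (intro power_mono) auto
          then show ?thesis by (simp add: power_mult_distrib powr_squared)
        qed
        consider "r \<le> t / 4" | "t / 4 < r" "r \<le> s - h" | "t / 4 < r" "s - h < r" by linarith
        then show ?thesis
        proof cases
          case 1
          then have rs: "r < s" "t / 4 \<le> s - r" using t by auto
          have "(D r)\<^sup>2 \<le> (r powr \<alpha> * (b * t powr \<beta> * (h * (s - r) powr \<gamma>)))\<^sup>2"
            using D(3) g rs D0 by (intro power_mono) auto
          also have "\<dots> = b\<^sup>2 * t powr (2 * \<beta>) * h\<^sup>2 * r powr (2 * \<alpha>) * (s - r) powr (2 * \<gamma>)"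
            by (simp add: power_mult_distrib powr_squared)
          also have "\<dots> \<le> b\<^sup>2 * t powr (2 * \<beta>) * h\<^sup>2 * r powr (2 * \<alpha>) * (t / 4) powr (2 * \<gamma>)"
            using rs g t by (intro mult_left_mono powr_mono2') auto
          also have "\<dots> = c1 * f1 r" using 1 r by (simp add: c1_def f1_def)
          finally show ?thesis using nn by linarith
        next
          case 2
          then have rs: "r < s" using h by auto
          have "(D r)\<^sup>2 \<le> (r powr \<alpha> * (b * t powr \<beta> * (h * (s - r) powr \<gamma>)))\<^sup>2"
            using D(3) g rs D0 by (intro power_mono) auto
          also have "\<dots> = (r powr \<alpha>)\<^sup>2 * (b\<^sup>2 * t powr (2 * \<beta>) * h\<^sup>2 * (s - r) powr (2 * \<gamma>))"
            by (simp add: power_mult_distrib powr_squared)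
          also have "\<dots> \<le> a4\<^sup>2 * t powr (2 * \<alpha>) * (b\<^sup>2 * t powr (2 * \<beta>) * h\<^sup>2 * (s - r) powr (2 * \<gamma>))"
            by (intro mult_right_mono alpha 2) auto
          also have "\<dots> = c2 * f2 r" using 2 by (simp add: c2_def f2_def powr_add)
          finally show ?thesis using nn by linarith
        next
          case 3
          have "(D r)\<^sup>2 \<le> (r powr \<alpha> * (b * t powr \<beta> * (h powr (\<gamma> + 1) / (\<gamma> + 1))))\<^sup>2"
            using D(2) g D0 by (intro power_mono) auto
          also have "\<dots> = (r powr \<alpha>)\<^sup>2 * (b\<^sup>2 * t powr (2 * \<beta>) * (h powr (\<gamma> + 1) / (\<gamma> + 1))\<^sup>2)"
            by (simp add: power_mult_distrib power_divide powr_squared)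
          also have "\<dots> \<le> a4\<^sup>2 * t powr (2 * \<alpha>) * (b\<^sup>2 * t powr (2 * \<beta>) * (h powr (\<gamma> + 1) / (\<gamma> + 1))\<^sup>2)"
            by (intro mult_right_mono alpha 3) auto
          also have "\<dots> = c3 * indicator {s - h..s'} r" using 3 r by (simp add: c3_def powr_add)
          finally show ?thesis using nn by linarith
        qed
      qed
    qed
    have I1: "(\<integral>\<^sup>+r. ennreal (f1 r) \<partial>lborel) = ennreal ((t / 4) powr (2 * \<alpha> + 1) / (2 * \<alpha> + 1))"
      unfolding f1_def using a t by (intro nn_integral_has_integral_lebesgue has_integral_powr_from_0) auto
    have I2: "(\<integral>\<^sup>+r. ennreal (f2 r) \<partial>lborel) = ennreal (h powr (2 * \<gamma> + 1) / (- 2 * \<gamma> - 1))"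
    proof -
      have "(\<integral>\<^sup>+v. ennreal (indicator {h..} v * v powr (2 * \<gamma>)) \<partial>lborel) = ennreal (- (h powr (2 * \<gamma> + 1)) / (2 * \<gamma> + 1))"
        using g h by (intro nn_integral_has_integral_lebesgue has_integral_powr_to_inf) auto
      also have "- (h powr (2 * \<gamma> + 1)) / (2 * \<gamma> + 1) = h powr (2 * \<gamma> + 1) / (- 2 * \<gamma> - 1)"
        using g by (simp add: field_simps)
      also have "(\<integral>\<^sup>+v. ennreal (indicator {h..} v * v powr (2 * \<gamma>)) \<partial>lborel) = (\<integral>\<^sup>+r. ennreal (f2 r) \<partial>lborel)"
        unfolding f2_def by (subst nn_integral_real_affine[where c = "-1" and t = s]) auto
      finally show ?thesis .
    qed
    have hh: "h powr (2 * \<gamma> + 1) * h\<^sup>2 = (h powr (\<gamma> + 3/2))\<^sup>2"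
      using h powr_add[of h "2 * \<gamma> + 1" 2] by (simp add: powr_squared algebra_simps)
    have tt: "t powr (2 * \<alpha> + 2 * \<beta>) = (t powr (\<alpha> + \<beta>))\<^sup>2" by (simp add: powr_squared algebra_simps)
    have J1: "c1 * ((t / 4) powr (2 * \<alpha> + 1) / (2 * \<alpha> + 1)) \<le> k1 * (t powr (\<alpha> + \<beta>) * h powr (\<gamma> + 3/2))\<^sup>2"
    proof -
      have "c1 * ((t / 4) powr (2 * \<alpha> + 1) / (2 * \<alpha> + 1)) =
          k1 * (t powr (2 * \<beta>) * t powr (2 * \<alpha> + 2 * \<gamma> + 1) * h\<^sup>2)"
      proof -
        have "(t / 4) powr (2 * \<gamma>) * (t / 4) powr (2 * \<alpha> + 1) = (t * (1 / 4)) powr (2 * \<alpha> + 2 * \<gamma> + 1)"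
          by (simp add: algebra_simps flip: powr_add)
        also have "\<dots> = t powr (2 * \<alpha> + 2 * \<gamma> + 1) * (1 / 4) powr (2 * \<alpha> + 2 * \<gamma> + 1)"
          by (rule powr_mult)
        finally have e: "(t / 4) powr (2 * \<gamma>) * (t / 4) powr (2 * \<alpha> + 1) =
          t powr (2 * \<alpha> + 2 * \<gamma> + 1) * (1 / 4) powr (2 * \<alpha> + 2 * \<gamma> + 1)" .
        have "c1 * ((t / 4) powr (2 * \<alpha> + 1) / (2 * \<alpha> + 1)) =
          b\<^sup>2 * t powr (2 * \<beta>) * h\<^sup>2 * ((t / 4) powr (2 * \<gamma>) * (t / 4) powr (2 * \<alpha> + 1)) / (2 * \<alpha> + 1)"
          by (simp add: c1_def)
        then show ?thesis by (simp only: e k1_def) (simp add: mult_ac)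
      qed
      also have "\<dots> = k1 * (t powr (2 * \<alpha> + 2 * \<beta>) * (t powr (2 * \<gamma> + 1) * h\<^sup>2))"
        by (simp add: powr_add mult_ac)
      also have "\<dots> \<le> k1 * (t powr (2 * \<alpha> + 2 * \<beta>) * (h powr (2 * \<gamma> + 1) * h\<^sup>2))"
        using h g k by (intro mult_left_mono mult_right_mono powr_mono2') auto
      finally show ?thesis by (simp add: hh tt power_mult_distrib)
    qed
    have J2: "c2 * (h powr (2 * \<gamma> + 1) / (- 2 * \<gamma> - 1)) = k2 * (t powr (\<alpha> + \<beta>) * h powr (\<gamma> + 3/2))\<^sup>2"
      unfolding c2_def k2_def tt power_mult_distrib hh[symmetric] by simp
    have J3: "c3 * (s' - (s - h)) = k3 * (t powr (\<alpha> + \<beta>) * h powr (\<gamma> + 3/2))\<^sup>2"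
    proof -
      have eq: "s' - (s - h) = 2 * h" by (simp add: h_def)
      have h': "(h powr (\<gamma> + 1))\<^sup>2 * h = (h powr (\<gamma> + 3/2))\<^sup>2"
        using h powr_add[of h "2 * \<gamma> + 2" 1] by (simp add: powr_squared algebra_simps)
      show ?thesis
        unfolding eq c3_def k3_def tt power_mult_distrib power_divide h'[symmetric] by simp
    qed
    have "(\<integral>\<^sup>+r. ennreal ((D r)\<^sup>2) \<partial>lborel) \<le>
        (\<integral>\<^sup>+r. ennreal c1 * ennreal (f1 r) + ennreal c2 * ennreal (f2 r) + ennreal c3 * indicator {s - h..s'} r \<partial>lborel)"
    proof (rule nn_integral_mono)
      fix r
      have "ennreal ((D r)\<^sup>2) \<le> ennreal (c1 * f1 r + c2 * f2 r + c3 * indicator {s - h..s'} r)"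
        by (rule ennreal_leI[OF pt])
      also have "\<dots> = ennreal c1 * ennreal (f1 r) + ennreal c2 * ennreal (f2 r) + ennreal c3 * indicator {s - h..s'} r"
        using c by (simp add: ennreal_mult f1_def f2_def ennreal_indicator)
      finally show "ennreal ((D r)\<^sup>2) \<le> ennreal c1 * ennreal (f1 r) + ennreal c2 * ennreal (f2 r) + ennreal c3 * indicator {s - h..s'} r" .
    qed
    also have "\<dots> = ennreal c1 * ennreal ((t / 4) powr (2 * \<alpha> + 1) / (2 * \<alpha> + 1)) +
        ennreal c2 * ennreal (h powr (2 * \<gamma> + 1) / (- 2 * \<gamma> - 1)) + ennreal c3 * ennreal (s' - (s - h))"
      using h t by (simp add: nn_integral_add nn_integral_cmult I1 I2)
    also have "\<dots> = ennreal (c1 * ((t / 4) powr (2 * \<alpha> + 1) / (2 * \<alpha> + 1)) +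
        c2 * (h powr (2 * \<gamma> + 1) / (- 2 * \<gamma> - 1)) + c3 * (s' - (s - h)))"
      using c a g h t by (simp add: ennreal_mult[symmetric] ennreal_plus[symmetric] del: ennreal_plus)
    also have "\<dots> \<le> ennreal ((sqrt (k1 + k2 + k3) * t powr (\<alpha> + \<beta>) * h powr (\<gamma> + 3/2))\<^sup>2)"
    proof (rule ennreal_leI)
      have "(sqrt (k1 + k2 + k3) * t powr (\<alpha> + \<beta>) * h powr (\<gamma> + 3/2))\<^sup>2 =
          (k1 + k2 + k3) * (t powr (\<alpha> + \<beta>) * h powr (\<gamma> + 3/2))\<^sup>2"
        using k by (simp add: power_mult_distrib)
      then show "c1 * ((t / 4) powr (2 * \<alpha> + 1) / (2 * \<alpha> + 1)) +
          c2 * (h powr (2 * \<gamma> + 1) / (- 2 * \<gamma> - 1)) + c3 * (s' - (s - h)) \<le>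
          (sqrt (k1 + k2 + k3) * t powr (\<alpha> + \<beta>) * h powr (\<gamma> + 3/2))\<^sup>2"
        using J1 J2 J3 by (simp add: distrib_right)
    qed
    finally show "(\<integral>\<^sup>+r. ennreal ((indicator {0..s'} r * volterra_kernel \<alpha> \<beta> \<gamma> s' r -
        indicator {0..s} r * volterra_kernel \<alpha> \<beta> \<gamma> s r)\<^sup>2) \<partial>lborel)
      \<le> ennreal ((sqrt (k1 + k2 + k3) * t powr (\<alpha> + \<beta>) * (s' - s) powr (\<gamma> + 3/2))\<^sup>2)"
      by (simp only: D_def h_def)
  qed
qed

section \<open>Small balls of the Volterra process\<close>

lemma std_normal_interval_ge:
  assumes "a \<le> b" "- m \<le> a" "b \<le> m"
  shows "(b - a) * std_normal_density m \<le> measure std_gauss {a..b}"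
proof -
  have m: "std_normal_density m \<le> std_normal_density x" if "x \<in> {a..b}" for x
  proof -
    have "\<bar>x\<bar> \<le> \<bar>m\<bar>" using that assms by auto
    then have "x\<^sup>2 \<le> m\<^sup>2" by (rule abs_le_square_iff[THEN iffD1])
    then show ?thesis by (simp add: std_normal_density_def divide_right_mono)
  qed
  have "ennreal ((b - a) * std_normal_density m) = (\<integral>\<^sup>+x. ennreal (std_normal_density m) * indicator {a..b} x \<partial>lborel)"
    using assms by (simp add: nn_integral_cmult mult.commute flip: ennreal_mult)
  also have "\<dots> \<le> (\<integral>\<^sup>+x. ennreal (std_normal_density x) * indicator {a..b} x \<partial>lborel)"
    using m by (intro nn_integral_mono) (auto simp: indicator_def ennreal_leI)
  also have "\<dots> = emeasure std_gauss {a..b}" by (subst emeasure_density) auto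
  finally show ?thesis by (simp add: std_normal.emeasure_eq_measure)
qed

lemma measure_std_normal_atMost_less_1: "measure std_gauss {..x} < 1"
proof -
  let ?m = "\<bar>x\<bar> + 2"
  have "0 < (x + 2 - (x + 1)) * std_normal_density ?m" by (simp add: normal_density_pos)
  also have "\<dots> \<le> measure std_gauss {x + 1..x + 2}" by (intro std_normal_interval_ge) auto
  finally have "0 < measure std_gauss {x + 1..x + 2}" .
  moreover have "measure std_gauss {..x} + measure std_gauss {x + 1..x + 2} =
      measure std_gauss ({..x} \<union> {x + 1..x + 2})"
    by (intro std_normal.finite_measure_Union[symmetric]) auto
  moreover have "\<dots> \<le> 1" by (rule std_normal.prob_le_1)
  ultimately show ?thesis by linarith
qed

text \<open>One bound for small and large \<open>x\<close>. For \<open>x \<le> 2\<close> the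
  probability is at least \<open>c * x\<close>, and its logarithmic cost is dominated by any
  negative power. For \<open>x > 2\<close> the fourth moment, which is 3, leaves at most
  \<open>3 / x ^ 4\<close> outside, whence the restriction \<open>p \<le> 4\<close>; the
  \<open>6\<close> in \<open>C\<close> is twice this 3, from
  \<open>exp (- 2 * y) \<le> 1 - y\<close>.\<close>

lemma std_normal_small_ball_ge:
  assumes p: "0 < p" "p \<le> 4"
  shows "\<exists>C>0. \<forall>x>0. exp (- C * x powr - p) \<le> measure std_gauss {s. \<bar>s\<bar> \<le> x}"
proof -
  define c where "c = 2 * std_normal_density 2"
  define C where "C = 6 + 1 / p + \<bar>ln c\<bar> * 2 powr p"
  have c: "0 < c" by (simp add: c_def normal_density_pos)
  have C: "0 < C" "6 \<le> C" "1 / p + \<bar>ln c\<bar> * 2 powr p \<le> C" using p by (simp_all add: C_def add_pos_nonneg)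
  have eq: "{s. \<bar>s\<bar> \<le> x} = {- x..x}" for x :: real by auto
  have "exp (- C * x powr - p) \<le> measure std_gauss {s. \<bar>s\<bar> \<le> x}" if x: "0 < x" for x
  proof (cases "x \<le> 2")
    case True
    have "x powr - p = exp (- p * ln x)" using x by (simp add: powr_def)
    then have "- p * ln x \<le> x powr - p" using exp_ge_add_one_self[of "- p * ln x"] by linarith
    then have "- ln x \<le> 1 / p * x powr - p" using p by (simp add: field_simps)
    moreover have "- ln c \<le> \<bar>ln c\<bar> * 2 powr p * x powr - p"
    proof -
      have "1 = 2 powr p * 2 powr - p" by (simp flip: powr_add)
      also have "\<dots> \<le> 2 powr p * x powr - p" using True x p by (intro mult_left_mono powr_mono2') auto
      finally have "\<bar>ln c\<bar> * 1 \<le> \<bar>ln c\<bar> * (2 powr p * x powr - p)" by (intro mult_left_mono) auto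
      then show ?thesis by (simp add: mult.assoc)
    qed
    ultimately have "- ln (c * x) \<le> (1 / p + \<bar>ln c\<bar> * 2 powr p) * x powr - p"
      using c x by (simp add: ln_mult distrib_right)
    also have "\<dots> \<le> C * x powr - p" using C by (intro mult_right_mono) auto
    finally have "exp (- C * x powr - p) \<le> exp (ln (c * x))" by simp
    also have "\<dots> = (x - - x) * std_normal_density 2" using c x by (simp add: c_def)
    also have "\<dots> \<le> measure std_gauss {s. \<bar>s\<bar> \<le> x}"
      unfolding eq using True x by (intro std_normal_interval_ge) auto
    finally show ?thesis .
  next
    case False
    then have x2: "2 < x" by simp
    have x4: "2 ^ 4 \<le> x ^ 4" using x2 by (intro power_mono) auto
    have "measure std_gauss {s\<in>space std_gauss. x ^ 4 \<le> s ^ 4} \<le>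
        (LINT s|std_gauss. s ^ 4) / x ^ 4"
      using std_normal_distribution_even_moments(2)[of 2] x
      by (intro integral_Markov_inequality_measure[where A = "{}"]) auto
    also have "(LINT s|std_gauss. s ^ 4) = 3"
      using std_normal_distribution_even_moments(1)[of 2] by (simp add: fact_numeral)
    finally have tail: "measure std_gauss {s. x ^ 4 \<le> s ^ 4} \<le> 3 / x ^ 4" by simp
    have "1 = measure std_gauss (space std_gauss)" using std_normal.prob_space by simp
    also have "\<dots> \<le> measure std_gauss ({s. \<bar>s\<bar> \<le> x} \<union> {s. x ^ 4 \<le> s ^ 4})"
    proof (rule std_normal.finite_measure_mono)
      show "space std_gauss \<subseteq> {s. \<bar>s\<bar> \<le> x} \<union> {s. x ^ 4 \<le> s ^ 4}"
      proof
        fix s :: real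
        have "x ^ 4 \<le> s ^ 4" if "x < \<bar>s\<bar>" using power_mono[of x "\<bar>s\<bar>" 4] that x by simp
        then show "s \<in> {s. \<bar>s\<bar> \<le> x} \<union> {s. x ^ 4 \<le> s ^ 4}" by (cases "x < \<bar>s\<bar>") auto
      qed
    qed (auto simp: eq)
    also have "\<dots> \<le> measure std_gauss {s. \<bar>s\<bar> \<le> x} + measure std_gauss {s. x ^ 4 \<le> s ^ 4}"
      by (intro measure_Un_le) (auto simp: eq)
    finally have *: "1 - 3 / x ^ 4 \<le> measure std_gauss {s. \<bar>s\<bar> \<le> x}" using tail by simp
    define y where "y = 3 / x ^ 4"
    have y: "0 \<le> y" "y \<le> 1 / 2" using x4 x by (simp_all add: y_def field_simps)
    have "exp (- 2 * y) \<le> 1 - y"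
    proof -
      have "y * (2 * y) \<le> y * 1" using y by (intro mult_left_mono) auto
      then have "1 \<le> (1 - y) * (1 + 2 * y)" by (simp add: algebra_simps)
      also have "\<dots> \<le> (1 - y) * exp (2 * y)" using y exp_ge_add_one_self[of "2 * y"] by (intro mult_left_mono) auto
      finally show ?thesis by (simp add: exp_minus field_simps)
    qed
    moreover have "2 * y \<le> C * x powr - p"
    proof -
      have "2 * y = 6 * x powr - 4" using x by (simp add: y_def powr_minus_divide)
      also have "\<dots> \<le> 6 * x powr - p" using x2 p by (intro mult_left_mono powr_mono) auto
      also have "\<dots> \<le> C * x powr - p" using C by (intro mult_right_mono) auto
      finally show ?thesis .
    qed
    ultimately have "exp (- C * x powr - p) \<le> 1 - y"
      by (smt (verit) exp_le_cancel_iff mult_minus_left)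
    with * show ?thesis by (simp add: y_def)
  qed
  with C(1) show ?thesis by blast
qed

section \<open>Dyadic chaining\<close>

text \<open>This is \<open>\<bar>i - j\<bar>\<close>: one of the two truncated differences vanishes.\<close>

definition dyadic_dist :: "nat \<Rightarrow> nat \<Rightarrow> nat" where
  "dyadic_dist i j = (i - j) + (j - i)"

lemma sum_power_dyadic_dist_le:
  fixes q :: real
  assumes q: "0 < q" "q < 1"
  shows "(\<Sum>j\<le>J. q ^ dyadic_dist j m) \<le> 2 / (1 - q)"
proof -
  have geo: "(\<Sum>i<n. q ^ i) \<le> 1 / (1 - q)" for n
    using q by (simp add: sum_gp_strict divide_right_mono)
  have "(\<Sum>j\<le>J. q ^ dyadic_dist j m) \<le> (\<Sum>j\<in>{..<m} \<union> {m..<m + Suc J}. q ^ dyadic_dist j m)"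
    using q by (intro sum_mono2) auto
  also have "\<dots> = (\<Sum>j<m. q ^ dyadic_dist j m) + (\<Sum>j\<in>{m..<m + Suc J}. q ^ dyadic_dist j m)"
    by (intro sum.union_disjoint) auto
  also have "(\<Sum>j<m. q ^ dyadic_dist j m) \<le> 1 / (1 - q)"
  proof -
    have "(\<Sum>j<m. q ^ dyadic_dist j m) \<le> (\<Sum>j<m. q ^ (m - Suc j))"
      using q by (intro sum_mono power_decreasing) (auto simp: dyadic_dist_def)
    also have "\<dots> = (\<Sum>i<m. q ^ i)" by (rule sum.nat_diff_reindex)
    finally show ?thesis using geo[of m] by linarith
  qed
  also have "(\<Sum>j\<in>{m..<m + Suc J}. q ^ dyadic_dist j m) = (\<Sum>i<Suc J. q ^ i)"
    using sum.shift_bounds_nat_ivl[of "\<lambda>j. q ^ dyadic_dist j m" 0 m "Suc J"]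
    by (simp add: dyadic_dist_def add.commute atLeast0LessThan)
  also have "\<dots> \<le> 1 / (1 - q)" by (rule geo)
  finally show ?thesis by simp
qed

text \<open>A point of level \<open>Suc j\<close> with even index already belongs to level
  \<open>j\<close>, and one with odd index is a single increment away from such a point. Each level
  is therefore charged at most once.\<close>

lemma dyadic_chaining:
  fixes f :: "real \<Rightarrow> real" and e :: "nat \<Rightarrow> real" and a r :: real
  assumes inc: "\<And>j k. j \<le> J \<Longrightarrow> k < 2 ^ j \<Longrightarrow> \<bar>f (a + r * (real k + 1) / 2 ^ j) - f (a + r * real k / 2 ^ j)\<bar> \<le> e j"
    and "j \<le> J" "k \<le> 2 ^ j"
  shows "\<bar>f (a + r * real k / 2 ^ j) - f a\<bar> \<le> (\<Sum>i\<le>j. e i)"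
  using assms(2,3)
proof (induction j arbitrary: k)
  case 0
  have "0 \<le> e 0" using inc[of 0 0] by simp
  moreover have "k = 0 \<or> k = 1" using 0 by auto
  ultimately show ?case using inc[of 0 0] by auto
next
  case (Suc j)
  have e: "0 \<le> e (Suc j)" using inc[of "Suc j" 0] Suc.prems by simp
  have half: "a + r * real (2 * m) / 2 ^ Suc j = a + r * real m / 2 ^ j" for m by simp
  show ?case
  proof (cases "even k")
    case True
    then obtain m where m: "k = 2 * m" by auto
    then have "\<bar>f (a + r * real k / 2 ^ Suc j) - f a\<bar> \<le> (\<Sum>i\<le>j. e i)"
      using Suc.IH[of m] Suc.prems half[of m] by simp
    then show ?thesis using e by simp
  next
    case False
    then obtain m where m: "k = 2 * m + 1" by (elim oddE)
    then have "\<bar>f (a + r * real (2 * m) / 2 ^ Suc j) - f a\<bar> \<le> (\<Sum>i\<le>j. e i)"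
      using Suc.IH[of m] Suc.prems half[of m] by simp
    moreover have "\<bar>f (a + r * real k / 2 ^ Suc j) - f (a + r * real (2 * m) / 2 ^ Suc j)\<bar> \<le> e (Suc j)"
      using inc[of "Suc j" "2 * m"] Suc.prems m by (simp add: add.commute)
    ultimately show ?thesis by simp
  qed
qed

lemma SUP_abs_le_iff:
  fixes f :: "real \<Rightarrow> real"
  assumes f: "continuous_on {t - r..t + r} f" and r: "0 < r"
  shows "(SUP s\<in>{s. \<bar>s\<bar> \<le> r}. \<bar>f (t + s) - f t\<bar>) \<le> e \<longleftrightarrow> (\<forall>s\<in>{- r..r}. \<bar>f (t + s) - f t\<bar> \<le> e)"
proof -
  have eq: "{s. \<bar>s\<bar> \<le> r} = {- r..r}" by auto
  have "continuous_on {- r..r} (\<lambda>s. \<bar>f (t + s) - f t\<bar>)"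
    by (intro continuous_intros continuous_on_compose2[OF f]) auto
  then have "bdd_above ((\<lambda>s. \<bar>f (t + s) - f t\<bar>) ` {- r..r})"
    by (intro bounded_imp_bdd_above compact_imp_bounded compact_continuous_image compact_Icc)
  then show ?thesis unfolding eq using r by (intro cSUP_le_iff) auto
qed

text \<open>By continuity the dyadic points decide the supremum. Countably many conditions make the
  event measurable, and they are what chaining controls.\<close>

lemma SUP_abs_le_iff_dyadic:
  fixes f :: "real \<Rightarrow> real"
  assumes f: "continuous_on {t - r..t + r} f" and r: "0 < r"
  shows "(SUP s\<in>{s. \<bar>s\<bar> \<le> r}. \<bar>f (t + s) - f t\<bar>) \<le> e \<longleftrightarrow>
    (\<forall>j. \<forall>k\<le>2 ^ j. \<bar>f (t - r + 2 * r * real k / 2 ^ j) - f t\<bar> \<le> e)"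
proof -
  have cont: "continuous_on {- r..r} (\<lambda>s. \<bar>f (t + s) - f t\<bar>)"
    by (intro continuous_intros continuous_on_compose2[OF f]) auto
  have "(SUP s\<in>{s. \<bar>s\<bar> \<le> r}. \<bar>f (t + s) - f t\<bar>) \<le> e \<longleftrightarrow> (\<forall>s\<in>{- r..r}. \<bar>f (t + s) - f t\<bar> \<le> e)"
    by (rule SUP_abs_le_iff[OF f r])
  also have "\<dots> \<longleftrightarrow> (\<forall>j. \<forall>k\<le>2 ^ j. \<bar>f (t - r + 2 * r * real k / 2 ^ j) - f t\<bar> \<le> e)"
  proof safe
    fix j k :: nat assume all: "\<forall>s\<in>{- r..r}. \<bar>f (t + s) - f t\<bar> \<le> e" and k: "k \<le> 2 ^ j"
    have "real k \<le> 2 ^ j" using k by (metis of_nat_le_iff of_nat_numeral of_nat_power)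
    then have "2 * r * real k / 2 ^ j \<le> 2 * r" using r by (simp add: field_simps)
    then have "- r + 2 * r * real k / 2 ^ j \<in> {- r..r}" using r by simp
    then have "\<bar>f (t + (- r + 2 * r * real k / 2 ^ j)) - f t\<bar> \<le> e" using all by blast
    then show "\<bar>f (t - r + 2 * r * real k / 2 ^ j) - f t\<bar> \<le> e" by (simp add: algebra_simps)
  next
    fix s assume all: "\<forall>j. \<forall>k\<le>2 ^ j. \<bar>f (t - r + 2 * r * real k / 2 ^ j) - f t\<bar> \<le> e" and s: "s \<in> {- r..r}"
    define x where "x = (s + r) / (2 * r)"
    have x: "0 \<le> x" "x \<le> 1" "s = - r + 2 * r * x" using s r by (auto simp: x_def field_simps)
    define k where "k j = nat \<lfloor>x * 2 ^ j\<rfloor>" for j :: nat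
    have k: "real (k j) \<le> x * 2 ^ j" "x * 2 ^ j - 1 \<le> real (k j)" for j
      using x by (auto simp: k_def)
    have kle: "k j \<le> 2 ^ j" for j
    proof -
      have "real (k j) \<le> 1 * 2 ^ j" using k(1)[of j] x by (meson mult_right_mono order.trans zero_le_numeral zero_le_power)
      then show ?thesis by (metis mult_1 of_nat_le_iff of_nat_numeral of_nat_power)
    qed
    have "(\<lambda>j. real (k j) / 2 ^ j) \<longlonglongrightarrow> x"
    proof (rule tendsto_sandwich[where f = "\<lambda>j. x - (1 / 2) ^ j" and h = "\<lambda>_. x"])
      have "(\<lambda>j. (1 / 2 :: real) ^ j) \<longlonglongrightarrow> 0" by (rule LIMSEQ_realpow_zero) auto
      then show "(\<lambda>j. x - (1 / 2) ^ j) \<longlonglongrightarrow> x" using tendsto_diff[OF tendsto_const[of x]] by fastforce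
      show "\<forall>\<^sub>F j in sequentially. x - (1 / 2) ^ j \<le> real (k j) / 2 ^ j"
      proof (intro always_eventually allI)
        fix j :: nat
        have "x - (1 / 2) ^ j = (x * 2 ^ j - 1) / 2 ^ j" by (simp add: diff_divide_distrib power_divide)
        also have "\<dots> \<le> real (k j) / 2 ^ j" by (intro divide_right_mono k(2)) simp
        finally show "x - (1 / 2) ^ j \<le> real (k j) / 2 ^ j" .
      qed
      show "\<forall>\<^sub>F j in sequentially. real (k j) / 2 ^ j \<le> x"
        using k(1) by (intro always_eventually allI) (simp add: field_simps)
    qed simp
    then have lim: "(\<lambda>j. - r + 2 * r * (real (k j) / 2 ^ j)) \<longlonglongrightarrow> s"
      unfolding x(3) by (intro tendsto_intros)
    have "(\<lambda>j. \<bar>f (t + (- r + 2 * r * (real (k j) / 2 ^ j))) - f t\<bar>) \<longlonglongrightarrow> \<bar>f (t + s) - f t\<bar>"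
    proof (rule continuous_on_tendsto_compose[OF cont lim s])
      have k01: "0 \<le> real (k j) / 2 ^ j" "real (k j) / 2 ^ j \<le> 1" for j
      proof -
        have "real (k j) \<le> 2 ^ j" using kle[of j] by (metis of_nat_le_iff of_nat_numeral of_nat_power)
        then show "0 \<le> real (k j) / 2 ^ j" "real (k j) / 2 ^ j \<le> 1" by simp_all
      qed
      show "\<forall>\<^sub>F j in sequentially. - r + 2 * r * (real (k j) / 2 ^ j) \<in> {- r..r}"
      proof (intro always_eventually allI)
        fix j
        have "0 \<le> 2 * r * (real (k j) / 2 ^ j)"
          using r k01(1)[of j] by (intro mult_nonneg_nonneg) auto
        moreover have "2 * r * (real (k j) / 2 ^ j) \<le> 2 * r * 1"
          using r by (intro mult_left_mono k01) auto
        ultimately show "- r + 2 * r * (real (k j) / 2 ^ j) \<in> {- r..r}" by simp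
      qed
    qed
    moreover have "\<bar>f (t + (- r + 2 * r * (real (k j) / 2 ^ j))) - f t\<bar> \<le> e" for j
      using all kle[of j] by (simp add: algebra_simps)
    ultimately show "\<bar>f (t + s) - f t\<bar> \<le> e" by (intro LIMSEQ_le_const2) auto
  qed
  finally show ?thesis .
qed


section \<open>The scale N and the two exponential bounds\<close>

definition small_ball_scale :: "real \<Rightarrow> real \<Rightarrow> real \<Rightarrow> real \<Rightarrow> real \<Rightarrow> real \<Rightarrow> real" where
  "small_ball_scale \<alpha> \<beta> \<gamma> t r \<epsilon> =
     r * t powr ((2 * \<alpha> + 2 * \<beta>) / (2 * \<gamma> + 3)) * \<epsilon> powr (- 2 / (2 * \<gamma> + 3))"

text \<open>Raising the definition to the power \<open>\<gamma> + 3/2\<close> clears both fractional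
  exponents. The upper bound on \<open>\<epsilon>\<close> is exactly the condition
  \<open>1 < N\<close>.\<close>

lemma small_ball_scale:
  assumes g: "-1 < \<gamma>" and pos: "0 < t" "0 < r" "0 < \<epsilon>"
    and less: "\<epsilon> < t powr (\<alpha> + \<beta>) * r powr (\<gamma> + 3/2)"
  defines "N \<equiv> small_ball_scale \<alpha> \<beta> \<gamma> t r \<epsilon>"
  shows "1 < N" "\<epsilon> = t powr (\<alpha> + \<beta>) * (r / N) powr (\<gamma> + 3/2)"
proof -
  define d where "d = \<gamma> + 3/2"
  have d: "0 < d" using g by (simp add: d_def)
  have N: "0 < N" using pos by (simp add: N_def small_ball_scale_def)
  have e1: "(2 * \<alpha> + 2 * \<beta>) / (2 * \<gamma> + 3) * d = \<alpha> + \<beta>"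
    and e2: "- 2 / (2 * \<gamma> + 3) * d = - 1"
    using g by (simp_all add: d_def field_simps)
  have "N powr d = r powr d * (t powr ((2 * \<alpha> + 2 * \<beta>) / (2 * \<gamma> + 3))) powr d * (\<epsilon> powr (- 2 / (2 * \<gamma> + 3))) powr d"
    by (simp add: N_def small_ball_scale_def powr_mult)
  also have "\<dots> = r powr d * t powr (\<alpha> + \<beta>) * \<epsilon> powr (- 1)" by (simp only: powr_powr e1 e2)
  also have "\<dots> = t powr (\<alpha> + \<beta>) * r powr d / \<epsilon>" using pos by (simp add: powr_minus_divide)
  finally have Nd: "N powr d = t powr (\<alpha> + \<beta>) * r powr d / \<epsilon>" .
  then have "1 < N powr d" using less pos by (simp add: d_def)
  moreover have "N powr d \<le> 1" if "N \<le> 1" using powr_mono2[of d N 1] that N d by simp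
  ultimately show "1 < N" by linarith
  have "\<epsilon> = t powr (\<alpha> + \<beta>) * r powr d / N powr d" using Nd pos by simp
  then show "\<epsilon> = t powr (\<alpha> + \<beta>) * (r / N) powr (\<gamma> + 3/2)"
    using N pos by (simp add: powr_divide d_def)
qed

context standard_brownian_motion
begin

abbreviation small_ball :: "(real \<Rightarrow> 'a \<Rightarrow> real) \<Rightarrow> real \<Rightarrow> real \<Rightarrow> real \<Rightarrow> 'a set" where
  "small_ball X t r \<epsilon> \<equiv> {\<omega>\<in>space M. (SUP s\<in>{s. \<bar>s\<bar> \<le> r}. \<bar>X (t + s) \<omega> - X t \<omega>\<bar>) \<le> \<epsilon>}"

lemma small_ball_eq:
  assumes X: "gaussian_volterra_process M W \<alpha> \<beta> \<gamma> X" and r: "0 < r" "r < t"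
  shows "small_ball X t r \<epsilon> =
      {\<omega>\<in>space M. \<forall>j. \<forall>k\<le>2 ^ j. \<bar>X (t - r + 2 * r * real k / 2 ^ j) \<omega> - X t \<omega>\<bar> \<le> \<epsilon>}"
    and "small_ball X t r \<epsilon> \<in> events"
proof -
  have cont: "continuous_on {t - r..t + r} (\<lambda>s. X s \<omega>)" if "\<omega> \<in> space M" for \<omega>
  proof -
    have "continuous_on {0..} (\<lambda>s. X s \<omega>)"
      using X that by (simp add: gaussian_volterra_process_def)
    then show ?thesis by (rule continuous_on_subset) (use r in auto)
  qed
  show eq: "small_ball X t r \<epsilon> =
      {\<omega>\<in>space M. \<forall>j. \<forall>k\<le>2 ^ j. \<bar>X (t - r + 2 * r * real k / 2 ^ j) \<omega> - X t \<omega>\<bar> \<le> \<epsilon>}"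
    using SUP_abs_le_iff_dyadic[OF cont r(1)] by (intro Collect_cong conj_cong refl)
  have m: "X s \<in> borel_measurable M" if "0 \<le> s" for s
    using X that by (simp add: gaussian_volterra_process_def has_wiener_integral_def)
  have "{\<omega>\<in>space M. \<forall>j. \<forall>k\<in>{..2 ^ j}. \<bar>X (t - r + 2 * r * real k / 2 ^ j) \<omega> - X t \<omega>\<bar> \<le> \<epsilon>} \<in> events"
    using r by (intro sets.sets_Collect_countable_All sets.sets_Collect_finite_All sets_abs_diff_le m) auto
  then show "small_ball X t r \<epsilon> \<in> events" unfolding eq by (simp only: Ball_def atMost_iff)
qed

lemma volterra_small_ball_upper:
  fixes X :: "real \<Rightarrow> 'a \<Rightarrow> real"
  assumes g: "-1 < \<gamma>" and X: "gaussian_volterra_process M W \<alpha> \<beta> \<gamma> X"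
  shows "\<exists>\<kappa>>0. \<forall>t>0. \<forall>r\<in>{0<..<t/2}. \<forall>\<epsilon>. 0 < \<epsilon> \<and> \<epsilon> < t powr (\<alpha> + \<beta>) * r powr (\<gamma> + 3/2) \<longrightarrow>
    prob (small_ball X t r \<epsilon>) \<le> exp (- \<kappa> * small_ball_scale \<alpha> \<beta> \<gamma> t r \<epsilon>)"
proof -
  let ?K = "volterra_kernel \<alpha> \<beta> \<gamma>"
  have wi: "has_wiener_integral M W \<tau> (?K \<tau>) (X \<tau>)" if "0 \<le> \<tau>" for \<tau>
    using X that by (simp add: gaussian_volterra_process_def)
  obtain c where c: "0 < c" and low: "\<And>t h T. 0 < t \<Longrightarrow> 0 < h \<Longrightarrow> t / 2 \<le> T - h \<Longrightarrow> T \<le> 3 * t / 2 \<Longrightarrow>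
    ennreal ((c * t powr (\<alpha> + \<beta>) * h powr (\<gamma> + 3/2))\<^sup>2) \<le>
      (\<integral>\<^sup>+s\<in>{T - h<..}. ennreal ((indicator {0..T} s * ?K T s)\<^sup>2) \<partial>lborel)"
    using volterra_kernel_lower[OF g, of \<alpha> \<beta>] by blast
  \<comment> \<open>The maximum with \<open>1 / 2\<close> keeps \<open>q\<close> positive, so that
    its logarithm is meaningful.\<close>
  define q where "q = max (1 / 2) (measure std_gauss {..4 / c})"
  have q: "0 < q" "q < 1" "measure std_gauss {..4 / c} \<le> q"
    using measure_std_normal_atMost_less_1[of "4 / c"] by (auto simp: q_def)
  show ?thesis
  \<comment> \<open>There will be \<open>\<lfloor>N\<rfloor>\<close> factors \<open>q\<close>, and
    \<open>\<lfloor>N\<rfloor>\<close> is at least \<open>N / 2\<close> because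
    \<open>N > 1\<close>.\<close>
  proof (intro exI[of _ "- ln q / 2"] conjI allI ballI impI)
    show "0 < - ln q / 2" using q by simp
    fix t r \<epsilon> :: real
    assume t: "0 < t" and r: "r \<in> {0<..<t / 2}" and e: "0 < \<epsilon> \<and> \<epsilon> < t powr (\<alpha> + \<beta>) * r powr (\<gamma> + 3/2)"
    define N where "N = small_ball_scale \<alpha> \<beta> \<gamma> t r \<epsilon>"
    have r': "0 < r" "r < t / 2" using r by auto
    have N: "1 < N" "\<epsilon> = t powr (\<alpha> + \<beta>) * (r / N) powr (\<gamma> + 3/2)"
      unfolding N_def using small_ball_scale[OF g t r'(1)] e by auto
    \<comment> \<open>With \<open>\<lfloor>N\<rfloor>\<close> steps, the innovation over each step has standard deviation at least \<open>c * \<epsilon>\<close>.\<close>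
    define n where "n = nat \<lfloor>N\<rfloor>"
    have n: "1 \<le> n" "real n \<le> N" "N < real n + 1" using N(1) by (auto simp: n_def le_nat_iff)
    define h where "h = r / real n"
    have h: "0 < h" "r / N \<le> h" "real n * h = r"
      using n r' N(1) by (auto simp: h_def intro!: divide_left_mono)
    define \<tau> where "\<tau> i = t + real i * h" for i :: nat
    define \<sigma> where "\<sigma> = c * t powr (\<alpha> + \<beta>) * h powr (\<gamma> + 3/2)"
    have \<sigma>: "0 < \<sigma>" using c t h by (simp add: \<sigma>_def)
    have ce: "c * \<epsilon> \<le> \<sigma>"
    proof -
      have "(r / N) powr (\<gamma> + 3/2) \<le> h powr (\<gamma> + 3/2)"
        using h g r' N(1) by (intro powr_mono2) auto
      then show ?thesis unfolding \<sigma>_def N(2) using c by (simp add: mult.assoc mult_left_mono)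
    qed
    have \<tau>r: "\<tau> i - t \<in> {0..r}" if "i \<le> n" for i
    proof -
      have "real i * h \<le> real n * h" using that h by (intro mult_right_mono) auto
      then show ?thesis using h by (simp add: \<tau>_def)
    qed
    \<comment> \<open>Differences are taken from the fixed time \<open>\<tau> 0 = t\<close>, so the
      small ball event bounds them by \<open>\<epsilon>\<close> directly; only the right half of the
      interval is used.\<close>
    let ?E = "{\<omega>\<in>space M. \<forall>i<n. \<bar>X (\<tau> (Suc i)) \<omega> - X (\<tau> 0) \<omega>\<bar> \<le> \<epsilon>}"
    have Xm: "X s \<in> borel_measurable M" if "0 \<le> s" for s
      using wi[OF that] by (simp add: has_wiener_integral_def)
    have "prob (small_ball X t r \<epsilon>) \<le> prob ?E"
    proof (rule finite_measure_mono)
      show "small_ball X t r \<epsilon> \<subseteq> ?E"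
      proof safe
        fix \<omega> i assume \<omega>: "\<omega> \<in> space M" and sup: "(SUP s\<in>{s. \<bar>s\<bar> \<le> r}. \<bar>X (t + s) \<omega> - X t \<omega>\<bar>) \<le> \<epsilon>" and i: "i < n"
        have "continuous_on {0..} (\<lambda>s. X s \<omega>)"
          using X \<omega> by (simp add: gaussian_volterra_process_def)
        then have "continuous_on {t - r..t + r} (\<lambda>s. X s \<omega>)"
          by (rule continuous_on_subset) (use r' in auto)
        with sup r' have "\<forall>s\<in>{- r..r}. \<bar>X (t + s) \<omega> - X t \<omega>\<bar> \<le> \<epsilon>"
          by (subst (asm) SUP_abs_le_iff) auto
        moreover have "\<tau> (Suc i) - t \<in> {- r..r}" using \<tau>r[of "Suc i"] i r' by auto
        ultimately have "\<bar>X (t + (\<tau> (Suc i) - t)) \<omega> - X t \<omega>\<bar> \<le> \<epsilon>" by blast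
        then show "\<bar>X (\<tau> (Suc i)) \<omega> - X (\<tau> 0) \<omega>\<bar> \<le> \<epsilon>" by (simp add: \<tau>_def)
      qed
      have "{\<omega>\<in>space M. \<forall>i\<in>{..<n}. \<bar>X (\<tau> (Suc i)) \<omega> - X (\<tau> 0) \<omega>\<bar> \<le> \<epsilon>} \<in> events"
        using t h by (intro sets.sets_Collect_finite_All sets_abs_diff_le Xm) (auto simp: \<tau>_def)
      then show "?E \<in> events" by (simp only: Ball_def lessThan_iff)
    qed
    also have "prob ?E \<le> measure std_gauss {..4 * \<epsilon> / \<sigma>} ^ n"
    proof (rule wiener_integral_small_ball_le[OF wi])
      show "mono_on {..n} \<tau>" using h by (auto simp: mono_on_def \<tau>_def intro!: mult_right_mono)
      fix i assume i: "i < n"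
      have "\<tau> (Suc i) - h = \<tau> i" by (simp add: \<tau>_def algebra_simps)
      moreover have "\<tau> (Suc i) \<le> 3 * t / 2" "t / 2 \<le> \<tau> i"
        using \<tau>r[of "Suc i"] \<tau>r[of i] i r' by auto
      ultimately show "ennreal (\<sigma>\<^sup>2) \<le> (\<integral>\<^sup>+s\<in>{\<tau> i<..}. ennreal ((indicator {0..\<tau> (Suc i)} s * ?K (\<tau> (Suc i)) s)\<^sup>2) \<partial>lborel)"
        using low[OF t h(1), of "\<tau> (Suc i)"] by (simp add: \<sigma>_def)
    qed (use t \<sigma> e in \<open>auto simp: \<tau>_def\<close>)
    also have "\<dots> \<le> q ^ n"
    proof (rule power_mono)
      have "4 * \<epsilon> / \<sigma> \<le> 4 / c" using ce \<sigma> c by (simp add: field_simps)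
      then have "measure std_gauss {..4 * \<epsilon> / \<sigma>} \<le> measure std_gauss {..4 / c}"
        by (intro std_normal.finite_measure_mono) auto
      with q(3) show "measure std_gauss {..4 * \<epsilon> / \<sigma>} \<le> q" by linarith
    qed simp
    also have "q ^ n = exp (real n * ln q)" using q by (simp add: exp_of_nat_mult)
    also have "\<dots> \<le> exp (- (- ln q / 2) * N)"
    proof -
      have "N / 2 \<le> real n" using n by linarith
      then have "real n * ln q \<le> N / 2 * ln q" using q by (intro mult_right_mono_neg) auto
      then show ?thesis by (simp add: mult.commute)
    qed
    finally show "prob (small_ball X t r \<epsilon>) \<le> exp (- (- ln q / 2) * small_ball_scale \<alpha> \<beta> \<gamma> t r \<epsilon>)"
      by (simp add: N_def)
  qed
qed


lemma volterra_small_ball_lower: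
  fixes X :: "real \<Rightarrow> 'a \<Rightarrow> real"
  assumes a: "-1/2 < \<alpha>" and g: "-1 < \<gamma>" "\<gamma> < -1/2" and X: "gaussian_volterra_process M W \<alpha> \<beta> \<gamma> X"
  shows "\<exists>\<kappa>>0. \<forall>t>0. \<forall>r\<in>{0<..<t/2}. \<forall>\<epsilon>. 0 < \<epsilon> \<and> \<epsilon> < t powr (\<alpha> + \<beta>) * r powr (\<gamma> + 3/2) \<longrightarrow>
    exp (- \<kappa> * small_ball_scale \<alpha> \<beta> \<gamma> t r \<epsilon>) \<le> prob (small_ball X t r \<epsilon>)"
proof -
  let ?K = "volterra_kernel \<alpha> \<beta> \<gamma>"
  let ?g = "\<lambda>x. measure std_gauss {s. \<bar>s\<bar> \<le> x}"
  have wi: "has_wiener_integral M W \<tau> (?K \<tau>) (X \<tau>)" if "0 \<le> \<tau>" for \<tau>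
    using X that by (simp add: gaussian_volterra_process_def)
  have Xm: "X s \<in> borel_measurable M" if "0 \<le> s" for s
    using wi[OF that] by (simp add: has_wiener_integral_def)
  obtain C where C: "0 < C" and up: "\<And>t s s'. 0 < t \<Longrightarrow> t / 2 \<le> s \<Longrightarrow> s < s' \<Longrightarrow> s' \<le> 3 * t / 2 \<Longrightarrow>
    (\<integral>\<^sup>+r. ennreal ((indicator {0..s'} r * ?K s' r - indicator {0..s} r * ?K s r)\<^sup>2) \<partial>lborel)
    \<le> ennreal ((C * t powr (\<alpha> + \<beta>) * (s' - s) powr (\<gamma> + 3/2))\<^sup>2)"
    using volterra_kernel_upper[OF a g, of \<beta>] by blast
  \<comment> \<open>Two exponents: the costs of the levels below the critical one are summable only
    for a small exponent, those above it only for a large one.\<close>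
  obtain C1 where C1: "0 < C1" "\<And>x. 0 < x \<Longrightarrow> exp (- C1 * x powr - (1 / 2)) \<le> ?g x"
    using std_normal_small_ball_ge[of "1 / 2"] by auto
  obtain C2 where C2: "0 < C2" "\<And>x. 0 < x \<Longrightarrow> exp (- C2 * x powr - 4) \<le> ?g x"
    using std_normal_small_ball_ge[of 4] by auto
  define d where "d = \<gamma> + 3/2"
  have d: "1/2 < d" "d < 1" using g by (simp_all add: d_def)
  \<comment> \<open>Put \<open>n = dyadic_dist j m\<close> and let \<open>x\<close> be the tolerance
    at level \<open>j\<close> over four times the deviation there. As \<open>1/2 < d < 1\<close>,
    and including the loss \<open>\<rho> ^ n\<close>, \<open>x\<close> is at least of order
    \<open>2 powr (3 * n / 8)\<close> for levels above \<open>m\<close> and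
    \<open>2 powr (- 9 * n / 8)\<close> below. The \<open>2 ^ j\<close> increments then cost
    \<open>2 powr (m - n / 2)\<close> above with exponent 4, and
    \<open>2 powr (m - 7 * n / 16)\<close> below with exponent 1/2. The number \<open>q\<close> is
    the slower of the two rates.\<close>
  define \<rho> where "\<rho> = (2 :: real) powr (- 1/8)"
  define q where "q = (2 :: real) powr (- 7/16)"
  have \<rho>: "0 < \<rho>" "\<rho> < 1" using powr_less_mono[of "- 1/8" 0 "2::real"] by (simp_all add: \<rho>_def)
  have q: "0 < q" "q < 1" using powr_less_mono[of "- 7/16" 0 "2::real"] by (simp_all add: q_def)
  have \<rho>n: "\<rho> ^ n = 2 powr (- real n / 8)" and qn: "q ^ n = 2 powr (- 7 * real n / 16)" for n
    by (simp_all add: \<rho>_def q_def powr_power mult.commute)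
  \<comment> \<open>Chosen so that the tolerances sum to at most
    \<open>c0 * \<epsilon> * (2 / (1 - \<rho>)) = \<epsilon> / 2\<close>.\<close>
  define c0 where "c0 = (1 - \<rho>) / 4"
  \<comment> \<open>The \<open>4\<close> is the loss in
    \<open>wiener_integral_small_ball_ge\<close>, and \<open>2 powr d\<close> comes from the length
    \<open>2 * r\<close> of the interval. The final halving pays for the gap between
    \<open>N\<close> and \<open>2 powr (real m + 1)\<close>.\<close>
  define c2 where "c2 = c0 / (4 * C * 2 powr d) / 2"
  have c: "0 < c0" "0 < c2" using \<rho> C by (simp_all add: c0_def c2_def)
  define k where "k = C1 * c2 powr - (1 / 2) + C2 * c2 powr - 4"
  have k: "C1 * c2 powr - (1 / 2) \<le> k" "C2 * c2 powr - 4 \<le> k" "0 < k"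
    using C1(1) C2(1) c by (simp_all add: k_def add_pos_pos)
  show ?thesis
  proof (intro exI[of _ "k * (2 / (1 - q))"] conjI allI ballI impI)
    show "0 < k * (2 / (1 - q))" using k q by simp
    fix t r \<epsilon> :: real
    assume t: "0 < t" and r: "r \<in> {0<..<t / 2}" and e: "0 < \<epsilon> \<and> \<epsilon> < t powr (\<alpha> + \<beta>) * r powr (\<gamma> + 3/2)"
    define N where "N = small_ball_scale \<alpha> \<beta> \<gamma> t r \<epsilon>"
    have r': "0 < r" "r < t / 2" using r by auto
    have N: "1 < N" "\<epsilon> = t powr (\<alpha> + \<beta>) * (r / N) powr d"
      unfolding N_def d_def using small_ball_scale[OF g(1) t r'(1)] e by auto
    \<comment> \<open>\<open>m\<close> is the dyadic level whose increments are of order \<open>\<epsilon>\<close>. The tolerances \<open>e' j\<close> decay geometrically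
      on both sides of \<open>m\<close>, hence sum to at most \<open>\<epsilon> / 2\<close>; they decay so slowly that the log-probabilities of the
      levels, bounded with \<open>C1\<close> below \<open>m\<close> and with \<open>C2\<close> above, still sum to a multiple of \<open>2 ^ m \<le> N\<close>.\<close>
    define m where "m = nat \<lfloor>log 2 N\<rfloor>"
    have m: "2 powr real m \<le> N" "N \<le> 2 powr (real m + 1)"
    proof -
      have "0 \<le> log 2 N" using N by simp
      then have "real m \<le> log 2 N" "log 2 N \<le> real m + 1" by (simp_all add: m_def)
      then show "2 powr real m \<le> N" "N \<le> 2 powr (real m + 1)"
        using N(1) by (simp_all add: le_log_iff log_le_iff)
    qed
    define e' where "e' j = c0 * \<epsilon> * \<rho> ^ dyadic_dist j m" for j
    define \<sigma> where "\<sigma> j = C * t powr (\<alpha> + \<beta>) * (2 * r / 2 ^ j) powr d" for j :: nat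
    define \<tau> where "\<tau> j k = t - r + 2 * r * k / 2 ^ j" for j :: nat and k :: real
    \<comment> \<open>Sidak's inequality is for finite families, so the levels are cut off at
      \<open>J\<close>; the lower bound for \<open>E J\<close> will not depend on
      \<open>J\<close>.\<close>
    define L where "L J = (SIGMA j:{..J}. {..<(2::nat) ^ j})" for J :: nat
    define E where "E J = {\<omega>\<in>space M. \<forall>(j, k)\<in>L J. \<bar>X (\<tau> j (real k + 1)) \<omega> - X (\<tau> j (real k)) \<omega>\<bar> \<le> e' j}" for J
    have e'pos: "0 < e' j" and \<sigma>pos: "0 < \<sigma> j" for j
      using c e \<rho> C t r' by (simp_all add: e'_def \<sigma>_def)
    have \<tau>: "t / 2 \<le> \<tau> j (real k)" "\<tau> j (real k) < \<tau> j (real k + 1)" "\<tau> j (real k + 1) \<le> 3 * t / 2"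
      "\<tau> j (real k + 1) - \<tau> j (real k) = 2 * r / 2 ^ j" if "k < 2 ^ j" for j k :: nat
    proof -
      have k: "real k + 1 \<le> 2 ^ j"
        using that by (metis Suc_leI add.commute of_nat_Suc of_nat_le_iff of_nat_numeral of_nat_power)
      show "t / 2 \<le> \<tau> j (real k)"
      proof -
        have "0 \<le> 2 * r * real k / 2 ^ j" using r' by simp
        then show ?thesis using r' unfolding \<tau>_def by linarith
      qed
      show diff: "\<tau> j (real k + 1) - \<tau> j (real k) = 2 * r / 2 ^ j"
        by (simp add: \<tau>_def field_simps)
      have "0 < 2 * r / 2 ^ j" using r' by simp
      with diff show "\<tau> j (real k) < \<tau> j (real k + 1)" by linarith
      have "2 * r * (real k + 1) / 2 ^ j \<le> 2 * r" using k r' by (simp add: pos_divide_le_eq)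
      then show "\<tau> j (real k + 1) \<le> 3 * t / 2" using r' by (simp add: \<tau>_def)
    qed
    have level: "exp (- k * q ^ dyadic_dist j m * N) \<le> ?g (e' j / (4 * \<sigma> j)) ^ 2 ^ j" for j
    proof -
      define x where "x = e' j / (4 * \<sigma> j)"
      have x_eq: "x = 2 * c2 * \<rho> ^ dyadic_dist j m * (2 ^ j / N) powr d"
      proof -
        have \<epsilon>: "\<epsilon> = t powr (\<alpha> + \<beta>) * (r powr d / N powr d)" using N r' by (simp add: powr_divide)
        have \<sigma>: "\<sigma> j = C * t powr (\<alpha> + \<beta>) * (2 powr d * r powr d / (2 ^ j) powr d)"
          using r' by (simp add: \<sigma>_def powr_divide powr_mult)
        have ratio: "(2 ^ j / N) powr d = (2 ^ j) powr d / N powr d"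
          using N by (simp add: powr_divide)
        have "c0 * (T * (A / B)) * R / (4 * (C * T * (D * A / E))) = 2 * (c0 / (4 * C * D) / 2) * R * (E / B)"
          if "0 < T" "0 < A" "0 < B" "0 < D" "0 < E" for T A B D E R :: real
          using that C by (simp add: field_simps)
        then show ?thesis using t r' N unfolding x_def e'_def c2_def ratio \<sigma> by (subst \<epsilon>) auto
      qed
      have x0: "0 < x" unfolding x_def using e'pos \<sigma>pos by simp
      have pow2: "(2 ^ j :: real) = 2 powr real j" by (simp add: powr_realpow)
      have ratio: "2 powr (real j - real m - 1) \<le> 2 ^ j / N"
      proof -
        have "2 powr (real j - real m - 1) = 2 powr real j / 2 powr (real m + 1)"
          by (simp flip: powr_diff add: algebra_simps)
        also have "\<dots> \<le> 2 powr real j / N" using m N(1) by (intro divide_left_mono) auto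
        finally show ?thesis by (simp add: pow2)
      qed
      \<comment> \<open>The step shared by both sides of \<open>m\<close>: from
        \<open>x \<ge> c2 * 2 powr v\<close>, the bound with exponent \<open>p\<close> gives
        \<open>2 ^ j\<close> factors of total cost \<open>k * 2 ^ j * 2 powr (- p * v)\<close>, and
        \<open>v\<close> below is chosen to fit this under
        \<open>k * q ^ dyadic_dist j m * N\<close>.\<close>
      have g_term: "exp (- k * q ^ dyadic_dist j m * N) \<le> ?g x ^ 2 ^ j"
        if C': "0 < C'" "exp (- C' * x powr - p) \<le> ?g x" "C' * c2 powr - p \<le> k"
          and x: "c2 * 2 powr v \<le> x" and p: "0 < p"
          and v: "2 ^ j * 2 powr (- p * v) \<le> q ^ dyadic_dist j m * 2 powr real m"
        for C' p v
      proof -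
        have "x powr - p \<le> (c2 * 2 powr v) powr - p" using x c p by (intro powr_mono2') auto
        also have "\<dots> = c2 powr - p * 2 powr (- p * v)"
          using c by (simp add: powr_mult powr_powr mult.commute)
        finally have "C' * x powr - p \<le> (C' * c2 powr - p) * 2 powr (- p * v)"
          using C'(1) by (simp add: mult.assoc)
        also have "\<dots> \<le> k * 2 powr (- p * v)" using C'(3) by (intro mult_right_mono) auto
        finally have "2 ^ j * (C' * x powr - p) \<le> 2 ^ j * (k * 2 powr (- p * v))"
          by (intro mult_left_mono) auto
        also have "\<dots> = k * (2 ^ j * 2 powr (- p * v))" by simp
        also have "\<dots> \<le> k * (q ^ dyadic_dist j m * 2 powr real m)"
          using k by (intro mult_left_mono v) auto
        also have "\<dots> \<le> k * (q ^ dyadic_dist j m * N)" using k q m by (intro mult_left_mono) auto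
        finally have "exp (- k * q ^ dyadic_dist j m * N) \<le> exp (real (2 ^ j) * (- C' * x powr - p))"
          by (simp add: mult.assoc)
        also have "\<dots> = exp (- C' * x powr - p) ^ 2 ^ j" by (rule exp_of_nat_mult)
        also have "\<dots> \<le> ?g x ^ 2 ^ j" using C'(2) by (intro power_mono) auto
        finally show ?thesis .
      qed
      have "exp (- k * q ^ dyadic_dist j m * N) \<le> ?g x ^ 2 ^ j"
      proof (cases "m \<le> j")
        case True
        define n where "n = j - m"
        have n: "dyadic_dist j m = n" "real j = real m + real n" using True by (auto simp: n_def dyadic_dist_def)
        have "c2 * 2 powr (3 * real n / 8) \<le> x"
        proof -
          have "2 powr (real n / 2 - 1) \<le> 2 powr ((real n - 1) * d)"
          proof (rule powr_mono)
            have "0 \<le> real n * (d - 1 / 2)" "0 \<le> 1 - d" using d by auto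
            then show "real n / 2 - 1 \<le> (real n - 1) * d" by (simp add: algebra_simps)
          qed simp
          also have "\<dots> = (2 powr (real j - real m - 1)) powr d" by (simp add: powr_powr n(2))
          also have "\<dots> \<le> (2 ^ j / N) powr d" using ratio d by (intro powr_mono2) auto
          finally have "2 * c2 * \<rho> ^ n * 2 powr (real n / 2 - 1) \<le> x"
            unfolding x_eq n(1) using c \<rho> by (intro mult_left_mono) auto
          moreover have "2 * c2 * \<rho> ^ n * 2 powr (real n / 2 - 1) = c2 * 2 powr (1 + - real n / 8 + (real n / 2 - 1))"
            unfolding \<rho>n powr_add by simp
          ultimately show ?thesis by simp
        qed
        moreover have "2 ^ j * 2 powr (- 4 * (3 * real n / 8)) \<le> q ^ dyadic_dist j m * 2 powr real m"
          unfolding pow2 qn n powr_add[symmetric] by (intro powr_mono) auto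
        ultimately show ?thesis
          using C2(1) C2(2)[OF x0] k(2) by (intro g_term[of C2 4 "3 * real n / 8"]) auto
      next
        case False
        define n where "n = m - j"
        have n: "dyadic_dist j m = n" "real m = real j + real n" using False by (auto simp: n_def dyadic_dist_def)
        have "c2 * 2 powr (- 9 * real n / 8) \<le> x"
        proof -
          have "2 powr (- real n - 1) \<le> 2 powr ((- real n - 1) * d)"
          proof (rule powr_mono)
            have "(real n + 1) * d \<le> (real n + 1) * 1" using d by (intro mult_left_mono) auto
            then show "- real n - 1 \<le> (- real n - 1) * d" by (simp add: algebra_simps)
          qed simp
          also have "\<dots> = (2 powr (real j - real m - 1)) powr d" by (simp add: powr_powr n(2))
          also have "\<dots> \<le> (2 ^ j / N) powr d" using ratio d by (intro powr_mono2) auto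
          finally have "2 * c2 * \<rho> ^ n * 2 powr (- real n - 1) \<le> x"
            unfolding x_eq n(1) using c \<rho> by (intro mult_left_mono) auto
          moreover have "2 * c2 * \<rho> ^ n * 2 powr (- real n - 1) = c2 * 2 powr (1 + - real n / 8 + (- real n - 1))"
            unfolding \<rho>n powr_add by simp
          ultimately show ?thesis by simp
        qed
        moreover have "2 ^ j * 2 powr (- (1 / 2) * (- 9 * real n / 8)) \<le> q ^ dyadic_dist j m * 2 powr real m"
          unfolding pow2 qn n powr_add[symmetric] by (intro powr_mono) auto
        ultimately show ?thesis
          using C1(1) C1(2)[OF x0] k(1) by (intro g_term[of C1 "1 / 2" "- 9 * real n / 8"]) auto
      qed
      then show ?thesis by (simp only: x_def)
    qed
    have lower: "exp (- (k * (2 / (1 - q))) * N) \<le> prob (E J)" for J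
    proof -
      have "exp (- (k * (2 / (1 - q))) * N) \<le> exp (\<Sum>j\<le>J. - k * q ^ dyadic_dist j m * N)"
      proof -
        have "(\<Sum>j\<le>J. - k * q ^ dyadic_dist j m * N) = - (k * (\<Sum>j\<le>J. q ^ dyadic_dist j m) * N)"
          by (simp add: sum_negf sum_distrib_left sum_distrib_right)
        moreover have "k * (\<Sum>j\<le>J. q ^ dyadic_dist j m) * N \<le> k * (2 / (1 - q)) * N"
          using sum_power_dyadic_dist_le[OF q, of m J] k N by (intro mult_right_mono mult_left_mono) auto
        ultimately show ?thesis by simp
      qed
      also have "\<dots> = (\<Prod>j\<le>J. exp (- k * q ^ dyadic_dist j m * N))" by (simp add: exp_sum)
      also have "\<dots> \<le> (\<Prod>j\<le>J. ?g (e' j / (4 * \<sigma> j)) ^ 2 ^ j)" by (intro prod_mono conjI level) simp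
      also have "\<dots> = (\<Prod>(j, k)\<in>L J. ?g (e' j / (4 * \<sigma> j)))"
        unfolding L_def by (subst prod.Sigma[symmetric]) auto
      also have "\<dots> = (\<Prod>i\<in>L J. ?g (e' (fst i) / (4 * \<sigma> (fst i))))" by (simp add: case_prod_beta')
      also have "\<dots> \<le> prob {\<omega>\<in>space M. \<forall>i\<in>L J. \<bar>X (\<tau> (fst i) (real (snd i) + 1)) \<omega> - X (\<tau> (fst i) (real (snd i))) \<omega>\<bar> \<le> e' (fst i)}"
      proof (rule wiener_integral_small_ball_ge[OF wi])
        show "finite (L J)" by (simp add: L_def)
        fix i assume "i \<in> L J"
        then have i: "snd i < 2 ^ fst i" by (auto simp: L_def)
        show "0 \<le> \<tau> (fst i) (real (snd i) + 1)" "0 \<le> \<tau> (fst i) (real (snd i))"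
          using \<tau>[OF i] t by auto
        show "(\<integral>\<^sup>+s. ennreal ((indicator {0..\<tau> (fst i) (real (snd i) + 1)} s * ?K (\<tau> (fst i) (real (snd i) + 1)) s -
            indicator {0..\<tau> (fst i) (real (snd i))} s * ?K (\<tau> (fst i) (real (snd i))) s)\<^sup>2) \<partial>lborel) \<le> ennreal ((\<sigma> (fst i))\<^sup>2)"
          using up[OF t \<tau>(1,2,3)[OF i]] unfolding \<tau>(4)[OF i] \<sigma>_def d_def .
      qed (use e'pos \<sigma>pos in auto)
      also have "\<dots> = prob (E J)" by (simp only: E_def case_prod_beta')
      finally show ?thesis .
    qed
    \<comment> \<open>Continuity from above turns the bound uniform in \<open>J\<close> into one for
      all levels together.\<close>
    have "decseq E" unfolding decseq_def E_def L_def by fastforce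
    moreover have Em: "range E \<subseteq> events"
    proof safe
      fix J
      have "{\<omega>\<in>space M. \<forall>i\<in>L J. \<bar>X (\<tau> (fst i) (real (snd i) + 1)) \<omega> - X (\<tau> (fst i) (real (snd i))) \<omega>\<bar> \<le> e' (fst i)} \<in> events"
      proof (intro sets.sets_Collect_finite_All sets_abs_diff_le Xm)
        show "finite (L J)" by (simp add: L_def)
        fix i assume "i \<in> L J"
        then have i: "snd i < 2 ^ fst i" by (auto simp: L_def)
        show "0 \<le> \<tau> (fst i) (real (snd i) + 1)" "0 \<le> \<tau> (fst i) (real (snd i))"
          using \<tau>[OF i] t by auto
      qed
      then show "E J \<in> events" by (simp only: E_def case_prod_beta')
    qed
    ultimately have "(\<lambda>J. prob (E J)) \<longlonglongrightarrow> prob (\<Inter>J. E J)" by (intro finite_Lim_measure_decseq)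
    then have "exp (- (k * (2 / (1 - q))) * N) \<le> prob (\<Inter>J. E J)"
      by (rule LIMSEQ_le_const) (use lower in blast)
    also have "\<dots> \<le> prob (small_ball X t r \<epsilon>)"
    proof (rule finite_measure_mono)
      show "small_ball X t r \<epsilon> \<in> events" using small_ball_eq(2)[OF X r'(1)] r' by simp
      show "(\<Inter>J. E J) \<subseteq> small_ball X t r \<epsilon>"
      proof
        fix \<omega> assume \<omega>: "\<omega> \<in> (\<Inter>J. E J)"
        then have sp: "\<omega> \<in> space M" by (auto simp: E_def)
        have chain: "\<bar>X (\<tau> j (real k)) \<omega> - X (t - r) \<omega>\<bar> \<le> \<epsilon> / 2" if k: "k \<le> 2 ^ j" for j k
        proof -
          have inc: "\<bar>X (\<tau> i (real l + 1)) \<omega> - X (\<tau> i (real l)) \<omega>\<bar> \<le> e' i" if "i \<le> j" "l < 2 ^ i" for i l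
            using \<omega> that by (auto simp: E_def L_def)
          have "\<bar>X (t - r + 2 * r * real k / 2 ^ j) \<omega> - X (t - r) \<omega>\<bar> \<le> (\<Sum>i\<le>j. e' i)"
            using inc k unfolding \<tau>_def
            by (intro dyadic_chaining[where f = "\<lambda>s. X s \<omega>" and J = j]) auto
          also have "\<dots> = c0 * \<epsilon> * (\<Sum>i\<le>j. \<rho> ^ dyadic_dist i m)"
            by (simp add: e'_def sum_distrib_left)
          also have "\<dots> \<le> c0 * \<epsilon> * (2 / (1 - \<rho>))"
            using sum_power_dyadic_dist_le[OF \<rho>, of m j] c e by (intro mult_left_mono) auto
          also have "\<dots> = \<epsilon> / 2" using \<rho> by (simp add: c0_def field_simps)
          finally show ?thesis by (simp add: \<tau>_def)
        qed
        \<comment> \<open>Chaining starts at the left end \<open>t - r\<close>. Since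
          \<open>t\<close> is itself a dyadic point, the midpoint, two chains of
          \<open>\<epsilon> / 2\<close> compare any dyadic point with \<open>t\<close>.\<close>
        have mid: "\<tau> 1 (real 1) = t" by (simp add: \<tau>_def)
        then have "\<bar>X t \<omega> - X (t - r) \<omega>\<bar> \<le> \<epsilon> / 2" using chain[of 1 1] by simp
        then have "\<bar>X (\<tau> j (real k)) \<omega> - X t \<omega>\<bar> \<le> \<epsilon>" if "k \<le> 2 ^ j" for j k
          using chain[OF that] by linarith
        then show "\<omega> \<in> small_ball X t r \<epsilon>"
          using sp r' by (subst small_ball_eq(1)[OF X]) (auto simp: \<tau>_def)
      qed
    qed
    finally show "exp (- (k * (2 / (1 - q))) * small_ball_scale \<alpha> \<beta> \<gamma> t r \<epsilon>) \<le> prob (small_ball X t r \<epsilon>)"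
      by (simp only: N_def)
  qed
qed

end

theorem theorem1p2:
  fixes M :: "'a measure" and W X :: "real \<Rightarrow> 'a \<Rightarrow> real" and \<alpha> \<beta> \<gamma> :: real
  assumes "\<alpha> > - 1/2" and "\<gamma> \<in> {-1<..<-1/2}" and "\<alpha> + \<beta> + \<gamma> + 3/2 > 0"
    and "standard_brownian_motion M W"
    and "gaussian_volterra_process M W \<alpha> \<beta> \<gamma> X"
  shows "\<exists>\<kappa>\<^sub>3>0. \<exists>\<kappa>\<^sub>4>0. \<forall>t>0. \<forall>r\<in>{0<..<t/2}. \<forall>\<epsilon>.
    0 < \<epsilon> \<and> \<epsilon> < t powr (\<alpha> + \<beta>) * r powr (\<gamma> + 3/2) \<longrightarrow>
      exp (- \<kappa>\<^sub>3 * r * t powr ((2*\<alpha> + 2*\<beta>) / (2*\<gamma> + 3)) * \<epsilon> powr (- 2 / (2*\<gamma> + 3)))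
        \<le> measure M {\<omega> \<in> space M. (SUP s\<in>{s. \<bar>s\<bar> \<le> r}. \<bar>X (t + s) \<omega> - X t \<omega>\<bar>) \<le> \<epsilon>} \<and>
      measure M {\<omega> \<in> space M. (SUP s\<in>{s. \<bar>s\<bar> \<le> r}. \<bar>X (t + s) \<omega> - X t \<omega>\<bar>) \<le> \<epsilon>}
        \<le> exp (- \<kappa>\<^sub>4 * r * t powr ((2*\<alpha> + 2*\<beta>) / (2*\<gamma> + 3)) * \<epsilon> powr (- 2 / (2*\<gamma> + 3)))"
proof -
  interpret standard_brownian_motion M W by fact
  have g: "-1 < \<gamma>" "\<gamma> < -1/2" using assms(2) by auto
  have scale: "- \<kappa> * r * t powr ((2*\<alpha> + 2*\<beta>) / (2*\<gamma> + 3)) * \<epsilon> powr (- 2 / (2*\<gamma> + 3)) =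
      - \<kappa> * small_ball_scale \<alpha> \<beta> \<gamma> t r \<epsilon>" for \<kappa> t r \<epsilon>
    by (simp add: small_ball_scale_def mult.assoc)
  obtain \<kappa>\<^sub>3 where 3: "0 < \<kappa>\<^sub>3" "\<forall>t>0. \<forall>r\<in>{0<..<t/2}. \<forall>\<epsilon>. 0 < \<epsilon> \<and> \<epsilon> < t powr (\<alpha> + \<beta>) * r powr (\<gamma> + 3/2) \<longrightarrow>
    exp (- \<kappa>\<^sub>3 * small_ball_scale \<alpha> \<beta> \<gamma> t r \<epsilon>) \<le> prob (small_ball X t r \<epsilon>)"
    using volterra_small_ball_lower[OF assms(1) g assms(5)] by blast
  obtain \<kappa>\<^sub>4 where 4: "0 < \<kappa>\<^sub>4" "\<forall>t>0. \<forall>r\<in>{0<..<t/2}. \<forall>\<epsilon>. 0 < \<epsilon> \<and> \<epsilon> < t powr (\<alpha> + \<beta>) * r powr (\<gamma> + 3/2) \<longrightarrow>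
    prob (small_ball X t r \<epsilon>) \<le> exp (- \<kappa>\<^sub>4 * small_ball_scale \<alpha> \<beta> \<gamma> t r \<epsilon>)"
    using volterra_small_ball_upper[OF g(1) assms(5)] by blast
  show ?thesis unfolding scale
  proof (rule exI[of _ \<kappa>\<^sub>3], rule conjI[OF 3(1)], rule exI[of _ \<kappa>\<^sub>4], rule conjI[OF 4(1)], intro allI impI ballI)
    fix t r \<epsilon> :: real
    assume "0 < t" "r \<in> {0<..<t/2}" "0 < \<epsilon> \<and> \<epsilon> < t powr (\<alpha> + \<beta>) * r powr (\<gamma> + 3/2)"
    then show "exp (- \<kappa>\<^sub>3 * small_ball_scale \<alpha> \<beta> \<gamma> t r \<epsilon>) \<le> prob (small_ball X t r \<epsilon>) \<and>
        prob (small_ball X t r \<epsilon>) \<le> exp (- \<kappa>\<^sub>4 * small_ball_scale \<alpha> \<beta> \<gamma> t r \<epsilon>)"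
      using 3(2) 4(2) by simp
  qed
qed

end
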